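(* Consider a single junction $v$ with $n$ incoming and $m$ outgoing roads, $n\le m$, with the piecewise linear discontinuous flux $f$ on every road and a distribution matrix $A=(\beta_{i,j})$ as described in the context. For all constant initial data $u_{i,0}^{\mathrm{in}},\,u_{j,0}^{\mathrm{out}}\in[0,u_{\max}]$, $i=1,\dots,n$, $j=1,\dots,m$ (where for each $j$ with $u_{j,0}^{\mathrm{out}}=u^*$ it is additionally prescribed whether the traffic ahead is free flowing or congested), there exists a unique admissible weak solution $u$ at the junction. Moreover, on each incoming road $i$ the solution is given by the wave $(u_{i,0}^{\mathrm{in}},u_i^{\mathrm{in}})$, and on each outgoing road $j$ the solution is given by the wave $(u_{j,0}^{\mathrm{out}},u_j^{\mathrm{out}})$, where $$u_i^{\mathrm{in}}\in\begin{cases}\{u_{i,0}^{\mathrm{in}}\}\cup(\eta(u_{i,0}^{\mathrm{in}}),u_{\max}], & \text{if } u_{i,0}^{\mathrm{in}}\in[0,f_+^{-1}],\\ \{u_{i,0}^{\mathrm{in}}\}\cup[u^*,u_{\max}], & \text{if } u_{i,0}^{\mathrm{in}}\in(f_+^{-1},u^* ),\\ [u^*,u_{\max}], & \text{if } u_{i,0}^{\mathrm{in}}\in[u^*,u_{\max}],\end{cases}$$ and $$u_j^{\mathrm{out}}\in\begin{cases}[0,u^*], & \text{if } u_{j,0}^{\mathrm{out}}\in[0,u^* ),\\ [0,u^*], & \text{if } u_{j,0}^{\mathrm{out}}=u^* \text{ and free flowing},\\ \{u^*\}\cup[0,f_+^{-1}), & \text{if } u_{j,0}^{\mathrm{out}}=u^*\text{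 and congested},\\ \{u_{j,0}^{\mathrm{out}}\}\cup[0,\eta(u_{j,0}^{\mathrm{out}})), & \text{if } u_{j,0}^{\mathrm{out}}\in(u^*,u_{\max}].\end{cases}$$
   Context: **Flux.** Let $0<u^*<u_{\max}$. The flux $f:[0,u_{\max}]\to[0,\infty)$, the same on every road, is $f(u)=f_1(u)$ for $u\in[0,u^*]$ and $f(u)=f_2(u)$ for $u\in(u^*,u_{\max}]$, where $f_1$ is affine and strictly increasing, $f_2$ is affine and strictly decreasing, $f(0)=f(u_{\max})=0$, and, with $f(u^*-):=f_1(u^* )$ and $f(u^*+):=f_2(u^* )$, one has $f(u^*-)>f(u^*+)$. (Thus $f(u^* )=f(u^*-)$ by convention.) The multivalued version is $\tilde f(u)=\{f(u)\}$ for $u\ne u^*$ and $\tilde f(u^* )=[f(u^*+),f(u^*-)]$. **Notation.** $f_+^{-1}:=f^{-1}(f(u^*+))$, the unique point of $[0,u^* )$ at which $f$ takes the value $f(u^*+)$. The map $\eta:[0,u_{\max}]\to[0,u_{\max}]$ is: for $u\in[0,f_+^{-1}]$, $\eta(u)$ is the unique point of $[u^*,u_{\max}]$ with $f_2(\eta(u))=f(u)$ (so $\eta(f_+^{-1})=u^*$); for $u\in(f_+^{-1},u^* )$, $\eta(u)=u^*$ (with associated flux value $f(u)\in\tilde f(u^* )$); $\eta(u^* )=u^*$; for $u\in(u^*,u_{\max}]$, $\eta(u)$ is the unique point of $[0,f_+^{-1})$ with $f(\eta(u))=f(u)$. **Junction.** The incoming roads are $I_i^{\mathrm{in}}=(a_i^{\mathrm{in}},b_i^{\mathrm{in}})$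 with $a_i^{\mathrm{in}}=-\infty$, $i=1,\dots,n$, and the outgoing roads are $I_j^{\mathrm{out}}=(a_j^{\mathrm{out}},b_j^{\mathrm{out}})$ with $b_j^{\mathrm{out}}=+\infty$, $j=1,\dots,m$; the junction is located at the points $b_i^{\mathrm{in}}$ and $a_j^{\mathrm{out}}$. The distribution matrix $A=(\beta_{i,j})\in[0,1]^{n\times m}$ satisfies $\sum_{j=1}^m\beta_{i,j}=1$ for every $i$, and the following technical condition: with $e_1,\dots,e_n$ the canonical basis of $\mathbb{R}^n$ and $\beta^{(j)}=(\beta_{1,j},\dots,\beta_{n,j})\in\mathbb{R}^n$, put $H_i=\{e_i\}^\perp$ for $i\le n$ and $H_{n+j}=\{\beta^{(j)}\}^\perp$ for $j\le m$; then for every choice of $1\le\ell\le n-1$ indices $1\le k_1<\dots<k_\ell\le n+m$ one has $(1,\dots,1)\notin(H_{k_1}\cap\dots\cap H_{k_\ell})^\perp$. **Weak solution at the junction.** A collection $u$ and $w$ of functions $u_i^{\mathrm{in}},w_i^{\mathrm{in}}:I_i^{\mathrm{in}}\times[0,\infty)\to\mathbb{R}$ and $u_j^{\mathrm{out}},w_j^{\mathrm{out}}:I_j^{\mathrm{out}}\times[0,\infty)\to\mathbb{R}$ with $w_i^{\mathrm{in}}\in\tilde f(u_i^{\mathrm{in}})$ and $w_j^{\mathrm{out}}\in\tilde f(u_j^{\mathrm{out}})$ a.e., such that, for every $T>0$, $$\sum_{i=1}^n\int_0^T\!\!\int_{I_i^{\mathrm{in}}}\bigl(u_i^{\mathrm{in}}\partial_t\phi_i^{\mathrm{in}}+w_i^{\mathrm{in}}\partial_x\phi_i^{\mathrm{in}}\bigr)dx\,dt+\sum_{j=1}^m\int_0^T\!\!\int_{I_j^{\mathrm{out}}}\bigl(u_j^{\mathrm{out}}\partial_t\phi_j^{\mathrm{out}}+w_j^{\mathrm{out}}\partial_x\phi_j^{\mathrm{out}}\bigr)dx\,dt=0$$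 for all $C^1$ test functions $\phi_i^{\mathrm{in}}$, $\phi_j^{\mathrm{out}}$ compactly supported in $(a_i^{\mathrm{in}},b_i^{\mathrm{in}}]\times(0,T)$ and $[a_j^{\mathrm{out}},b_j^{\mathrm{out}})\times(0,T)$ respectively, with $\phi_i^{\mathrm{in}}(b_i^{\mathrm{in}},\cdot)=\phi_j^{\mathrm{out}}(a_j^{\mathrm{out}},\cdot)$ and $\partial_x\phi_i^{\mathrm{in}}(b_i^{\mathrm{in}},\cdot)=\partial_x\phi_j^{\mathrm{out}}(a_j^{\mathrm{out}},\cdot)$ for all $i,j$. The initial data are attained: $u_i^{\mathrm{in}}(\cdot,0)=u_{i,0}^{\mathrm{in}}$, $u_j^{\mathrm{out}}(\cdot,0)=u_{j,0}^{\mathrm{out}}$. **Admissible weak solution.** $(u,w)$ is admissible if 1. $u_i^{\mathrm{in}}(\cdot,t)$ and $u_j^{\mathrm{out}}(\cdot,t)$ have bounded variation for all $i,j$; 2. $(u,w)$ is a weak solution at the junction; 3. $w_j^{\mathrm{out}}(a_j^{\mathrm{out}}+,t)=\sum_{i=1}^n\beta_{i,j}\,w_i^{\mathrm{in}}(b_i^{\mathrm{in}}-,t)$ for all $j$ and $t\ge0$; 4. $\sum_{i=1}^n w_i^{\mathrm{in}}(b_i^{\mathrm{in}}-,t)$ is maximal subject to 2 and 3. **Waves and selection on roads.** Riemann problems on a road are solved by regularization and the convex hull construction. For small $\epsilon>0$ let $f^\epsilon$ be the continuous function equal to $f_1$ on $[0,u^*]$, to $f_2$ on $[u^*+\epsilon,u_{\max}]$,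 and affine on $[u^*,u^*+\epsilon]$. The Riemann solution with left and right states $(u_L,u_R)$ is the limit, as $\epsilon\to0$, of the entropy solution (lower convex hull if $u_L<u_R$, upper concave hull if $u_L>u_R$) of $u_t+f^\epsilon(u)_x=0$ with these data, and $w$ is the corresponding limit of the flux. A state equal to $u^*$ carries a flux value $\omega\in\tilde f(u^* )$ and is represented in the regularized problem by the point of $[u^*,u^*+\epsilon]$ where $f^\epsilon$ equals $\omega$. For an outgoing initial datum equal to $u^*$, $\omega=f(u^*-)$ if the traffic ahead is free flowing and $\omega=f(u^*+)$ if it is congested. On an incoming road, "the wave $(u_{i,0}^{\mathrm{in}},u_i^{\mathrm{in}})$" is the restriction to $x<b_i^{\mathrm{in}}$ of the Riemann solution centered at $x=b_i^{\mathrm{in}}$ with left state $u_{i,0}^{\mathrm{in}}$ and right state $u_i^{\mathrm{in}}$, all of whose waves have nonpositive speed. On an outgoing road, "the wave $(u_{j,0}^{\mathrm{out}},u_j^{\mathrm{out}})$" is the restriction to $x>a_j^{\mathrm{out}}$ of the Riemann solution centered at $x=a_j^{\mathrm{out}}$ with left state $u_j^{\mathrm{out}}$ and right state $u_{j,0}^{\mathrm{out}}$, all of whose waves have nonnegative speed. Existence, uniqueness and the maximization in item 4 are understood among solutions that on each road are of this form.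
   Formalization: Items 3 and 4 of admissibility (flux distribution and maximality) are required for t > 0 instead of t ≥ 0: at t = 0 the fluxes are those of the initial data, which in general violate the distribution rule. *)

theory Defs
  imports "HOL-Analysis.Analysis"
begin

subsection \<open>Flux\<close>

record pl_flux =
  branch1 :: "real \<Rightarrow> real"
  branch2 :: "real \<Rightarrow> real"
  ustar :: real
  umax :: real

definition affine_fun :: "(real \<Rightarrow> real) \<Rightarrow> bool" where
  "affine_fun g \<longleftrightarrow> (\<exists>p q. \<forall>x. g x = p * x + q)"

definition flux :: "pl_flux \<Rightarrow> real \<Rightarrow> real" where
  "flux F u = (if u \<le> ustar F then branch1 F u else branch2 F u)"

definition valid_flux :: "pl_flux \<Rightarrow> bool" where
  "valid_flux F \<longleftrightarrow>
     0 < ustar F \<and> ustar F < umax F \<and>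
     affine_fun (branch1 F) \<and> strict_mono (branch1 F) \<and>
     affine_fun (branch2 F) \<and> strict_antimono_on UNIV (branch2 F) \<and>
     flux F 0 = 0 \<and> flux F (umax F) = 0 \<and>
     branch1 F (ustar F) > branch2 F (ustar F)"

text \<open>The multivalued flux is empty outside \<open>[0, umax]\<close>, so \<open>\<omega> \<in> ftilde F u\<close> also says
  that \<open>u\<close> is an admissible density.\<close>

definition ftilde :: "pl_flux \<Rightarrow> real \<Rightarrow> real set" where
  "ftilde F u =
     (if u = ustar F then {branch2 F (ustar F)..branch1 F (ustar F)}
      else if u \<in> {0..umax F} then {flux F u} else {})"

definition finv_plus :: "pl_flux \<Rightarrow> real" where
  "finv_plus F = (THE u. u \<in> {0..<ustar F} \<and> flux F u = branch2 F (ustar F))"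

definition eta :: "pl_flux \<Rightarrow> real \<Rightarrow> real" where
  "eta F u =
     (if u \<le> finv_plus F then THE v. v \<in> {ustar F..umax F} \<and> branch2 F v = flux F u
      else if u \<le> ustar F then ustar F
      else THE v. v \<in> {0..<finv_plus F} \<and> flux F v = flux F u)"


subsection \<open>Riemann problems on a road\<close>

definition flux_eps :: "pl_flux \<Rightarrow> real \<Rightarrow> real \<Rightarrow> real" where
  "flux_eps F \<epsilon> u =
     (if u \<le> ustar F then branch1 F u
      else if u \<ge> ustar F + \<epsilon> then branch2 F u
      else branch1 F (ustar F) +
           (u - ustar F) / \<epsilon> * (branch2 F (ustar F + \<epsilon>) - branch1 F (ustar F)))"

text \<open>A state is a pair \<open>(u, \<omega>)\<close> with \<open>\<omega> \<in> ftilde F u\<close>.  Only for \<open>u = ustar F\<close> does \<open>\<omega>\<close> carry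
  information; it then selects the point representing the state in the regularized problem.\<close>

definition regularized_state :: "pl_flux \<Rightarrow> real \<Rightarrow> real \<times> real \<Rightarrow> real" where
  "regularized_state F \<epsilon> s =
     (if fst s = ustar F
      then THE p. p \<in> {ustar F..ustar F + \<epsilon>} \<and> flux_eps F \<epsilon> p = snd s
      else fst s)"

definition lower_hull :: "(real \<Rightarrow> real) \<Rightarrow> real \<Rightarrow> real \<Rightarrow> real \<Rightarrow> real" where
  "lower_hull g l r v = Inf {y. (v, y) \<in> convex hull ((\<lambda>z. (z, g z)) ` {l..r})}"

definition upper_hull :: "(real \<Rightarrow> real) \<Rightarrow> real \<Rightarrow> real \<Rightarrow> real \<Rightarrow> real" where
  "upper_hull g l r v = Sup {y. (v, y) \<in> convex hull ((\<lambda>z. (z, g z)) ` {l..r})}"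

text \<open>The entropy solution of \<open>u\<^sub>t + g(u)\<^sub>x = 0\<close> with Riemann data \<open>p\<close> (left) and \<open>q\<close> (right) is
  \<open>u(x,t) = U(x/t)\<close> with \<open>U\<close> the inverse of the derivative of the hull \<open>h\<close> of \<open>g\<close> between \<open>p\<close> and
  \<open>q\<close>.  As \<open>h\<close> may have kinks and affine pieces, ``\<open>\<xi>\<close> is the derivative of \<open>h\<close> at \<open>U \<xi>\<close>'' is
  expressed by sub- and supergradients relative to the interval of states: a kink (or an end
  point) yields a constant state, an affine piece yields a jump at the speed given by its slope,
  where the value of \<open>U\<close> is an arbitrary state of that piece.\<close>

definition entropy_profile :: "(real \<Rightarrow> real) \<Rightarrow> real \<Rightarrow> real \<Rightarrow> (real \<Rightarrow> real) \<Rightarrow> bool" where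
  "entropy_profile g p q U \<longleftrightarrow>
     (if p \<le> q
      then \<forall>\<xi>. U \<xi> \<in> {p..q} \<and>
             (\<forall>v\<in>{p..q}. lower_hull g p q v \<ge> lower_hull g p q (U \<xi>) + \<xi> * (v - U \<xi>))
      else \<forall>\<xi>. U \<xi> \<in> {q..p} \<and>
             (\<forall>v\<in>{q..p}. upper_hull g q p v \<le> upper_hull g q p (U \<xi>) + \<xi> * (v - U \<xi>)))"

text \<open>\<open>U\<close> and \<open>W\<close> are the profiles, in the variable \<open>\<xi> = x/t\<close>, of the density and of the flux of the
  Riemann solution with left state \<open>sL\<close> and right state \<open>sR\<close>.  The limit is
  taken pointwise away from the finitely many rays along which the waves travel; the values on
  these rays are left free.\<close>

definition riemann_solution ::
  "pl_flux \<Rightarrow> real \<times> real \<Rightarrow> real \<times> real \<Rightarrow> (real \<Rightarrow> real) \<Rightarrow> (real \<Rightarrow> real) \<Rightarrow> bool" where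
  "riemann_solution F sL sR U W \<longleftrightarrow>
     (\<exists>Ue S.
        (\<forall>\<^sub>F \<epsilon> in at_right 0.
           entropy_profile (flux_eps F \<epsilon>) (regularized_state F \<epsilon> sL) (regularized_state F \<epsilon> sR) (Ue \<epsilon>)) \<and>
        finite S \<and>
        (\<forall>\<xi>. \<xi> \<notin> S \<longrightarrow>
           ((\<lambda>\<epsilon>. Ue \<epsilon> \<xi>) \<longlongrightarrow> U \<xi>) (at_right 0) \<and>
           ((\<lambda>\<epsilon>. flux_eps F \<epsilon> (Ue \<epsilon> \<xi>)) \<longlongrightarrow> W \<xi>) (at_right 0)))"

text \<open>All waves have nonpositive speed iff the right state is still present on every ray of
  positive speed, and symmetrically for nonnegative speed and the left state.  (So a steep wave,
  whose speed tends to \<open>-\<infinity>\<close> with the regularization, is excluded on outgoing roads.)\<close>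

definition incoming_wave ::
  "pl_flux \<Rightarrow> real \<Rightarrow> real \<times> real \<Rightarrow> real \<times> real \<Rightarrow>
    (real \<Rightarrow> real \<Rightarrow> real) \<Rightarrow> (real \<Rightarrow> real \<Rightarrow> real) \<Rightarrow> bool" where
  "incoming_wave F b s0 s u w \<longleftrightarrow>
     (\<exists>U W. riemann_solution F s0 s U W \<and>
        (\<forall>\<xi>>0. U \<xi> = fst s \<and> W \<xi> = snd s) \<and>
        (\<forall>x<b. \<forall>t>0. u x t = U ((x - b) / t) \<and> w x t = W ((x - b) / t)))"

definition outgoing_wave ::
  "pl_flux \<Rightarrow> real \<Rightarrow> real \<times> real \<Rightarrow> real \<times> real \<Rightarrow>
    (real \<Rightarrow> real \<Rightarrow> real) \<Rightarrow> (real \<Rightarrow> real \<Rightarrow> real) \<Rightarrow> bool" where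
  "outgoing_wave F a s0 s u w \<longleftrightarrow>
     (\<exists>U W. riemann_solution F s s0 U W \<and>
        (\<forall>\<xi><0. U \<xi> = fst s \<and> W \<xi> = snd s) \<and>
        (\<forall>x>a. \<forall>t>0. u x t = U ((x - a) / t) \<and> w x t = W ((x - a) / t)))"

definition outgoing_datum :: "pl_flux \<Rightarrow> real \<Rightarrow> bool \<Rightarrow> real \<times> real" where
  "outgoing_datum F u0 free =
     (u0, if u0 = ustar F then (if free then branch1 F (ustar F) else branch2 F (ustar F))
          else flux F u0)"


subsection \<open>Junction\<close>

text \<open>Roads are indexed by the finite types \<open>'n\<close> (incoming) and \<open>'m\<close> (outgoing).  The incoming road
  \<open>i\<close> is \<open>{..<b i}\<close>, the outgoing road \<open>j\<close> is \<open>{a j<..}\<close>; functions are written \<open>u x t\<close>, and their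
  values outside the road or for \<open>t < 0\<close> are irrelevant.\<close>

record ('n, 'm) junction_sol =
  uin :: "'n \<Rightarrow> real \<Rightarrow> real \<Rightarrow> real"
  win :: "'n \<Rightarrow> real \<Rightarrow> real \<Rightarrow> real"
  uout :: "'m \<Rightarrow> real \<Rightarrow> real \<Rightarrow> real"
  wout :: "'m \<Rightarrow> real \<Rightarrow> real \<Rightarrow> real"

definition constraint_plane :: "real^'m^'n \<Rightarrow> 'n + 'm \<Rightarrow> (real^'n) set" where
  "constraint_plane A k =
     (case k of Inl i \<Rightarrow> orthogonal_comp {axis i 1} | Inr j \<Rightarrow> orthogonal_comp {column j A})"

definition distribution_matrix :: "real^'m^'n \<Rightarrow> bool" where
  "distribution_matrix A \<longleftrightarrow>
     (\<forall>i j. A $ i $ j \<in> {0..1}) \<and>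
     (\<forall>i. (\<Sum>j\<in>UNIV. A $ i $ j) = 1) \<and>
     (\<forall>K :: ('n + 'm) set. 1 \<le> card K \<and> card K \<le> CARD('n) - 1 \<longrightarrow>
        (\<chi> i. 1) \<notin> orthogonal_comp (\<Inter>k\<in>K. constraint_plane A k))"

text \<open>\<open>C\<^sup>1\<close> on a half-closed strip \<open>S\<close>, with one-sided derivatives at the boundary, and compactly
  supported in \<open>S\<close>; \<open>\<phi>x\<close> and \<open>\<phi>t\<close> are the partial derivatives of \<open>\<phi>\<close>.\<close>

definition test_function ::
  "(real \<times> real) set \<Rightarrow> (real \<Rightarrow> real \<Rightarrow> real) \<Rightarrow> (real \<Rightarrow> real \<Rightarrow> real) \<Rightarrow> (real \<Rightarrow> real \<Rightarrow> real) \<Rightarrow> bool" where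
  "test_function S \<phi> \<phi>x \<phi>t \<longleftrightarrow>
     (\<forall>(x, t)\<in>S. ((\<lambda>(x, t). \<phi> x t) has_derivative (\<lambda>(h, k). \<phi>x x t * h + \<phi>t x t * k)) (at (x, t) within S)) \<and>
     continuous_on S (\<lambda>(x, t). \<phi>x x t) \<and> continuous_on S (\<lambda>(x, t). \<phi>t x t) \<and>
     (\<exists>K\<subseteq>S. compact K \<and> (\<forall>(x, t)\<in>S - K. \<phi> x t = 0))"

definition weak_form ::
  "real set \<Rightarrow> real \<Rightarrow> (real \<Rightarrow> real \<Rightarrow> real) \<Rightarrow> (real \<Rightarrow> real \<Rightarrow> real) \<Rightarrow>
    (real \<Rightarrow> real \<Rightarrow> real) \<Rightarrow> (real \<Rightarrow> real \<Rightarrow> real) \<Rightarrow> real" where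
  "weak_form I T u w \<phi>x \<phi>t =
     (LINT t:{0<..<T}|lebesgue. (LINT x:I|lebesgue. u x t * \<phi>t x t + w x t * \<phi>x x t))"

definition road_pair :: "pl_flux \<Rightarrow> real set \<Rightarrow> (real \<Rightarrow> real \<Rightarrow> real) \<Rightarrow> (real \<Rightarrow> real \<Rightarrow> real) \<Rightarrow> bool" where
  "road_pair F I u w \<longleftrightarrow>
     set_borel_measurable lebesgue (I \<times> {0..}) (\<lambda>(x, t). u x t) \<and>
     set_borel_measurable lebesgue (I \<times> {0..}) (\<lambda>(x, t). w x t) \<and>
     (AE (x, t) in lebesgue. x \<in> I \<and> 0 \<le> t \<longrightarrow> w x t \<in> ftilde F (u x t))"

definition weak_solution ::
  "pl_flux \<Rightarrow> ('n::finite \<Rightarrow> real) \<Rightarrow> ('m::finite \<Rightarrow> real) \<Rightarrow> ('n \<Rightarrow> real) \<Rightarrow> ('m \<Rightarrow> real) \<Rightarrow>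
    ('n, 'm) junction_sol \<Rightarrow> bool" where
  "weak_solution F b a uin0 uout0 s \<longleftrightarrow>
     (\<forall>i. road_pair F {..<b i} (uin s i) (win s i)) \<and>
     (\<forall>j. road_pair F {a j<..} (uout s j) (wout s j)) \<and>
     (\<forall>T>0. \<forall>\<phi> \<phi>x \<phi>t \<psi> \<psi>x \<psi>t.
        (\<forall>i. test_function ({..b i} \<times> {0<..<T}) (\<phi> i) (\<phi>x i) (\<phi>t i)) \<and>
        (\<forall>j. test_function ({a j..} \<times> {0<..<T}) (\<psi> j) (\<psi>x j) (\<psi>t j)) \<and>
        (\<forall>i j. \<forall>t\<in>{0<..<T}. \<phi> i (b i) t = \<psi> j (a j) t \<and> \<phi>x i (b i) t = \<psi>x j (a j) t) \<longrightarrow>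
        (\<Sum>i\<in>UNIV. weak_form {..<b i} T (uin s i) (win s i) (\<phi>x i) (\<phi>t i)) +
        (\<Sum>j\<in>UNIV. weak_form {a j<..} T (uout s j) (wout s j) (\<psi>x j) (\<psi>t j)) = 0) \<and>
     (\<forall>i. \<forall>x<b i. uin s i x 0 = uin0 i) \<and>
     (\<forall>j. \<forall>x>a j. uout s j x 0 = uout0 j)"

definition bounded_variation_on :: "real set \<Rightarrow> (real \<Rightarrow> real) \<Rightarrow> bool" where
  "bounded_variation_on I g \<longleftrightarrow>
     (\<exists>C. \<forall>xs. sorted xs \<and> set xs \<subseteq> I \<longrightarrow>
        (\<Sum>k<length xs - 1. \<bar>g (xs ! Suc k) - g (xs ! k)\<bar>) \<le> C)"

text \<open>The one-sided limits are part of the condition.  It is imposed for \<open>t > 0\<close>: at \<open>t = 0\<close> the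
  density is the initial datum, whose fluxes need not satisfy the distribution rule.\<close>

definition distribution_condition ::
  "('n::finite \<Rightarrow> real) \<Rightarrow> ('m::finite \<Rightarrow> real) \<Rightarrow> real^'m^'n \<Rightarrow> ('n, 'm) junction_sol \<Rightarrow> bool" where
  "distribution_condition b a A s \<longleftrightarrow>
     (\<forall>t>0. \<exists>\<gamma> \<delta>.
        (\<forall>i. ((\<lambda>x. win s i x t) \<longlongrightarrow> \<gamma> i) (at_left (b i))) \<and>
        (\<forall>j. ((\<lambda>x. wout s j x t) \<longlongrightarrow> \<delta> j) (at_right (a j))) \<and>
        (\<forall>j. \<delta> j = (\<Sum>i\<in>UNIV. A $ i $ j * \<gamma> i)))"

definition throughput :: "('n::finite \<Rightarrow> real) \<Rightarrow> ('n, 'm) junction_sol \<Rightarrow> real \<Rightarrow> real" where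
  "throughput b s t = (\<Sum>i\<in>UNIV. Lim (at_left (b i)) (\<lambda>x. win s i x t))"

text \<open>\<open>win0 i\<close> is the flux value carried by the incoming initial datum \<open>uin0 i\<close>; \<open>free j\<close> tells
  whether the traffic ahead on the outgoing road \<open>j\<close> is free flowing, and matters only if
  \<open>uout0 j = ustar F\<close>.\<close>

definition wave_form ::
  "pl_flux \<Rightarrow> ('n::finite \<Rightarrow> real) \<Rightarrow> ('m::finite \<Rightarrow> real) \<Rightarrow> ('n \<Rightarrow> real) \<Rightarrow> ('n \<Rightarrow> real) \<Rightarrow>
    ('m \<Rightarrow> real) \<Rightarrow> ('m \<Rightarrow> bool) \<Rightarrow> ('n, 'm) junction_sol \<Rightarrow> bool" where
  "wave_form F b a uin0 win0 uout0 free s \<longleftrightarrow>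
     (\<forall>i. \<exists>v. \<exists>\<omega>\<in>ftilde F v.
        incoming_wave F (b i) (uin0 i, win0 i) (v, \<omega>) (uin s i) (win s i)) \<and>
     (\<forall>j. \<exists>v. \<exists>\<omega>\<in>ftilde F v.
        outgoing_wave F (a j) (outgoing_datum F (uout0 j) (free j)) (v, \<omega>) (uout s j) (wout s j))"

definition admissible ::
  "pl_flux \<Rightarrow> ('n::finite \<Rightarrow> real) \<Rightarrow> ('m::finite \<Rightarrow> real) \<Rightarrow> real^'m^'n \<Rightarrow> ('n \<Rightarrow> real) \<Rightarrow> ('n \<Rightarrow> real) \<Rightarrow>
    ('m \<Rightarrow> real) \<Rightarrow> ('m \<Rightarrow> bool) \<Rightarrow> ('n, 'm) junction_sol \<Rightarrow> bool" where
  "admissible F b a A uin0 win0 uout0 free s \<longleftrightarrow>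
     (\<forall>t\<ge>0. (\<forall>i. bounded_variation_on {..<b i} (\<lambda>x. uin s i x t)) \<and>
            (\<forall>j. bounded_variation_on {a j<..} (\<lambda>x. uout s j x t))) \<and>
     weak_solution F b a uin0 uout0 s \<and>
     distribution_condition b a A s \<and>
     (\<forall>s'. wave_form F b a uin0 win0 uout0 free s' \<and> weak_solution F b a uin0 uout0 s' \<and>
           distribution_condition b a A s' \<longrightarrow>
           (\<forall>t>0. throughput b s' t \<le> throughput b s t))"

definition same_solution ::
  "('n \<Rightarrow> real) \<Rightarrow> ('m \<Rightarrow> real) \<Rightarrow> ('n, 'm) junction_sol \<Rightarrow> ('n, 'm) junction_sol \<Rightarrow> bool" where
  "same_solution b a s s' \<longleftrightarrow>
     (\<forall>i. AE (x, t) in lebesgue. x < b i \<and> 0 \<le> t \<longrightarrow>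
        uin s i x t = uin s' i x t \<and> win s i x t = win s' i x t) \<and>
     (\<forall>j. AE (x, t) in lebesgue. x > a j \<and> 0 \<le> t \<longrightarrow>
        uout s j x t = uout s' j x t \<and> wout s j x t = wout s' j x t)"

definition incoming_states :: "pl_flux \<Rightarrow> real \<Rightarrow> real set" where
  "incoming_states F u0 =
     (if u0 \<le> finv_plus F then {u0} \<union> {eta F u0<..umax F}
      else if u0 < ustar F then {u0} \<union> {ustar F..umax F}
      else {ustar F..umax F})"

definition outgoing_states :: "pl_flux \<Rightarrow> real \<Rightarrow> bool \<Rightarrow> real set" where
  "outgoing_states F u0 free =
     (if u0 < ustar F then {0..ustar F}
      else if u0 = ustar F then (if free then {0..ustar F} else {ustar F} \<union> {0..<finv_plus F})
      else {u0} \<union> {0..<eta F u0})"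

end

theory Submission
  imports Defs
begin

text \<open>On every road the regularized Riemann problem is solved by minimizing (maximizing) the piecewise
  affine function \<open>flux_eps F \<epsilon> u - \<xi> * u\<close>, so the value on the ray \<open>\<xi>\<close> is found by comparing at most
  four vertices.  In the limit, a wave on a road whose speeds have the right sign is determined by its
  flux at the junction, and the fluxes that occur form an interval \<open>[0, capacity]\<close>.  The junction
  problem thereby becomes the linear program of maximizing \<open>\<Sum>\<gamma>\<^sub>i\<close> over a polytope.  If it had two
  solutions, \<open>(1,\<dots>,1)\<close> would lie in the span of the normals of the constraints that are constant along
  the segment joining them; this span has dimension at most \<open>n - 1\<close>, against the technical condition
  on the distribution matrix.  Any profile satisfying the Rankine-Hugoniot relations has a weak form
  that reduces to its flux at the junction, and these contributions cancel as the rows of the matrix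
  sum to one.\<close>

subsection \<open>Optimal states and entropy solutions\<close>

text \<open>The limit \<epsilon> -> 0 is delicate at \<open>ustar F\<close>: the two ends of the
  ramp and the points on it all tend to this density but keep different fluxes, and waves along the
  ramp have speeds tending to -\<infinity>. Such a wave is invisible on incoming roads and excluded
  on outgoing ones, and the flux value of a critical incoming datum is forgotten at once; hence one
  solution serves all choices of \<open>win0\<close>. On the rays along which a wave travels several
  vertices tie and the entropy state is not unique, so profiles are compared only off a finite set
  of rays. The flux at the junction determines the wave on the open road but not the junction state:
  when a shock of speed zero stands exactly at the junction, a free and a congested state give the
  same wave. The capacities are the demand of an incoming road and the supply of an outgoing one; a
  larger flux would need a wave of the wrong sign or leave the range of the flux.\<close>

definition entropy_state :: "(real \<Rightarrow> real) \<Rightarrow> real \<Rightarrow> real \<Rightarrow> real \<Rightarrow> real \<Rightarrow> bool" where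
  "entropy_state g p q \<xi> y \<longleftrightarrow>
     (if p \<le> q
      then y \<in> {p..q} \<and> (\<forall>v\<in>{p..q}. lower_hull g p q v \<ge> lower_hull g p q y + \<xi> * (v - y))
      else y \<in> {q..p} \<and> (\<forall>v\<in>{q..p}. upper_hull g q p v \<le> upper_hull g q p y + \<xi> * (v - y)))"

text \<open>The profile condition couples no two rays, so existence, uniqueness and limits can be
  studied for each fixed \<xi>.\<close>

lemma entropy_profile_iff:
  "entropy_profile g p q U \<longleftrightarrow> (\<forall>\<xi>. entropy_state g p q \<xi> (U \<xi>))"
  by (auto simp: entropy_profile_def entropy_state_def)

text \<open>Signs the objective so that the lower hull (minimize) and the upper hull (maximize) lead
  to one minimization problem.\<close>

definition orient :: "real \<Rightarrow> real \<Rightarrow> real" where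
  "orient p q = (if p \<le> q then 1 else -1)"

text \<open>The epigraph condition \<open>g x \<ge> A + \<xi> * (x - z) + c * \<bar>x - z\<bar>\<close> is convex, hence inherited by the
  hull; so hulls need never be computed, and \<open>c > 0\<close> makes the entropy state unique.\<close>

definition optimal_state :: "(real \<Rightarrow> real) \<Rightarrow> real \<Rightarrow> real \<Rightarrow> real \<Rightarrow> real \<Rightarrow> real \<Rightarrow> bool" where
  "optimal_state g p q \<xi> c z \<longleftrightarrow>
     z \<in> {min p q..max p q} \<and>
     (\<forall>x\<in>{min p q..max p q}.
        orient p q * (g z - \<xi> * z) + c * \<bar>x - z\<bar> \<le> orient p q * (g x - \<xi> * x))"

lemma convex_tent: "0 \<le> c \<Longrightarrow> convex {(v, y :: real). A + \<xi> * (v - z) + c * \<bar>v - z\<bar> \<le> y}"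
proof (rule convexI, clarsimp)
  fix v y v' y' s t :: real
  assume c: "0 \<le> c" and h: "A + \<xi> * (v - z) + c * \<bar>v - z\<bar> \<le> y"
    "A + \<xi> * (v' - z) + c * \<bar>v' - z\<bar> \<le> y'" and st: "0 \<le> s" "0 \<le> t" "s + t = 1"
  have t: "t = 1 - s" using st by simp
  have "s * v + t * v' - z = s * (v - z) + t * (v' - z)"
    by (simp add: t algebra_simps)
  then have "\<bar>s * v + t * v' - z\<bar> \<le> \<bar>s * (v - z)\<bar> + \<bar>t * (v' - z)\<bar>"
    by (metis abs_triangle_ineq)
  then have "\<bar>s * v + t * v' - z\<bar> \<le> s * \<bar>v - z\<bar> + t * \<bar>v' - z\<bar>"
    using st by (simp add: abs_mult)
  then have 1: "c * \<bar>s * v + t * v' - z\<bar> \<le> s * (c * \<bar>v - z\<bar>) + t * (c * \<bar>v' - z\<bar>)"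
    using mult_left_mono[OF _ c, of "\<bar>s * v + t * v' - z\<bar>" "s * \<bar>v - z\<bar> + t * \<bar>v' - z\<bar>"]
    by (simp add: distrib_left mult.left_commute)
  have "s * (A + \<xi> * (v - z) + c * \<bar>v - z\<bar>) + t * (A + \<xi> * (v' - z) + c * \<bar>v' - z\<bar>) \<le> s * y + t * y'"
    using h st by (intro add_mono mult_left_mono) auto
  moreover have "s * (A + \<xi> * (v - z) + c * \<bar>v - z\<bar>) + t * (A + \<xi> * (v' - z) + c * \<bar>v' - z\<bar>)
     = A + \<xi> * (s * v + t * v' - z) + (s * (c * \<bar>v - z\<bar>) + t * (c * \<bar>v' - z\<bar>))"
    unfolding t by (simp add: algebra_simps)
  ultimately show "A + \<xi> * (s * v + t * v' - z) + c * \<bar>s * v + t * v' - z\<bar> \<le> s * y + t * y'"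
    using 1 by linarith
qed

text \<open>The set above the tent is convex and contains the graph of \<open>g\<close>, hence the
  convex hull of the graph; no hull point lies below the tent. At \<open>z\<close> the tent touches
  the graph, which fixes the hull value there.\<close>

lemma lower_hull_tent:
  assumes c: "0 \<le> c" and z: "z \<in> {l..r}"
    and opt: "\<And>x. x \<in> {l..r} \<Longrightarrow> g z - \<xi> * z + c * \<bar>x - z\<bar> \<le> g x - \<xi> * x"
  shows "lower_hull g l r z = g z"
    and "v \<in> {l..r} \<Longrightarrow> g z + \<xi> * (v - z) + c * \<bar>v - z\<bar> \<le> lower_hull g l r v"
proof -
  let ?C = "convex hull ((\<lambda>z. (z, g z)) ` {l..r})"
  have "?C \<subseteq> {(v, y). g z + \<xi> * (v - z) + c * \<bar>v - z\<bar> \<le> y}"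
    using opt by (intro hull_minimal convex_tent c) (fastforce simp: algebra_simps)
  then have lb: "g z + \<xi> * (v - z) + c * \<bar>v - z\<bar> \<le> y" if "(v, y) \<in> ?C" for v y
    using that by auto
  have mem: "(v, g v) \<in> ?C" if "v \<in> {l..r}" for v
    using that by (intro hull_inc) auto
  show tent: "g z + \<xi> * (v - z) + c * \<bar>v - z\<bar> \<le> lower_hull g l r v" if "v \<in> {l..r}" for v
    unfolding lower_hull_def using mem[OF that] lb by (intro cInf_greatest) auto
  have "lower_hull g l r z \<le> g z"
    unfolding lower_hull_def
  proof (rule cInf_lower)
    show "bdd_below {y. (z, y) \<in> ?C}"
      using lb by (intro bdd_belowI[of _ "g z"]) fastforce
  qed (use mem z in auto)
  with tent[OF z] show "lower_hull g l r z = g z" by simp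
qed

text \<open>The reflection (v, y) -> (v, -y) is linear and so commutes with convex hulls; results on
  lower hulls transfer to \<open>- g\<close> with slope -\<xi>.\<close>

lemma upper_hull_eq_lower_hull: "upper_hull g l r v = - lower_hull (\<lambda>x. - g x) l r v"
proof -
  let ?R = "\<lambda>(v :: real, y :: real). (v, - y)"
  have lin: "linear ?R"
    by (rule linearI) auto
  have "convex hull ((\<lambda>z. (z, - g z)) ` {l..r}) = ?R ` (convex hull ((\<lambda>z. (z, g z)) ` {l..r}))"
    unfolding convex_hull_linear_image[OF lin] by (simp add: image_image)
  moreover have "(v, y) \<in> ?R ` X \<longleftrightarrow> y \<in> uminus ` {y. (v, y) \<in> X}" for X y
    by force
  ultimately have "{y. (v, y) \<in> convex hull ((\<lambda>z. (z, - g z)) ` {l..r})} =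
      uminus ` {y. (v, y) \<in> convex hull ((\<lambda>z. (z, g z)) ` {l..r})}"
    by simp
  then show ?thesis
    by (simp add: upper_hull_def lower_hull_def Inf_real_def image_image)
qed

text \<open>With \<open>c = 0\<close> the tent is a supporting line, which is what a subgradient of
  the hull amounts to.\<close>

lemma optimal_imp_entropy_state:
  assumes "optimal_state g p q \<xi> 0 z"
  shows "entropy_state g p q \<xi> z"
proof (cases "p \<le> q")
  case True
  then show ?thesis
    using assms lower_hull_tent[of 0 z p q g \<xi>]
    by (auto simp: entropy_state_def optimal_state_def orient_def)
next
  case False
  then show ?thesis
    using assms lower_hull_tent[of 0 z q p "\<lambda>x. - g x" "- \<xi>"]
    by (auto simp: entropy_state_def optimal_state_def orient_def upper_hull_eq_lower_hull
        min_def max_def algebra_simps)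
qed

text \<open>The subgradient inequality at \<open>y\<close>, evaluated at \<open>z\<close>, and the
  tent at \<open>z\<close>, evaluated at \<open>y\<close>, add up to c * |y - z| \<le> 0.\<close>

lemma entropy_state_unique:
  assumes opt: "optimal_state g p q \<xi> c z" and c: "0 < c" and y: "entropy_state g p q \<xi> y"
  shows "y = z"
proof (rule ccontr)
  assume "y \<noteq> z"
  then have gap: "0 < c * \<bar>y - z\<bar>" using c by simp
  show False
  proof (cases "p \<le> q")
    case True
    then have "g z + \<xi> * (y - z) + c * \<bar>y - z\<bar> \<le> lower_hull g p q y" "lower_hull g p q z = g z"
      using lower_hull_tent[of c z p q g \<xi>] opt c y
      by (auto simp: entropy_state_def optimal_state_def orient_def)
    moreover have "lower_hull g p q z \<ge> lower_hull g p q y + \<xi> * (z - y)"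
      using True y opt by (auto simp: entropy_state_def optimal_state_def)
    ultimately show False using gap by (simp add: algebra_simps)
  next
    case False
    then have zy: "z \<in> {q..p}" "y \<in> {q..p}"
      using opt y by (auto simp: entropy_state_def optimal_state_def orient_def min_def max_def)
    have *: "- g z - (- \<xi>) * z + c * \<bar>x - z\<bar> \<le> - g x - (- \<xi>) * x" if "x \<in> {q..p}" for x
      using False opt y that by (auto simp: entropy_state_def optimal_state_def orient_def min_def max_def)
    have "- g z - \<xi> * (y - z) + c * \<bar>y - z\<bar> \<le> lower_hull (\<lambda>x. - g x) q p y"
        "lower_hull (\<lambda>x. - g x) q p z = - g z"
      using lower_hull_tent[of c z q p "\<lambda>x. - g x" "- \<xi>", OF _ zy(1) *] zy(2) c by auto
    moreover have "upper_hull g q p z \<le> upper_hull g q p y + \<xi> * (z - y)"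
      using False y opt by (auto simp: entropy_state_def optimal_state_def)
    ultimately show False using gap by (simp add: algebra_simps upper_hull_eq_lower_hull)
  qed
qed

text \<open>The graph of an affine function over [l, r] is the segment between its end points, and
  the set above a tent is convex; the comparison at both ends therefore spreads to the whole
  interval.\<close>

lemma affine_above_tent:
  fixes h :: "real \<Rightarrow> real"
  assumes aff: "\<And>x. x \<in> {l..r} \<Longrightarrow> h x = P + Q * x" and c: "0 \<le> c" and x: "x \<in> {l..r}"
    and l: "A + c * \<bar>l - z\<bar> \<le> h l" and r: "A + c * \<bar>r - z\<bar> \<le> h r"
  shows "A + c * \<bar>x - z\<bar> \<le> h x"
proof -
  \<comment> \<open>Slope zero, because in the applications \<open>h\<close> already contains the
    term with \<xi>.\<close>
  have "(l, h l) \<in> {(v, y). A + 0 * (v - z) + c * \<bar>v - z\<bar> \<le> y}"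
    "(r, h r) \<in> {(v, y). A + 0 * (v - z) + c * \<bar>v - z\<bar> \<le> y}" using l r by auto
  then have sub: "closed_segment (l, h l) (r, h r) \<subseteq> {(v, y). A + 0 * (v - z) + c * \<bar>v - z\<bar> \<le> y}"
    by (intro closed_segment_subset convex_tent c)
  have "x \<in> closed_segment l r" using x by (simp add: closed_segment_eq_real_ivl)
  then obtain t where t: "0 \<le> t" "t \<le> 1" "x = (1 - t) * l + t * r"
    by (auto simp: closed_segment_def)
  have "h x = (1 - t) * h l + t * h r"
    unfolding aff[OF x] using aff[of l] aff[of r] x by (simp add: t(3) algebra_simps)
  then have "(x, h x) \<in> closed_segment (l, h l) (r, h r)"
    using t by (auto simp: closed_segment_def intro!: exI[of _ t])
  then show ?thesis using sub by auto
qed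

text \<open>The limit on a single ray. The constant \<open>c\<close> may depend on \<epsilon> and
  tend to zero: it identifies the entropy state for each \<epsilon> and does not control the
  limit.\<close>

definition riemann_limit ::
  "pl_flux \<Rightarrow> real \<times> real \<Rightarrow> real \<times> real \<Rightarrow> real \<Rightarrow> real \<Rightarrow> real \<Rightarrow> bool" where
  "riemann_limit F sL sR \<xi> u w \<longleftrightarrow>
     (\<exists>z. (\<forall>\<^sub>F \<epsilon> in at_right 0. \<exists>c>0. optimal_state (flux_eps F \<epsilon>)
             (regularized_state F \<epsilon> sL) (regularized_state F \<epsilon> sR) \<xi> c (z \<epsilon>)) \<and>
          (z \<longlongrightarrow> u) (at_right 0) \<and> ((\<lambda>\<epsilon>. flux_eps F \<epsilon> (z \<epsilon>)) \<longlongrightarrow> w) (at_right 0))"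

text \<open>Sharpness makes every selection \<open>y\<close> of entropy states coincide with
  \<open>z\<close> for small \<epsilon>, so it inherits the limits of \<open>z\<close>.\<close>

lemma riemann_limit_tendsto:
  assumes "riemann_limit F sL sR \<xi> u w"
    and y: "\<forall>\<^sub>F \<epsilon> in at_right 0. entropy_state (flux_eps F \<epsilon>)
             (regularized_state F \<epsilon> sL) (regularized_state F \<epsilon> sR) \<xi> (y \<epsilon>)"
  shows "(y \<longlongrightarrow> u) (at_right 0)" "((\<lambda>\<epsilon>. flux_eps F \<epsilon> (y \<epsilon>)) \<longlongrightarrow> w) (at_right 0)"
proof -
  obtain z where z: "\<forall>\<^sub>F \<epsilon> in at_right 0. \<exists>c>0. optimal_state (flux_eps F \<epsilon>)
             (regularized_state F \<epsilon> sL) (regularized_state F \<epsilon> sR) \<xi> c (z \<epsilon>)"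
    and lim: "(z \<longlongrightarrow> u) (at_right 0)" "((\<lambda>\<epsilon>. flux_eps F \<epsilon> (z \<epsilon>)) \<longlongrightarrow> w) (at_right 0)"
    using assms(1) by (auto simp: riemann_limit_def)
  have eq: "\<forall>\<^sub>F \<epsilon> in at_right 0. z \<epsilon> = y \<epsilon>"
    using z y by eventually_elim (metis entropy_state_unique)
  show "(y \<longlongrightarrow> u) (at_right 0)"
    by (rule Lim_transform_eventually[OF lim(1) eq])
  show "((\<lambda>\<epsilon>. flux_eps F \<epsilon> (y \<epsilon>)) \<longlongrightarrow> w) (at_right 0)"
    by (rule Lim_transform_eventually[OF lim(2)]) (use eq in eventually_elim, simp)
qed

text \<open>The finite set collects the rays that \<open>riemann_solution\<close> leaves free. On
  any other ray a known limit is binding, which turns information about one ray into a constraint on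
  every competing solution.\<close>

lemma riemann_solution_determined:
  assumes "riemann_solution F sL sR U W"
  shows "\<exists>S. finite S \<and> (\<forall>\<xi> u w. \<xi> \<notin> S \<longrightarrow> riemann_limit F sL sR \<xi> u w \<longrightarrow> U \<xi> = u \<and> W \<xi> = w)"
proof -
  obtain Ue S where e: "\<forall>\<^sub>F \<epsilon> in at_right 0.
           entropy_profile (flux_eps F \<epsilon>) (regularized_state F \<epsilon> sL) (regularized_state F \<epsilon> sR) (Ue \<epsilon>)"
    and S: "finite S" and lim: "\<And>\<xi>. \<xi> \<notin> S \<Longrightarrow> ((\<lambda>\<epsilon>. Ue \<epsilon> \<xi>) \<longlongrightarrow> U \<xi>) (at_right 0) \<and>
           ((\<lambda>\<epsilon>. flux_eps F \<epsilon> (Ue \<epsilon> \<xi>)) \<longlongrightarrow> W \<xi>) (at_right 0)"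
    using assms by (auto simp: riemann_solution_def)
  have "U \<xi> = u \<and> W \<xi> = w" if "\<xi> \<notin> S" and l: "riemann_limit F sL sR \<xi> u w" for \<xi> u w
  proof -
    have "\<forall>\<^sub>F \<epsilon> in at_right 0. entropy_state (flux_eps F \<epsilon>)
             (regularized_state F \<epsilon> sL) (regularized_state F \<epsilon> sR) \<xi> (Ue \<epsilon> \<xi>)"
      using e by eventually_elim (simp add: entropy_profile_iff)
    from riemann_limit_tendsto[OF l this] lim[OF that(1)] show ?thesis
      using tendsto_unique trivial_limit_at_right_real by blast
  qed
  then show ?thesis using S by blast
qed

section \<open>Explicit form and vertices of the regularized flux\<close>

locale pl_road =
  fixes F :: pl_flux and \<alpha> \<kappa> :: real
  assumes \<alpha>_pos: "0 < \<alpha>" and \<kappa>_pos: "0 < \<kappa>"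
    and ustar_pos: "0 < ustar F" and ustar_less: "ustar F < umax F"
    and branch1_eq: "branch1 F = (\<lambda>x. \<alpha> * x)"
    and branch2_eq: "branch2 F = (\<lambda>x. \<kappa> * (umax F - x))"
    and jump: "\<kappa> * (umax F - ustar F) < \<alpha> * ustar F"
begin

abbreviation us :: real where "us \<equiv> ustar F"
abbreviation um :: real where "um \<equiv> umax F"
abbreviation top_flux :: real where "top_flux \<equiv> \<alpha> * us"
abbreviation bot_flux :: real where "bot_flux \<equiv> \<kappa> * (um - us)"

lemma bot_flux_pos: "0 < bot_flux"
  using \<kappa>_pos ustar_less by simp

text \<open>The total fall of \<open>flux_eps\<close> over the ramp, which descends from
  \<open>top_flux\<close> at \<open>us\<close> to \<open>bot_flux - \<kappa> * \<epsilon>\<close> at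
  \<open>us + \<epsilon>\<close>, not merely to \<open>bot_flux\<close>.\<close>

definition ramp_drop :: "real \<Rightarrow> real" where
  "ramp_drop \<epsilon> = top_flux - bot_flux + \<kappa> * \<epsilon>"

lemma ramp_drop_pos: "0 \<le> \<epsilon> \<Longrightarrow> 0 < ramp_drop \<epsilon>"
  using jump \<kappa>_pos by (simp add: ramp_drop_def add_pos_nonneg)

lemma flux_eps_left: "0 < \<epsilon> \<Longrightarrow> x \<le> us \<Longrightarrow> flux_eps F \<epsilon> x = \<alpha> * x"
  by (simp add: flux_eps_def branch1_eq)

lemma flux_eps_right: "0 < \<epsilon> \<Longrightarrow> us + \<epsilon> \<le> x \<Longrightarrow> flux_eps F \<epsilon> x = \<kappa> * (um - x)"
  by (simp add: flux_eps_def branch2_eq)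

lemma flux_eps_mid:
  assumes "0 < \<epsilon>" "us \<le> x" "x \<le> us + \<epsilon>"
  shows "flux_eps F \<epsilon> x = top_flux - (x - us) / \<epsilon> * ramp_drop \<epsilon>"
proof (cases "x = us + \<epsilon>")
  case True
  then show ?thesis using assms by (simp add: flux_eps_def branch2_eq ramp_drop_def algebra_simps)
next
  case False
  have "\<kappa> * (um - (us + \<epsilon>)) - \<alpha> * us = - ramp_drop \<epsilon>" by (simp add: ramp_drop_def algebra_simps)
  with False show ?thesis using assms by (auto simp: flux_eps_def branch2_eq branch1_eq)
qed

text \<open>The objective is affine off the kinks \<open>us\<close> and
  \<open>us + \<epsilon>\<close>. Each case applies \<open>affine_above_tent\<close> to the part of
  one affine piece inside [lo, hi]; the ends of that part are among the points covered by
  \<open>v\<close>.\<close>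

lemma flux_eps_above_tent:
  assumes e: "0 < \<epsilon>" and c: "0 \<le> c" and x: "x \<in> {lo..hi}"
    and v: "\<And>y. y \<in> {lo, hi} \<union> ({us, us + \<epsilon>} \<inter> {lo..hi}) \<Longrightarrow>
        A + c * \<bar>y - z\<bar> \<le> \<sigma> * (flux_eps F \<epsilon> y - \<xi> * y)"
  shows "A + c * \<bar>x - z\<bar> \<le> \<sigma> * (flux_eps F \<epsilon> x - \<xi> * x)"
proof -
  let ?h = "\<lambda>x. \<sigma> * (flux_eps F \<epsilon> x - \<xi> * x)"
  consider "x \<le> us" | "us \<le> x" "x \<le> us + \<epsilon>" | "us + \<epsilon> \<le> x" by linarith
  then show ?thesis
  proof cases
    case 1
    show ?thesis
    proof (rule affine_above_tent[where l = lo and r = "min hi us" and P = 0 and Q = "\<sigma> * (\<alpha> - \<xi>)"])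
      show "A + c * \<bar>min hi us - z\<bar> \<le> ?h (min hi us)"
        using v[of "min hi us"] x 1 by (auto simp: min_def)
      show "A + c * \<bar>lo - z\<bar> \<le> ?h lo" using v[of lo] by simp
    qed (use x 1 e c in \<open>auto simp: flux_eps_left algebra_simps\<close>)
  next
    case 2
    show ?thesis
    \<comment> \<open>\<open>P\<close> and \<open>Q\<close> are the intercept and the slope read off
      from \<open>flux_eps_mid\<close>.\<close>
    proof (rule affine_above_tent[where l = "max lo us" and r = "min hi (us + \<epsilon>)"
          and P = "\<sigma> * (top_flux + us / \<epsilon> * ramp_drop \<epsilon>)" and Q = "\<sigma> * (- ramp_drop \<epsilon> / \<epsilon> - \<xi>)"])
      show "A + c * \<bar>max lo us - z\<bar> \<le> ?h (max lo us)"
        using v[of "max lo us"] x 2 by (auto simp: max_def)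
      show "A + c * \<bar>min hi (us + \<epsilon>) - z\<bar> \<le> ?h (min hi (us + \<epsilon>))"
        using v[of "min hi (us + \<epsilon>)"] x 2 by (auto simp: min_def)
    qed (use x 2 e c in \<open>auto simp: flux_eps_mid field_simps\<close>)
  next
    case 3
    show ?thesis
    proof (rule affine_above_tent[where l = "max lo (us + \<epsilon>)" and r = hi and P = "\<sigma> * \<kappa> * um"
          and Q = "\<sigma> * (- \<kappa> - \<xi>)"])
      show "A + c * \<bar>max lo (us + \<epsilon>) - z\<bar> \<le> ?h (max lo (us + \<epsilon>))"
        using v[of "max lo (us + \<epsilon>)"] x 3 by (auto simp: max_def)
      show "A + c * \<bar>hi - z\<bar> \<le> ?h hi" using v[of hi] by simp
    qed (use x 3 e c in \<open>auto simp: flux_eps_right algebra_simps\<close>)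
  qed
qed

definition vertices :: "real \<Rightarrow> real \<Rightarrow> real \<Rightarrow> real set" where
  "vertices \<epsilon> p q = {p, q} \<union> ({us, us + \<epsilon>} \<inter> {min p q..max p q})"

lemma vertices_subset: "vertices \<epsilon> p q \<subseteq> {min p q..max p q}" and finite_vertices: "finite (vertices \<epsilon> p q)"
  by (auto simp: vertices_def)

lemma optimal_stateI:
  assumes e: "0 < \<epsilon>" and c: "0 \<le> c" and z: "z \<in> {min p q..max p q}"
    and v: "\<And>y. y \<in> vertices \<epsilon> p q \<Longrightarrow> orient p q * (flux_eps F \<epsilon> z - \<xi> * z) + c * \<bar>y - z\<bar>
        \<le> orient p q * (flux_eps F \<epsilon> y - \<xi> * y)"
  shows "optimal_state (flux_eps F \<epsilon>) p q \<xi> c z"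
  unfolding optimal_state_def
proof (intro conjI ballI z)
  fix x assume x: "x \<in> {min p q..max p q}"
  have "{min p q, max p q} = {p, q}" by (auto simp: min_def max_def)
  then show "orient p q * (flux_eps F \<epsilon> z - \<xi> * z) + c * \<bar>x - z\<bar>
        \<le> orient p q * (flux_eps F \<epsilon> x - \<xi> * x)"
    using v by (intro flux_eps_above_tent[OF e c x]) (auto simp: vertices_def)
qed

text \<open>Serves the exceptional rays: \<open>entropy_profile\<close> demands a state for every
  \<xi>, also where vertices tie and no positive \<open>c\<close> is available.\<close>

lemma ex_optimal_state: "0 < \<epsilon> \<Longrightarrow> \<exists>z. optimal_state (flux_eps F \<epsilon>) p q \<xi> 0 z"
proof -
  assume e: "0 < \<epsilon>"
  let ?h = "\<lambda>y. orient p q * (flux_eps F \<epsilon> y - \<xi> * y)"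
  have ne: "vertices \<epsilon> p q \<noteq> {}" by (auto simp: vertices_def)
  obtain z where z: "z \<in> vertices \<epsilon> p q" "\<And>y. y \<in> vertices \<epsilon> p q \<Longrightarrow> ?h z \<le> ?h y"
    using ex_min_if_finite[of "?h ` vertices \<epsilon> p q"] finite_vertices[of \<epsilon> p q] ne
    by (auto simp: not_less)
  then have "optimal_state (flux_eps F \<epsilon>) p q \<xi> 0 z"
    using vertices_subset[of \<epsilon> p q] by (intro optimal_stateI[OF e]) auto
  then show ?thesis ..
qed

text \<open>A strict minimum over finitely many vertices is automatically sharp: the least
  difference quotient from \<open>z\<close> serves as \<open>c\<close>.\<close>

lemma sharp_optimal_stateI:
  assumes e: "0 < \<epsilon>" and z: "z \<in> {min p q..max p q}"
    and v: "\<And>y. y \<in> vertices \<epsilon> p q \<Longrightarrow> y \<noteq> z \<Longrightarrow> orient p q * (flux_eps F \<epsilon> z - \<xi> * z)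
        < orient p q * (flux_eps F \<epsilon> y - \<xi> * y)"
  shows "\<exists>c>0. optimal_state (flux_eps F \<epsilon>) p q \<xi> c z"
proof -
  let ?h = "\<lambda>y. orient p q * (flux_eps F \<epsilon> y - \<xi> * y)"
  \<comment> \<open>Inserting 1 keeps the set nonempty when \<open>z\<close> is the only
    vertex.\<close>
  define C where "C = insert 1 ((\<lambda>y. (?h y - ?h z) / \<bar>y - z\<bar>) ` (vertices \<epsilon> p q - {z}))"
  have C: "finite C" "C \<noteq> {}" using finite_vertices by (auto simp: C_def)
  have pos: "0 < Min C" unfolding Min_gr_iff[OF C] using v by (auto simp: C_def)
  have "optimal_state (flux_eps F \<epsilon>) p q \<xi> (Min C) z"
  proof (rule optimal_stateI[OF e _ z])
    fix y assume y: "y \<in> vertices \<epsilon> p q"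
    show "?h z + Min C * \<bar>y - z\<bar> \<le> ?h y"
    proof (cases "y = z")
      case False
      then have "Min C \<le> (?h y - ?h z) / \<bar>y - z\<bar>"
        using y C by (intro Min_le) (auto simp: C_def)
      then have "Min C * \<bar>y - z\<bar> \<le> ?h y - ?h z" using False by (simp add: pos_le_divide_eq)
      then show ?thesis by linarith
    qed simp
  qed (use pos in simp)
  with pos show ?thesis by blast
qed

text \<open>Entropy states may be selected arbitrarily for all \<epsilon> and \<xi>: on the rays
  outside \<open>S\<close> uniqueness forces the limits of any selection.\<close>

lemma riemann_solutionI:
  assumes S: "finite S" and lim: "\<And>\<xi>. \<xi> \<notin> S \<Longrightarrow> riemann_limit F sL sR \<xi> (U \<xi>) (W \<xi>)"
  shows "riemann_solution F sL sR U W"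
proof -
  define Ue where "Ue = (\<lambda>\<epsilon> \<xi>. SOME y. entropy_state (flux_eps F \<epsilon>)
             (regularized_state F \<epsilon> sL) (regularized_state F \<epsilon> sR) \<xi> y)"
  have Ue: "\<forall>\<^sub>F \<epsilon> in at_right 0. entropy_state (flux_eps F \<epsilon>)
             (regularized_state F \<epsilon> sL) (regularized_state F \<epsilon> sR) \<xi> (Ue \<epsilon> \<xi>)" for \<xi>
    using eventually_at_right_less[of "0::real"]
  proof eventually_elim
    case (elim \<epsilon>)
    then show ?case
      unfolding Ue_def using ex_optimal_state[OF elim] optimal_imp_entropy_state
      by (metis (full_types, lifting) someI_ex)
  qed
  have "\<forall>\<^sub>F \<epsilon> in at_right 0. entropy_profile (flux_eps F \<epsilon>)
             (regularized_state F \<epsilon> sL) (regularized_state F \<epsilon> sR) (Ue \<epsilon>)"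
    using eventually_at_right_less[of "0::real"]
  proof eventually_elim
    case (elim \<epsilon>)
    then show ?case
      unfolding Ue_def entropy_profile_iff using ex_optimal_state[OF elim] optimal_imp_entropy_state
      by (metis (full_types, lifting) someI_ex)
  qed
  with S show ?thesis
    unfolding riemann_solution_def using riemann_limit_tendsto[OF lim Ue]
    by (intro exI[of _ Ue] exI[of _ S]) simp
qed

text \<open>The point of the ramp with flux \<omega>, found by solving
  \<open>flux_eps_mid\<close>.\<close>

definition ramp_point :: "real \<Rightarrow> real \<Rightarrow> real" where
  "ramp_point \<omega> \<epsilon> = us + \<epsilon> * (top_flux - \<omega>) / ramp_drop \<epsilon>"

lemma ramp_point:
  assumes e: "0 < \<epsilon>" and w: "\<omega> \<in> {bot_flux..top_flux}"
  shows "us \<le> ramp_point \<omega> \<epsilon>" "ramp_point \<omega> \<epsilon> < us + \<epsilon>" "flux_eps F \<epsilon> (ramp_point \<omega> \<epsilon>) = \<omega>"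
    "regularized_state F \<epsilon> (us, \<omega>) = ramp_point \<omega> \<epsilon>" "ramp_point top_flux \<epsilon> = us"
proof -
  have d: "0 < ramp_drop \<epsilon>" using ramp_drop_pos e by simp
  show 1: "us \<le> ramp_point \<omega> \<epsilon>" using e w d by (simp add: ramp_point_def)
  \<comment> \<open>Strict, since the ramp ends at a flux below \<open>bot_flux\<close>; the end of
    the ramp thus never represents a critical state and remains a separate vertex.\<close>
  have "\<epsilon> * (top_flux - \<omega>) < \<epsilon> * ramp_drop \<epsilon>"
    using e w mult_pos_pos[OF \<kappa>_pos e] by (intro mult_strict_left_mono) (auto simp: ramp_drop_def)
  then show 2: "ramp_point \<omega> \<epsilon> < us + \<epsilon>"
    using d by (simp add: ramp_point_def divide_less_eq)
  show 3: "flux_eps F \<epsilon> (ramp_point \<omega> \<epsilon>) = \<omega>"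
    using flux_eps_mid[OF e 1] 2 d e by (simp add: ramp_point_def)
  show "regularized_state F \<epsilon> (us, \<omega>) = ramp_point \<omega> \<epsilon>"
    unfolding regularized_state_def
  proof (simp, rule the_equality)
    fix p assume p: "us \<le> p \<and> p \<le> us + \<epsilon> \<and> flux_eps F \<epsilon> p = \<omega>"
    then have "top_flux - (p - us) / \<epsilon> * ramp_drop \<epsilon> = \<omega>" using flux_eps_mid[OF e, of p] by metis
    then show "p = ramp_point \<omega> \<epsilon>" using e d by (simp add: ramp_point_def field_simps)
  qed (use 1 2 3 in auto)
  show "ramp_point top_flux \<epsilon> = us" by (simp add: ramp_point_def)
qed

lemma ramp_point_tendsto: "(ramp_point \<omega> \<longlongrightarrow> us) (at_right 0)"
proof -
  have "ramp_drop 0 \<noteq> 0" using ramp_drop_pos[of 0] by simp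
  then have "((\<lambda>\<epsilon>. us + \<epsilon> * (top_flux - \<omega>) / ramp_drop \<epsilon>) \<longlongrightarrow> us + 0 * (top_flux - \<omega>) / ramp_drop 0) (at_right 0)"
    unfolding ramp_drop_def by (intro tendsto_intros) auto
  then show ?thesis by (simp add: ramp_point_def[abs_def])
qed

lemma regularized_state_off: "u \<noteq> us \<Longrightarrow> regularized_state F \<epsilon> (u, \<omega>) = u"
  by (simp add: regularized_state_def)

end

subsection \<open>Limits of the regularized Riemann problems\<close>

context pl_road begin

definition gain :: "real \<Rightarrow> real \<Rightarrow> real \<Rightarrow> real" where
  "gain \<xi> \<epsilon> x = flux_eps F \<epsilon> x - \<xi> * x"

text \<open>The bound on \<epsilon> * |\<xi>| makes the ramp fall faster than the line of slope
  \<xi>; \<open>d\<close> can be chosen to keep \<open>us + \<epsilon>\<close> below a given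
  congested state.\<close>

definition small :: "real \<Rightarrow> real \<Rightarrow> real \<Rightarrow> bool" where
  "small \<xi> d \<epsilon> \<longleftrightarrow> 0 < \<epsilon> \<and> \<epsilon> < d \<and> \<epsilon> * \<bar>\<xi>\<bar> < top_flux - bot_flux"

lemma eventually_small: "0 < d \<Longrightarrow> \<forall>\<^sub>F \<epsilon> in at_right 0. small \<xi> d \<epsilon>"
proof -
  assume d: "0 < d"
  have "((\<lambda>\<epsilon>::real. \<epsilon> * \<bar>\<xi>\<bar>) \<longlongrightarrow> 0 * \<bar>\<xi>\<bar>) (at_right 0)" by (intro tendsto_intros)
  then have "\<forall>\<^sub>F \<epsilon> in at_right 0. \<epsilon> * \<bar>\<xi>\<bar> < top_flux - bot_flux"
    using jump by (intro order_tendstoD(2)) auto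
  with eventually_at_right_less[of "0::real"] eventually_at_right_real[OF d]
  show ?thesis by eventually_elim (auto simp: small_def)
qed

lemma gain_left_mono: "0 < \<epsilon> \<Longrightarrow> x < y \<Longrightarrow> y \<le> us \<Longrightarrow> \<xi> < \<alpha> \<Longrightarrow> gain \<xi> \<epsilon> x < gain \<xi> \<epsilon> y"
  using mult_strict_left_mono[of x y "\<alpha> - \<xi>"] by (simp add: gain_def flux_eps_left algebra_simps)

lemma gain_left_anti: "0 < \<epsilon> \<Longrightarrow> x < y \<Longrightarrow> y \<le> us \<Longrightarrow> \<alpha> < \<xi> \<Longrightarrow> gain \<xi> \<epsilon> y < gain \<xi> \<epsilon> x"
  using mult_strict_left_mono[of x y "\<xi> - \<alpha>"] by (simp add: gain_def flux_eps_left algebra_simps)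

lemma gain_right_mono: "0 < \<epsilon> \<Longrightarrow> us + \<epsilon> \<le> x \<Longrightarrow> x < y \<Longrightarrow> \<xi> < - \<kappa> \<Longrightarrow> gain \<xi> \<epsilon> x < gain \<xi> \<epsilon> y"
  using mult_strict_left_mono[of x y "- \<kappa> - \<xi>"] by (simp add: gain_def flux_eps_right algebra_simps)

lemma gain_right_anti: "0 < \<epsilon> \<Longrightarrow> us + \<epsilon> \<le> x \<Longrightarrow> x < y \<Longrightarrow> - \<kappa> < \<xi> \<Longrightarrow> gain \<xi> \<epsilon> y < gain \<xi> \<epsilon> x"
  using mult_strict_left_mono[of x y "\<xi> + \<kappa>"] by (simp add: gain_def flux_eps_right algebra_simps)

text \<open>The ramp has slope \<open>- ramp_drop \<epsilon> / \<epsilon>\<close>, which is below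
  \<xi> for small \<epsilon>. This is how the speeds tending to -\<infinity> enter: every fixed ray
  ends up to the right of a wave on the ramp.\<close>

lemma gain_steep:
  assumes e: "small \<xi> d \<epsilon>" and x: "us \<le> x" "x < y" "y \<le> us + \<epsilon>"
  shows "gain \<xi> \<epsilon> y < gain \<xi> \<epsilon> x"
proof -
  have e0: "0 < \<epsilon>" using e by (simp add: small_def)
  have "\<epsilon> * \<bar>\<xi>\<bar> < ramp_drop \<epsilon>"
    using e mult_pos_pos[OF \<kappa>_pos e0] by (simp add: small_def ramp_drop_def)
  moreover have "- (\<epsilon> * \<bar>\<xi>\<bar>) \<le> \<epsilon> * \<xi>" using e0 by (metis abs_ge_minus_self abs_mult abs_of_pos minus_le_iff)
  ultimately have "0 < ramp_drop \<epsilon> / \<epsilon> + \<xi>"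
    using e0 by (simp add: field_simps)
  then have "0 < (y - x) * (ramp_drop \<epsilon> / \<epsilon> + \<xi>)" using x by simp
  moreover have "gain \<xi> \<epsilon> x - gain \<xi> \<epsilon> y = (y - x) * (ramp_drop \<epsilon> / \<epsilon> + \<xi>)"
    using x e0 by (simp add: gain_def flux_eps_mid field_simps)
  ultimately show ?thesis by linarith
qed

text \<open>Strict optimality is asked at the end points and kinks only. Equal end points are
  allowed here and excluded in \<open>max_vertex\<close>, following the convention that
  \<open>p \<le> q\<close> belongs to the lower hull.\<close>

definition min_vertex :: "real \<Rightarrow> real \<Rightarrow> real \<Rightarrow> real \<Rightarrow> real \<Rightarrow> bool" where
  "min_vertex \<xi> \<epsilon> p q z \<longleftrightarrow> 0 < \<epsilon> \<and> p \<le> z \<and> z \<le> q \<and>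
     (p < z \<longrightarrow> gain \<xi> \<epsilon> z < gain \<xi> \<epsilon> p) \<and> (z < q \<longrightarrow> gain \<xi> \<epsilon> z < gain \<xi> \<epsilon> q) \<and>
     (\<forall>y\<in>{us, us + \<epsilon>}. p \<le> y \<and> y < z \<or> z < y \<and> y \<le> q \<longrightarrow> gain \<xi> \<epsilon> z < gain \<xi> \<epsilon> y)"

definition max_vertex :: "real \<Rightarrow> real \<Rightarrow> real \<Rightarrow> real \<Rightarrow> real \<Rightarrow> bool" where
  "max_vertex \<xi> \<epsilon> p q z \<longleftrightarrow> 0 < \<epsilon> \<and> q < p \<and> q \<le> z \<and> z \<le> p \<and>
     (z < p \<longrightarrow> gain \<xi> \<epsilon> p < gain \<xi> \<epsilon> z) \<and> (q < z \<longrightarrow> gain \<xi> \<epsilon> q < gain \<xi> \<epsilon> z) \<and>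
     (\<forall>y\<in>{us, us + \<epsilon>}. q \<le> y \<and> y < z \<or> z < y \<and> y \<le> p \<longrightarrow> gain \<xi> \<epsilon> y < gain \<xi> \<epsilon> z)"

lemma min_vertex_optimal:
  assumes m: "min_vertex \<xi> \<epsilon> p q z"
  shows "\<exists>c>0. optimal_state (flux_eps F \<epsilon>) p q \<xi> c z"
proof (rule sharp_optimal_stateI)
  have le: "p \<le> q" "0 < \<epsilon>" "z \<in> {p..q}" using m by (auto simp: min_vertex_def)
  then show "0 < \<epsilon>" "z \<in> {min p q..max p q}" by auto
  fix y assume y: "y \<in> vertices \<epsilon> p q" "y \<noteq> z"
  have "gain \<xi> \<epsilon> z < gain \<xi> \<epsilon> y"
    using m y le unfolding min_vertex_def vertices_def by (cases "y < z") auto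
  with le show "orient p q * (flux_eps F \<epsilon> z - \<xi> * z) < orient p q * (flux_eps F \<epsilon> y - \<xi> * y)"
    by (simp add: orient_def gain_def)
qed

lemma max_vertex_optimal:
  assumes m: "max_vertex \<xi> \<epsilon> p q z"
  shows "\<exists>c>0. optimal_state (flux_eps F \<epsilon>) p q \<xi> c z"
proof (rule sharp_optimal_stateI)
  have le: "\<not> p \<le> q" "0 < \<epsilon>" "z \<in> {q..p}" using m by (auto simp: max_vertex_def)
  then show "0 < \<epsilon>" "z \<in> {min p q..max p q}" by auto
  fix y assume y: "y \<in> vertices \<epsilon> p q" "y \<noteq> z"
  have "gain \<xi> \<epsilon> y < gain \<xi> \<epsilon> z"
    using m y le unfolding max_vertex_def vertices_def by (cases "y < z") auto
  with le show "orient p q * (flux_eps F \<epsilon> z - \<xi> * z) < orient p q * (flux_eps F \<epsilon> y - \<xi> * y)"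
    by (simp add: orient_def gain_def)
qed

definition optimal_vertex :: "real \<times> real \<Rightarrow> real \<times> real \<Rightarrow> real \<Rightarrow> real \<Rightarrow> real \<Rightarrow> bool" where
  "optimal_vertex sL sR \<xi> \<epsilon> z \<longleftrightarrow>
     min_vertex \<xi> \<epsilon> (regularized_state F \<epsilon> sL) (regularized_state F \<epsilon> sR) z \<or>
     max_vertex \<xi> \<epsilon> (regularized_state F \<epsilon> sL) (regularized_state F \<epsilon> sR) z"

lemma riemann_limitI:
  assumes ev: "\<forall>\<^sub>F \<epsilon> in at_right 0. optimal_vertex sL sR \<xi> \<epsilon> (z \<epsilon>)"
    and z: "(z \<longlongrightarrow> u) (at_right 0)" "((\<lambda>\<epsilon>. flux_eps F \<epsilon> (z \<epsilon>)) \<longlongrightarrow> w) (at_right 0)"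
  shows "riemann_limit F sL sR \<xi> u w"
  unfolding riemann_limit_def
proof (intro exI[of _ z] conjI z)
  show "\<forall>\<^sub>F \<epsilon> in at_right 0. \<exists>c>0. optimal_state (flux_eps F \<epsilon>)
             (regularized_state F \<epsilon> sL) (regularized_state F \<epsilon> sR) \<xi> c (z \<epsilon>)"
    using ev unfolding optimal_vertex_def
    by eventually_elim (use min_vertex_optimal max_vertex_optimal in blast)
qed

lemma const_tendsto_left:
  assumes "u \<le> us"
  shows "((\<lambda>\<epsilon>. u) \<longlongrightarrow> u) (at_right (0::real))"
    and "((\<lambda>\<epsilon>. flux_eps F \<epsilon> u) \<longlongrightarrow> \<alpha> * u) (at_right 0)"
  using assms by (auto intro!: tendsto_eventually eventually_at_right_less
      simp: flux_eps_def branch1_eq)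

lemma const_tendsto_right:
  assumes "us < u"
  shows "((\<lambda>\<epsilon>. u) \<longlongrightarrow> u) (at_right (0::real))"
    and "((\<lambda>\<epsilon>. flux_eps F \<epsilon> u) \<longlongrightarrow> \<kappa> * (um - u)) (at_right 0)"
proof -
  have "\<forall>\<^sub>F \<epsilon> in at_right 0. small 0 (u - us) \<epsilon>" using assms by (intro eventually_small) simp
  then have "\<forall>\<^sub>F \<epsilon> in at_right 0. flux_eps F \<epsilon> u = \<kappa> * (um - u)"
    by eventually_elim (auto simp: small_def flux_eps_right)
  then show "((\<lambda>\<epsilon>. flux_eps F \<epsilon> u) \<longlongrightarrow> \<kappa> * (um - u)) (at_right 0)"
    by (rule tendsto_eventually)
qed auto

text \<open>One density, several fluxes: the left kink keeps \<open>top_flux\<close>, the right kink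
  \<open>bot_flux\<close>, a ramp point its own \<omega>. The limit flux records from which vertex a
  critical state arose.\<close>

lemma ramp_end_tendsto:
  "((\<lambda>\<epsilon>. us + \<epsilon>) \<longlongrightarrow> us) (at_right 0)"
  "((\<lambda>\<epsilon>. flux_eps F \<epsilon> (us + \<epsilon>)) \<longlongrightarrow> bot_flux) (at_right 0)"
proof -
  have "((\<lambda>\<epsilon>. us + \<epsilon>) \<longlongrightarrow> us + 0) (at_right 0)" by (intro tendsto_intros)
  then show 1: "((\<lambda>\<epsilon>. us + \<epsilon>) \<longlongrightarrow> us) (at_right 0)" by simp
  have "((\<lambda>\<epsilon>. \<kappa> * (um - (us + \<epsilon>))) \<longlongrightarrow> bot_flux) (at_right 0)"
    by (intro tendsto_intros 1)
  then show "((\<lambda>\<epsilon>. flux_eps F \<epsilon> (us + \<epsilon>)) \<longlongrightarrow> bot_flux) (at_right 0)"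
    by (rule Lim_transform_eventually)
       (use eventually_at_right_less[of "0::real"] in eventually_elim, simp add: flux_eps_right)
qed

lemma ramp_flux_tendsto:
  "\<omega> \<in> {bot_flux..top_flux} \<Longrightarrow> ((\<lambda>\<epsilon>. flux_eps F \<epsilon> (ramp_point \<omega> \<epsilon>)) \<longlongrightarrow> \<omega>) (at_right 0)"
  by (rule tendsto_eventually) (use eventually_at_right_less[of "0::real"] in eventually_elim, simp add: ramp_point)

lemma gain_ramp_point_tendsto:
  assumes "\<omega> \<in> {bot_flux..top_flux}"
  shows "((\<lambda>\<epsilon>. gain \<xi> \<epsilon> (ramp_point \<omega> \<epsilon>)) \<longlongrightarrow> \<omega> - \<xi> * us) (at_right 0)"
  unfolding gain_def by (intro tendsto_intros ramp_flux_tendsto ramp_point_tendsto assms)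

lemma gain_ramp_end_tendsto:
  "((\<lambda>\<epsilon>. gain \<xi> \<epsilon> (us + \<epsilon>)) \<longlongrightarrow> bot_flux - \<xi> * us) (at_right 0)"
  unfolding gain_def by (intro tendsto_intros ramp_end_tendsto)

lemma gain_const_tendsto:
  "u \<le> us \<Longrightarrow> ((\<lambda>\<epsilon>. gain \<xi> \<epsilon> u) \<longlongrightarrow> \<alpha> * u - \<xi> * u) (at_right 0)"
  "us < u \<Longrightarrow> ((\<lambda>\<epsilon>. gain \<xi> \<epsilon> u) \<longlongrightarrow> \<kappa> * (um - u) - \<xi> * u) (at_right 0)"
  unfolding gain_def by (intro tendsto_intros const_tendsto_left const_tendsto_right; simp)+

lemma eventually_less_of_tendsto:
  fixes f g :: "real \<Rightarrow> real"
  assumes "(f \<longlongrightarrow> x) (at_right 0)" "(g \<longlongrightarrow> y) (at_right 0)" "x < y"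
  shows "\<forall>\<^sub>F \<epsilon> in at_right 0. f \<epsilon> < g \<epsilon>"
proof -
  have "((\<lambda>\<epsilon>. g \<epsilon> - f \<epsilon>) \<longlongrightarrow> y - x) (at_right 0)" using assms by (intro tendsto_intros)
  then have "\<forall>\<^sub>F \<epsilon> in at_right 0. 0 < g \<epsilon> - f \<epsilon>" using assms(3) by (intro order_tendstoD(1)) auto
  then show ?thesis by eventually_elim simp
qed

section \<open>The nine Riemann problems between free, critical and congested states\<close>

lemmas vertex_simps = optimal_vertex_def min_vertex_def max_vertex_def regularized_state_off

text \<open>Both states lie on one affine branch, so the only wave is a contact of speed
  \<alpha>.\<close>

lemma riemann_free_free:
  assumes u: "u < us" and v: "v < us"
  shows "\<xi> < \<alpha> \<Longrightarrow> riemann_limit F (u, w) (v, w') \<xi> u (\<alpha> * u)"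
    and "\<alpha> < \<xi> \<Longrightarrow> riemann_limit F (u, w) (v, w') \<xi> v (\<alpha> * v)"
proof -
  have ev: "\<forall>\<^sub>F \<epsilon> in at_right 0. small \<xi> 1 \<epsilon>" by (rule eventually_small) simp
  show "riemann_limit F (u, w) (v, w') \<xi> u (\<alpha> * u)" if x: "\<xi> < \<alpha>"
  proof (rule riemann_limitI[OF _ const_tendsto_left])
    show "\<forall>\<^sub>F \<epsilon> in at_right 0. optimal_vertex (u, w) (v, w') \<xi> \<epsilon> u"
      using ev
    proof eventually_elim
      case (elim \<epsilon>)
      then show ?case using u v x gain_left_mono[of \<epsilon> u v \<xi>] gain_left_mono[of \<epsilon> v u \<xi>]
        by (auto simp: vertex_simps small_def)
    qed
  qed (use u in auto)
  show "riemann_limit F (u, w) (v, w') \<xi> v (\<alpha> * v)" if x: "\<alpha> < \<xi>"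
  proof (rule riemann_limitI[OF _ const_tendsto_left])
    show "\<forall>\<^sub>F \<epsilon> in at_right 0. optimal_vertex (u, w) (v, w') \<xi> \<epsilon> v"
      using ev
    proof eventually_elim
      case (elim \<epsilon>)
      then show ?case using u v x gain_left_anti[of \<epsilon> u v \<xi>] gain_left_anti[of \<epsilon> v u \<xi>]
        by (auto simp: vertex_simps small_def)
    qed
  qed (use v in auto)
qed

text \<open>The ramp descends from \<open>us\<close>, so that kink loses to a ramp point beyond it,
  and a single shock of speed (\<omega> - \<alpha> * u) / (us - u) remains. Speeds are compared
  after multiplying out the denominator.\<close>

lemma riemann_free_crit:
  assumes u: "u < us" and \<omega>: "\<omega> \<in> {bot_flux..top_flux}"
  shows "\<xi> * (us - u) < \<omega> - \<alpha> * u \<Longrightarrow> riemann_limit F (u, w) (us, \<omega>) \<xi> u (\<alpha> * u)"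
    and "\<omega> - \<alpha> * u < \<xi> * (us - u) \<Longrightarrow> riemann_limit F (u, w) (us, \<omega>) \<xi> us \<omega>"
proof -
  let ?P = "optimal_vertex (u, w) (us, \<omega>) \<xi>"
  have ev: "\<forall>\<^sub>F \<epsilon> in at_right 0. small \<xi> 1 \<epsilon>" by (rule eventually_small) simp
  show "riemann_limit F (u, w) (us, \<omega>) \<xi> u (\<alpha> * u)" if x: "\<xi> * (us - u) < \<omega> - \<alpha> * u"
  proof (rule riemann_limitI[OF _ const_tendsto_left])
    \<comment> \<open>As \<omega> is at most \<open>top_flux\<close>, the shock is no faster than
      \<alpha>; on rays to its left \<open>us\<close> therefore loses to \<open>u\<close> as
      well.\<close>
    have "\<xi> * (us - u) < \<alpha> * (us - u)" using x \<omega> by (simp add: algebra_simps)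
    then have \<xi>: "\<xi> < \<alpha>" using u by simp
    have "\<forall>\<^sub>F \<epsilon> in at_right 0. gain \<xi> \<epsilon> u < gain \<xi> \<epsilon> (ramp_point \<omega> \<epsilon>)"
      by (rule eventually_less_of_tendsto[OF gain_const_tendsto(1) gain_ramp_point_tendsto[OF \<omega>]])
        (use u x in \<open>auto simp: algebra_simps\<close>)
    with ev show "\<forall>\<^sub>F \<epsilon> in at_right 0. ?P \<epsilon> u"
    proof eventually_elim
      case (elim \<epsilon>)
      then have e: "0 < \<epsilon>" by (simp add: small_def)
      show ?case using elim e ramp_point[OF e \<omega>] u \<xi> gain_left_mono[of \<epsilon> u us \<xi>]
        by (auto simp: vertex_simps)
    qed
  qed (use u in auto)
  show "riemann_limit F (u, w) (us, \<omega>) \<xi> us \<omega>" if x: "\<omega> - \<alpha> * u < \<xi> * (us - u)"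
  proof (rule riemann_limitI[OF _ ramp_point_tendsto ramp_flux_tendsto[OF \<omega>]])
    have "\<forall>\<^sub>F \<epsilon> in at_right 0. gain \<xi> \<epsilon> (ramp_point \<omega> \<epsilon>) < gain \<xi> \<epsilon> u"
      by (rule eventually_less_of_tendsto[OF gain_ramp_point_tendsto[OF \<omega>] gain_const_tendsto(1)])
        (use u x in \<open>auto simp: algebra_simps\<close>)
    with ev show "\<forall>\<^sub>F \<epsilon> in at_right 0. ?P \<epsilon> (ramp_point \<omega> \<epsilon>)"
    proof eventually_elim
      case (elim \<epsilon>)
      then have e: "0 < \<epsilon>" by (simp add: small_def)
      show ?case using elim e ramp_point[OF e \<omega>] u gain_steep[OF elim(1), of us "ramp_point \<omega> \<epsilon>"]
        by (auto simp: vertex_simps)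
    qed
  qed
qed

text \<open>The kink \<open>us\<close> is never a minimizer. Right of the contact speed -\<kappa>
  the end of the ramp loses to \<open>v\<close>, left of it \<open>v\<close> loses to the end of the
  ramp; so each ray compares \<open>u\<close> with one competitor, and the intermediate state
  (\<open>us\<close>, \<open>bot_flux\<close>) can show only left of -\<kappa>.\<close>

lemma riemann_free_cong:
  assumes u: "u < us" and v: "us < v"
  shows "- \<kappa> < \<xi> \<Longrightarrow> \<xi> * (v - u) < \<kappa> * (um - v) - \<alpha> * u \<Longrightarrow> riemann_limit F (u, w) (v, w') \<xi> u (\<alpha> * u)"
    and "- \<kappa> < \<xi> \<Longrightarrow> \<kappa> * (um - v) - \<alpha> * u < \<xi> * (v - u) \<Longrightarrow>
      riemann_limit F (u, w) (v, w') \<xi> v (\<kappa> * (um - v))"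
    and "\<xi> < - \<kappa> \<Longrightarrow> \<xi> * (us - u) < bot_flux - \<alpha> * u \<Longrightarrow> riemann_limit F (u, w) (v, w') \<xi> u (\<alpha> * u)"
    and "\<xi> < - \<kappa> \<Longrightarrow> bot_flux - \<alpha> * u < \<xi> * (us - u) \<Longrightarrow> riemann_limit F (u, w) (v, w') \<xi> us bot_flux"
proof -
  let ?P = "optimal_vertex (u, w) (v, w') \<xi>"
  have ev: "\<forall>\<^sub>F \<epsilon> in at_right 0. small \<xi> (v - us) \<epsilon>" by (rule eventually_small) (use v in simp)
  have vum: "\<kappa> * (um - v) < bot_flux" using v \<kappa>_pos by simp
  show "riemann_limit F (u, w) (v, w') \<xi> u (\<alpha> * u)"
    if k: "- \<kappa> < \<xi>" and x: "\<xi> * (v - u) < \<kappa> * (um - v) - \<alpha> * u"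
  proof (rule riemann_limitI[OF _ const_tendsto_left])
    have "\<alpha> * us < \<alpha> * v" using v \<alpha>_pos by simp
    then have "\<xi> * (v - u) < \<alpha> * (v - u)" using x vum jump by (simp add: algebra_simps)
    then have \<xi>: "\<xi> < \<alpha>" using u v by simp
    have "\<forall>\<^sub>F \<epsilon> in at_right 0. gain \<xi> \<epsilon> u < gain \<xi> \<epsilon> v"
      by (rule eventually_less_of_tendsto[OF gain_const_tendsto(1) gain_const_tendsto(2)])
        (use u v x in \<open>auto simp: algebra_simps\<close>)
    with ev show "\<forall>\<^sub>F \<epsilon> in at_right 0. ?P \<epsilon> u"
    proof eventually_elim
      case (elim \<epsilon>)
      then have e: "0 < \<epsilon>" "us + \<epsilon> < v" by (auto simp: small_def)
      show ?case using elim e u v \<xi> k gain_left_mono[of \<epsilon> u us \<xi>] gain_right_anti[of \<epsilon> "us + \<epsilon>" v \<xi>]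
        by (auto simp: vertex_simps)
    qed
  qed (use u in auto)
  show "riemann_limit F (u, w) (v, w') \<xi> v (\<kappa> * (um - v))"
    if k: "- \<kappa> < \<xi>" and x: "\<kappa> * (um - v) - \<alpha> * u < \<xi> * (v - u)"
  proof (rule riemann_limitI[OF _ const_tendsto_right])
    have "\<forall>\<^sub>F \<epsilon> in at_right 0. gain \<xi> \<epsilon> v < gain \<xi> \<epsilon> u"
      by (rule eventually_less_of_tendsto[OF gain_const_tendsto(2) gain_const_tendsto(1)])
        (use u v x in \<open>auto simp: algebra_simps\<close>)
    with ev show "\<forall>\<^sub>F \<epsilon> in at_right 0. ?P \<epsilon> v"
    proof eventually_elim
      case (elim \<epsilon>)
      then have e: "0 < \<epsilon>" "us + \<epsilon> < v" by (auto simp: small_def)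
      show ?case using elim e u v k gain_steep[OF elim(1), of us "us + \<epsilon>"] gain_right_anti[of \<epsilon> "us + \<epsilon>" v \<xi>]
        by (auto simp: vertex_simps)
    qed
  qed (use v in auto)
  show "riemann_limit F (u, w) (v, w') \<xi> u (\<alpha> * u)"
    if k: "\<xi> < - \<kappa>" and x: "\<xi> * (us - u) < bot_flux - \<alpha> * u"
  proof (rule riemann_limitI[OF _ const_tendsto_left])
    have \<xi>: "\<xi> < \<alpha>" using k \<alpha>_pos \<kappa>_pos by linarith
    have "\<forall>\<^sub>F \<epsilon> in at_right 0. gain \<xi> \<epsilon> u < gain \<xi> \<epsilon> (us + \<epsilon>)"
      by (rule eventually_less_of_tendsto[OF gain_const_tendsto(1) gain_ramp_end_tendsto])
        (use u v x in \<open>auto simp: algebra_simps\<close>)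
    with ev show "\<forall>\<^sub>F \<epsilon> in at_right 0. ?P \<epsilon> u"
    proof eventually_elim
      case (elim \<epsilon>)
      then have e: "0 < \<epsilon>" "us + \<epsilon> < v" by (auto simp: small_def)
      show ?case using elim e u v \<xi> k gain_left_mono[of \<epsilon> u us \<xi>] gain_right_mono[of \<epsilon> "us + \<epsilon>" v \<xi>]
        by (auto simp: vertex_simps)
    qed
  qed (use u in auto)
  show "riemann_limit F (u, w) (v, w') \<xi> us bot_flux"
    if k: "\<xi> < - \<kappa>" and x: "bot_flux - \<alpha> * u < \<xi> * (us - u)"
  proof (rule riemann_limitI[OF _ ramp_end_tendsto])
    have "\<forall>\<^sub>F \<epsilon> in at_right 0. gain \<xi> \<epsilon> (us + \<epsilon>) < gain \<xi> \<epsilon> u"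
      by (rule eventually_less_of_tendsto[OF gain_ramp_end_tendsto gain_const_tendsto(1)])
        (use u v x in \<open>auto simp: algebra_simps\<close>)
    with ev show "\<forall>\<^sub>F \<epsilon> in at_right 0. ?P \<epsilon> (us + \<epsilon>)"
    proof eventually_elim
      case (elim \<epsilon>)
      then have e: "0 < \<epsilon>" "us + \<epsilon> < v" by (auto simp: small_def)
      show ?case using elim e u v k gain_steep[OF elim(1), of us "us + \<epsilon>"] gain_right_mono[of \<epsilon> "us + \<epsilon>" v \<xi>]
        by (auto simp: vertex_simps)
    qed
  qed
qed

text \<open>The wave from the ramp point up to \<open>us\<close> escapes to -\<infinity>, so the
  critical state shows \<open>top_flux\<close> whatever \<omega> was; the contact of speed \<alpha>
  remains.\<close>

lemma riemann_crit_free: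
  assumes \<omega>: "\<omega> \<in> {bot_flux..top_flux}" and v: "v < us"
  shows "\<xi> < \<alpha> \<Longrightarrow> riemann_limit F (us, \<omega>) (v, w') \<xi> us top_flux"
    and "\<alpha> < \<xi> \<Longrightarrow> riemann_limit F (us, \<omega>) (v, w') \<xi> v (\<alpha> * v)"
proof -
  let ?P = "optimal_vertex (us, \<omega>) (v, w') \<xi>"
  have ev: "\<forall>\<^sub>F \<epsilon> in at_right 0. small \<xi> 1 \<epsilon>" by (rule eventually_small) simp
  show "riemann_limit F (us, \<omega>) (v, w') \<xi> us top_flux" if x: "\<xi> < \<alpha>"
  proof (rule riemann_limitI[OF _ const_tendsto_left])
    from ev show "\<forall>\<^sub>F \<epsilon> in at_right 0. ?P \<epsilon> us"
    proof eventually_elim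
      case (elim \<epsilon>)
      then have e: "0 < \<epsilon>" by (simp add: small_def)
      show ?case using elim e ramp_point[OF e \<omega>] v x gain_left_mono[of \<epsilon> v us \<xi>]
          gain_steep[OF elim(1), of us "ramp_point \<omega> \<epsilon>"]
        by (auto simp: vertex_simps)
    qed
  qed auto
  show "riemann_limit F (us, \<omega>) (v, w') \<xi> v (\<alpha> * v)" if x: "\<alpha> < \<xi>"
  proof (rule riemann_limitI[OF _ const_tendsto_left])
    from ev show "\<forall>\<^sub>F \<epsilon> in at_right 0. ?P \<epsilon> v"
    proof eventually_elim
      case (elim \<epsilon>)
      then have e: "0 < \<epsilon>" by (simp add: small_def)
      have "gain \<xi> \<epsilon> (ramp_point \<omega> \<epsilon>) \<le> gain \<xi> \<epsilon> us"
        using gain_steep[OF elim(1), of us "ramp_point \<omega> \<epsilon>"] ramp_point[OF e \<omega>]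
        by (cases "us < ramp_point \<omega> \<epsilon>") auto
      then show ?case using elim e ramp_point[OF e \<omega>] v x gain_left_anti[of \<epsilon> v us \<xi>]
        by (auto simp: vertex_simps)
    qed
  qed (use v in auto)
qed

text \<open>The whole wave runs along the ramp, so in the limit every ray sees the right state
  only.\<close>

lemma riemann_crit_crit:
  assumes \<omega>: "\<omega> \<in> {bot_flux..top_flux}" and \<omega>': "\<omega>' \<in> {bot_flux..top_flux}"
  shows "riemann_limit F (us, \<omega>) (us, \<omega>') \<xi> us \<omega>'"
proof (rule riemann_limitI[OF _ ramp_point_tendsto ramp_flux_tendsto[OF \<omega>']])
  have ev: "\<forall>\<^sub>F \<epsilon> in at_right 0. small \<xi> 1 \<epsilon>" by (rule eventually_small) simp
  then show "\<forall>\<^sub>F \<epsilon> in at_right 0. optimal_vertex (us, \<omega>) (us, \<omega>') \<xi> \<epsilon> (ramp_point \<omega>' \<epsilon>)"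
  proof eventually_elim
    case (elim \<epsilon>)
    then have e: "0 < \<epsilon>" by (simp add: small_def)
    show ?case using e ramp_point[OF e \<omega>] ramp_point[OF e \<omega>']
        gain_steep[OF elim, of us "ramp_point \<omega>' \<epsilon>"]
        gain_steep[OF elim, of "ramp_point \<omega> \<epsilon>" "ramp_point \<omega>' \<epsilon>"]
        gain_steep[OF elim, of "ramp_point \<omega>' \<epsilon>" "ramp_point \<omega> \<epsilon>"]
      by (auto simp: vertex_simps)
  qed
qed

text \<open>A steep wave descends to the end of the ramp and escapes to -\<infinity>; what remains
  is the contact of speed -\<kappa> from (\<open>us\<close>, \<open>bot_flux\<close>) to
  \<open>v\<close>.\<close>

lemma riemann_crit_cong:
  assumes \<omega>: "\<omega> \<in> {bot_flux..top_flux}" and v: "us < v"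
  shows "\<xi> < - \<kappa> \<Longrightarrow> riemann_limit F (us, \<omega>) (v, w') \<xi> us bot_flux"
    and "- \<kappa> < \<xi> \<Longrightarrow> riemann_limit F (us, \<omega>) (v, w') \<xi> v (\<kappa> * (um - v))"
proof -
  let ?P = "optimal_vertex (us, \<omega>) (v, w') \<xi>"
  have ev: "\<forall>\<^sub>F \<epsilon> in at_right 0. small \<xi> (v - us) \<epsilon>" by (rule eventually_small) (use v in simp)
  show "riemann_limit F (us, \<omega>) (v, w') \<xi> us bot_flux" if x: "\<xi> < - \<kappa>"
  proof (rule riemann_limitI[OF _ ramp_end_tendsto])
    from ev show "\<forall>\<^sub>F \<epsilon> in at_right 0. ?P \<epsilon> (us + \<epsilon>)"
    proof eventually_elim
      case (elim \<epsilon>)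
      then have e: "0 < \<epsilon>" "us + \<epsilon> < v" by (auto simp: small_def)
      show ?case using elim e ramp_point[OF e(1) \<omega>] v x gain_right_mono[of \<epsilon> "us + \<epsilon>" v \<xi>]
          gain_steep[OF elim, of us "us + \<epsilon>"] gain_steep[OF elim, of "ramp_point \<omega> \<epsilon>" "us + \<epsilon>"]
        by (auto simp: vertex_simps)
    qed
  qed
  show "riemann_limit F (us, \<omega>) (v, w') \<xi> v (\<kappa> * (um - v))" if x: "- \<kappa> < \<xi>"
  proof (rule riemann_limitI[OF _ const_tendsto_right])
    from ev show "\<forall>\<^sub>F \<epsilon> in at_right 0. ?P \<epsilon> v"
    proof eventually_elim
      case (elim \<epsilon>)
      then have e: "0 < \<epsilon>" "us + \<epsilon> < v" by (auto simp: small_def)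
      show ?case using elim e ramp_point[OF e(1) \<omega>] v x gain_right_anti[of \<epsilon> "us + \<epsilon>" v \<xi>]
          gain_steep[OF elim, of us "us + \<epsilon>"] gain_steep[OF elim, of "ramp_point \<omega> \<epsilon>" "us + \<epsilon>"]
        by (auto simp: vertex_simps)
    qed
  qed (use v in auto)
qed

text \<open>The upper hull peaks at the kink \<open>us\<close>. The rays between the two contact
  speeds contain both signs, which suffices to refute such a pair of states at either kind of
  road.\<close>

lemma riemann_cong_free:
  assumes u: "us < u" and v: "v < us" and \<xi>: "- \<kappa> < \<xi>" "\<xi> < \<alpha>"
  shows "riemann_limit F (u, w) (v, w') \<xi> us top_flux"
proof (rule riemann_limitI[OF _ const_tendsto_left])
  have "\<forall>\<^sub>F \<epsilon> in at_right 0. small \<xi> (u - us) \<epsilon>" by (rule eventually_small) (use u in simp)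
  then show "\<forall>\<^sub>F \<epsilon> in at_right 0. optimal_vertex (u, w) (v, w') \<xi> \<epsilon> us"
  proof eventually_elim
    case (elim \<epsilon>)
    then have e: "0 < \<epsilon>" "us + \<epsilon> < u" by (auto simp: small_def)
    show ?case using elim e u v \<xi> gain_left_mono[of \<epsilon> v us \<xi>]
        gain_steep[OF elim, of us "us + \<epsilon>"] gain_right_anti[of \<epsilon> "us + \<epsilon>" u \<xi>]
      by (auto simp: vertex_simps)
  qed
qed auto

text \<open>For small \<epsilon> the ramp point beats the end of the ramp, so one shock joins
  \<open>u\<close> to the ramp point. Its speed is at most -\<kappa> because \<omega> is at least
  \<open>bot_flux\<close>.\<close>

lemma riemann_cong_crit:
  assumes u: "us < u" and \<omega>: "\<omega> \<in> {bot_flux..top_flux}"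
  shows "\<kappa> * (um - u) - \<omega> < \<xi> * (u - us) \<Longrightarrow> \<xi> \<noteq> - \<kappa> \<Longrightarrow> riemann_limit F (u, w) (us, \<omega>) \<xi> us \<omega>"
    and "\<xi> * (u - us) < \<kappa> * (um - u) - \<omega> \<Longrightarrow> riemann_limit F (u, w) (us, \<omega>) \<xi> u (\<kappa> * (um - u))"
proof -
  let ?P = "optimal_vertex (u, w) (us, \<omega>) \<xi>"
  have ev: "\<forall>\<^sub>F \<epsilon> in at_right 0. small \<xi> (u - us) \<epsilon>" by (rule eventually_small) (use u in simp)
  show "riemann_limit F (u, w) (us, \<omega>) \<xi> us \<omega>"
    if x: "\<kappa> * (um - u) - \<omega> < \<xi> * (u - us)" and k: "\<xi> \<noteq> - \<kappa>"
  proof (rule riemann_limitI[OF _ ramp_point_tendsto ramp_flux_tendsto[OF \<omega>]])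
    have "\<forall>\<^sub>F \<epsilon> in at_right 0. gain \<xi> \<epsilon> u < gain \<xi> \<epsilon> (ramp_point \<omega> \<epsilon>)"
      by (rule eventually_less_of_tendsto[OF gain_const_tendsto(2) gain_ramp_point_tendsto[OF \<omega>]])
        (use u x in \<open>auto simp: algebra_simps\<close>)
    with ev show "\<forall>\<^sub>F \<epsilon> in at_right 0. ?P \<epsilon> (ramp_point \<omega> \<epsilon>)"
    proof eventually_elim
      case (elim \<epsilon>)
      then have e: "0 < \<epsilon>" "us + \<epsilon> < u" by (auto simp: small_def)
      show ?case using elim e ramp_point[OF e(1) \<omega>] u
          gain_steep[OF elim(1), of "ramp_point \<omega> \<epsilon>" "us + \<epsilon>"]
        by (auto simp: vertex_simps)
    qed
  qed
  show "riemann_limit F (u, w) (us, \<omega>) \<xi> u (\<kappa> * (um - u))"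
    if x: "\<xi> * (u - us) < \<kappa> * (um - u) - \<omega>"
  proof (rule riemann_limitI[OF _ const_tendsto_right])
    have "\<xi> * (u - us) < (- \<kappa>) * (u - us)" using x \<omega> by (simp add: algebra_simps)
    then have \<xi>: "\<xi> < - \<kappa>" by (rule mult_right_less_imp_less) (use u in simp)
    have "\<forall>\<^sub>F \<epsilon> in at_right 0. gain \<xi> \<epsilon> (ramp_point \<omega> \<epsilon>) < gain \<xi> \<epsilon> u"
      by (rule eventually_less_of_tendsto[OF gain_ramp_point_tendsto[OF \<omega>] gain_const_tendsto(2)])
        (use u x in \<open>auto simp: algebra_simps\<close>)
    with ev show "\<forall>\<^sub>F \<epsilon> in at_right 0. ?P \<epsilon> u"
    proof eventually_elim
      case (elim \<epsilon>)
      then have e: "0 < \<epsilon>" "us + \<epsilon> < u" by (auto simp: small_def)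
      show ?case using elim e ramp_point[OF e(1) \<omega>] u \<xi> gain_right_mono[of \<epsilon> "us + \<epsilon>" u \<xi>]
        by (auto simp: vertex_simps)
    qed
  qed (use u in auto)
qed

lemma riemann_cong_cong:
  assumes u: "us < u" and v: "us < v"
  shows "\<xi> < - \<kappa> \<Longrightarrow> riemann_limit F (u, w) (v, w') \<xi> u (\<kappa> * (um - u))"
    and "- \<kappa> < \<xi> \<Longrightarrow> riemann_limit F (u, w) (v, w') \<xi> v (\<kappa> * (um - v))"
proof -
  let ?P = "optimal_vertex (u, w) (v, w') \<xi>"
  have ev: "\<forall>\<^sub>F \<epsilon> in at_right 0. small \<xi> (min u v - us) \<epsilon>"
    by (rule eventually_small) (use u v in simp)
  show "riemann_limit F (u, w) (v, w') \<xi> u (\<kappa> * (um - u))" if x: "\<xi> < - \<kappa>"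
  proof (rule riemann_limitI[OF _ const_tendsto_right])
    from ev show "\<forall>\<^sub>F \<epsilon> in at_right 0. ?P \<epsilon> u"
    proof eventually_elim
      case (elim \<epsilon>)
      then have e: "0 < \<epsilon>" "us + \<epsilon> < u" "us + \<epsilon> < v" by (auto simp: small_def)
      show ?case using e u v x gain_right_mono[of \<epsilon> u v \<xi>] gain_right_mono[of \<epsilon> v u \<xi>]
        by (auto simp: vertex_simps)
    qed
  qed (use u in auto)
  show "riemann_limit F (u, w) (v, w') \<xi> v (\<kappa> * (um - v))" if x: "- \<kappa> < \<xi>"
  proof (rule riemann_limitI[OF _ const_tendsto_right])
    from ev show "\<forall>\<^sub>F \<epsilon> in at_right 0. ?P \<epsilon> v"
    proof eventually_elim
      case (elim \<epsilon>)
      then have e: "0 < \<epsilon>" "us + \<epsilon> < u" "us + \<epsilon> < v" by (auto simp: small_def)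
      show ?case using e u v x gain_right_anti[of \<epsilon> u v \<xi>] gain_right_anti[of \<epsilon> v u \<xi>]
        by (auto simp: vertex_simps)
    qed
  qed (use v in auto)
qed

end

subsection \<open>Admissible profiles on roads\<close>

text \<open>Jumps are listed additively and in no particular order. A flux with jumps
  \<open>s1 * d1\<close> and \<open>s2 * d2\<close> satisfies the Rankine-Hugoniot relations by
  construction; two jumps cover a shock followed by a contact.\<close>

definition step :: "real \<Rightarrow> real \<Rightarrow> real \<Rightarrow> real \<Rightarrow> real \<Rightarrow> real \<Rightarrow> real" where
  "step c d1 s1 d2 s2 \<xi> = c + (if s1 \<le> \<xi> then d1 else 0) + (if s2 \<le> \<xi> then d2 else 0)"

context pl_road begin

definition congested :: "real \<Rightarrow> real" where
  "congested \<gamma> = (if bot_flux \<le> \<gamma> then us else um - \<gamma> / \<kappa>)"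

text \<open>The demand of the road: a free datum sends at most its own flux, while from other data
  waves of nonpositive speed can reach \<open>top_flux\<close>.\<close>

definition capacity_in :: "real \<Rightarrow> real" where
  "capacity_in u0 = (if u0 < us then \<alpha> * u0 else top_flux)"

text \<open>The supply of the road: free traffic ahead lets \<open>top_flux\<close> enter, critical
  or congested traffic at most its own flux.\<close>

definition capacity_out :: "real \<times> real \<Rightarrow> real" where
  "capacity_out s0 = (if fst s0 < us then top_flux else snd s0)"

text \<open>A canonical wave with junction flux \<gamma>. The limit clause ranges over every flux
  \<open>w0\<close> of the datum, since the wave does not remember it. The last clause is the
  largest flux of a free datum: the shock to \<open>congested \<gamma>\<close> stands still at the
  junction and the road stays in state \<open>u0\<close>.\<close>

definition incoming_profile :: "real \<Rightarrow> real \<Rightarrow> (real \<Rightarrow> real) \<Rightarrow> (real \<Rightarrow> real) \<Rightarrow> bool" where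
  "incoming_profile u0 \<gamma> U W \<longleftrightarrow>
     (\<exists>c w d1 s1 d2 s2. U = step c d1 s1 d2 s2 \<and> W = step w (s1 * d1) s1 (s2 * d2) s2 \<and>
        s1 \<le> 0 \<and> s2 \<le> 0 \<and> w + s1 * d1 + s2 * d2 = \<gamma>) \<and>
     (\<forall>\<xi>. W \<xi> \<in> ftilde F (U \<xi>)) \<and>
     (\<exists>S. finite S \<and> (\<forall>w0\<in>ftilde F u0. \<forall>\<xi>. \<xi> \<notin> S \<longrightarrow>
        riemann_limit F (u0, w0) (congested \<gamma>, \<gamma>) \<xi> (U \<xi>) (W \<xi>))) \<and>
     (\<forall>\<xi>>0. U \<xi> = congested \<gamma> \<and> W \<xi> = \<gamma>) \<and>
     (u0 < us \<and> \<gamma> = \<alpha> * u0 \<longrightarrow> (\<forall>\<xi><0. U \<xi> = u0 \<and> W \<xi> = \<gamma>))"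

text \<open>The counterpart with the free state \<gamma> / \<alpha> at the junction. The last clause
  is again the standing shock, which occurs when \<gamma> is the flux of a critical or congested
  datum.\<close>

definition outgoing_profile :: "real \<times> real \<Rightarrow> real \<Rightarrow> (real \<Rightarrow> real) \<Rightarrow> (real \<Rightarrow> real) \<Rightarrow> bool" where
  "outgoing_profile s0 \<gamma> U W \<longleftrightarrow>
     (\<exists>c d1 s1 d2 s2. U = step c d1 s1 d2 s2 \<and> W = step \<gamma> (s1 * d1) s1 (s2 * d2) s2 \<and>
        0 \<le> s1 \<and> 0 \<le> s2) \<and>
     (\<forall>\<xi>. W \<xi> \<in> ftilde F (U \<xi>)) \<and>
     (\<exists>S. finite S \<and> (\<forall>\<xi>. \<xi> \<notin> S \<longrightarrow> riemann_limit F (\<gamma> / \<alpha>, \<gamma>) s0 \<xi> (U \<xi>) (W \<xi>))) \<and>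
     (\<forall>\<xi><0. U \<xi> = \<gamma> / \<alpha> \<and> W \<xi> = \<gamma>) \<and>
     (us \<le> fst s0 \<and> \<gamma> = snd s0 \<longrightarrow> (\<forall>\<xi>>0. U \<xi> = fst s0 \<and> W \<xi> = \<gamma>))"

lemma ftilde_crit: "ftilde F us = {bot_flux..top_flux}"
  by (simp add: ftilde_def branch1_eq branch2_eq)

lemma ftilde_free: "u < us \<Longrightarrow> ftilde F u = (if 0 \<le> u then {\<alpha> * u} else {})"
  using ustar_less by (auto simp: ftilde_def branch1_eq flux_def)

lemma ftilde_cong: "us < u \<Longrightarrow> ftilde F u = (if u \<le> um then {\<kappa> * (um - u)} else {})"
  using ustar_pos by (auto simp: ftilde_def branch2_eq flux_def)

lemma ftilde_congested:
  assumes "\<gamma> \<in> {0..top_flux}"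
  shows "\<gamma> \<in> ftilde F (congested \<gamma>)" "congested \<gamma> \<in> {us..um}"
proof -
  have "us < um - \<gamma> / \<kappa>" if "\<gamma> < bot_flux" using that \<kappa>_pos by (simp add: field_simps)
  then show "\<gamma> \<in> ftilde F (congested \<gamma>)" "congested \<gamma> \<in> {us..um}"
    using assms \<kappa>_pos ustar_less by (auto simp: congested_def ftilde_crit ftilde_cong)
qed

lemma congested_eq: "us \<le> v \<Longrightarrow> \<omega> \<in> ftilde F v \<Longrightarrow> congested \<omega> = v"
  using \<kappa>_pos by (cases "v = us") (auto simp: congested_def ftilde_crit ftilde_cong split: if_splits)

lemma ftilde_free_flux:
  assumes "\<gamma> \<in> {0..top_flux}"
  shows "\<gamma> \<in> ftilde F (\<gamma> / \<alpha>)" "\<gamma> / \<alpha> \<in> {0..us}"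
proof -
  have eq: "\<alpha> * (\<gamma> / \<alpha>) = \<gamma>" using \<alpha>_pos by simp
  have range: "0 \<le> \<gamma> / \<alpha>" "\<gamma> / \<alpha> \<le> us" using assms \<alpha>_pos by (simp_all add: field_simps)
  then show "\<gamma> / \<alpha> \<in> {0..us}" by simp
  show "\<gamma> \<in> ftilde F (\<gamma> / \<alpha>)"
  proof (cases "\<gamma> / \<alpha> = us")
    case True
    then have "\<gamma> = top_flux" using eq by simp
    then show ?thesis unfolding True ftilde_crit using jump by simp
  next
    case False
    then show ?thesis using range eq by (subst ftilde_free) auto
  qed
qed

lemma single_jump:
  assumes "c \<noteq> v" and "s = (\<gamma> - w) / (v - c)"
  shows "step c (v - c) s 0 0 \<xi> = (if s \<le> \<xi> then v else c)"
    and "step w (s * (v - c)) s (0 * 0) 0 \<xi> = (if s \<le> \<xi> then \<gamma> else w)"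
    and "w + s * (v - c) + 0 * 0 = \<gamma>"
  using assms by (auto simp: step_def)

text \<open>The speed is dictated by Rankine-Hugoniot. \<open>c\<close> and \<open>w\<close> are the
  left state that is visible in the limit; for a critical datum this can be (\<open>us\<close>,
  \<open>bot_flux\<close>) in place of the prescribed flux.\<close>

lemma incoming_profile_single:
  assumes c: "c \<noteq> congested \<gamma>" and w: "w \<in> ftilde F c" and \<gamma>: "\<gamma> \<in> {0..top_flux}" and S: "finite S"
    and neg: "(\<gamma> - w) / (congested \<gamma> - c) \<le> 0"
    and lim: "\<And>w0 \<xi>. w0 \<in> ftilde F u0 \<Longrightarrow> \<xi> \<notin> S \<Longrightarrow> \<xi> < (\<gamma> - w) / (congested \<gamma> - c) \<Longrightarrow>
        riemann_limit F (u0, w0) (congested \<gamma>, \<gamma>) \<xi> c w"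
       "\<And>w0 \<xi>. w0 \<in> ftilde F u0 \<Longrightarrow> \<xi> \<notin> S \<Longrightarrow> (\<gamma> - w) / (congested \<gamma> - c) < \<xi> \<Longrightarrow>
        riemann_limit F (u0, w0) (congested \<gamma>, \<gamma>) \<xi> (congested \<gamma>) \<gamma>"
    and u0: "u0 < us \<Longrightarrow> c = u0 \<and> w = \<alpha> * u0"
  shows "\<exists>U W. incoming_profile u0 \<gamma> U W"
proof -
  define s where "s = (\<gamma> - w) / (congested \<gamma> - c)"
  note j = single_jump[OF c s_def]
  let ?U = "step c (congested \<gamma> - c) s 0 0"
  \<comment> \<open>The void second jump is written \<open>0 * 0\<close> to match the form
    \<open>s2 * d2\<close>.\<close>
  let ?W = "step w (s * (congested \<gamma> - c)) s (0 * 0) 0"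
  have "incoming_profile u0 \<gamma> ?U ?W"
    unfolding incoming_profile_def
  proof (intro conjI)
    show "\<exists>c' w' d1 s1 d2 s2. ?U = step c' d1 s1 d2 s2 \<and>
        ?W = step w' (s1 * d1) s1 (s2 * d2) s2 \<and>
        s1 \<le> 0 \<and> s2 \<le> 0 \<and> w' + s1 * d1 + s2 * d2 = \<gamma>"
      using neg j(3) unfolding s_def[symmetric]
      by (intro exI[of _ c] exI[of _ w] exI[of _ "congested \<gamma> - c"] exI[of _ s] exI[of _ 0]) simp
    show "\<forall>\<xi>. ?W \<xi> \<in> ftilde F (?U \<xi>)"
      unfolding j using w ftilde_congested[OF \<gamma>] by simp
    show "\<exists>S. finite S \<and> (\<forall>w0\<in>ftilde F u0. \<forall>\<xi>. \<xi> \<notin> S \<longrightarrow>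
        riemann_limit F (u0, w0) (congested \<gamma>, \<gamma>) \<xi> (?U \<xi>)
          (?W \<xi>))"
      unfolding j using S lim[folded s_def] by (intro exI[of _ "insert s S"]) auto
    show "\<forall>\<xi>>0. ?U \<xi> = congested \<gamma> \<and>
        ?W \<xi> = \<gamma>"
      unfolding j using neg by (auto simp: s_def)
    show "u0 < us \<and> \<gamma> = \<alpha> * u0 \<longrightarrow> (\<forall>\<xi><0. ?U \<xi> = u0 \<and>
        ?W \<xi> = \<gamma>)"
      unfolding j using u0 by (auto simp: s_def)
  qed
  then show ?thesis by blast
qed

lemma step_const: "step c 0 0 0 0 \<xi> = c"
  by (simp add: step_def)

lemma incoming_profile_const:
  assumes \<gamma>: "\<gamma> \<in> {0..top_flux}" and S: "finite S"
    and lim: "\<And>w0 \<xi>. w0 \<in> ftilde F u0 \<Longrightarrow> \<xi> \<notin> S \<Longrightarrow>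
        riemann_limit F (u0, w0) (congested \<gamma>, \<gamma>) \<xi> (congested \<gamma>) \<gamma>"
    and u0: "us \<le> u0"
  shows "\<exists>U W. incoming_profile u0 \<gamma> U W"
proof -
  have "\<exists>c w d1 s1 d2 s2. (\<lambda>_. congested \<gamma>) = step c d1 s1 d2 s2 \<and>
        (\<lambda>_. \<gamma>) = step w (s1 * d1) s1 (s2 * d2) s2 \<and> s1 \<le> 0 \<and> s2 \<le> 0 \<and> w + s1 * d1 + s2 * d2 = \<gamma>"
    by (intro exI[of _ "congested \<gamma>"] exI[of _ \<gamma>] exI[of _ 0]) (auto simp: step_const)
  then have "incoming_profile u0 \<gamma> (\<lambda>_. congested \<gamma>) (\<lambda>_. \<gamma>)"
    unfolding incoming_profile_def using ftilde_congested[OF \<gamma>] S lim u0 by auto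
  then show ?thesis by blast
qed

text \<open>The junction state is \<open>congested \<gamma>\<close>, which is critical exactly from
  \<open>bot_flux\<close> on; this and the type of the datum give the cases. Up to the capacity all
  speeds come out nonpositive.\<close>

lemma ex_incoming_profile:
  assumes u0: "u0 \<in> {0..um}" and \<gamma>: "\<gamma> \<in> {0..capacity_in u0}"
  shows "\<exists>U W. incoming_profile u0 \<gamma> U W"
proof -
  let ?v = "congested \<gamma>"
  have cap: "capacity_in u0 \<le> top_flux" using \<alpha>_pos by (simp add: capacity_in_def)
  with \<gamma> have \<gamma>t: "\<gamma> \<in> {0..top_flux}" by auto
  have v_crit: "bot_flux \<le> \<gamma> \<Longrightarrow> ?v = us" by (simp add: congested_def)
  have v_cong: "us < ?v \<and> \<kappa> * (um - ?v) = \<gamma>" if "\<gamma> < bot_flux"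
    using that \<kappa>_pos by (simp add: congested_def field_simps)
  consider (free) "u0 < us" | (crit) "u0 = us" | (cong) "us < u0" by linarith
  then show ?thesis
  proof cases
    case free
    then have w0: "ftilde F u0 = {\<alpha> * u0}" using u0 by (simp add: ftilde_free)
    have \<gamma>u: "\<gamma> \<le> \<alpha> * u0" using \<gamma> free by (simp add: capacity_in_def)
    have ne: "u0 < ?v" using ftilde_congested[OF \<gamma>t] free by auto
    let ?s = "(\<gamma> - \<alpha> * u0) / (?v - u0)"
    have s_less: "\<xi> < ?s \<longleftrightarrow> \<xi> * (?v - u0) < \<gamma> - \<alpha> * u0" "?s < \<xi> \<longleftrightarrow> \<gamma> - \<alpha> * u0 < \<xi> * (?v - u0)" for \<xi>
      using ne by (simp_all add: pos_less_divide_eq pos_divide_less_eq)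
    have neg: "?s \<le> 0" using ne \<gamma>u by (simp add: divide_nonpos_pos)
    show ?thesis
    proof (cases "bot_flux \<le> \<gamma>")
      case True
      show ?thesis
        by (rule incoming_profile_single[where c = u0 and w = "\<alpha> * u0" and S = "{}"])
          (use ne w0 \<gamma>t neg s_less riemann_free_crit[OF free, of \<gamma>] v_crit[OF True] True in auto)
    next
      case False
      then have v: "us < ?v" "\<kappa> * (um - ?v) = \<gamma>" using v_cong by auto
      note rc = riemann_free_cong[OF free v(1), unfolded v(2)]
      show ?thesis
      \<comment> \<open>If the line of the congested branch, extended to \<open>u0\<close>, passes
        below the free flux, the lower hull bends at the end of the ramp: a shock of speed below
        -\<kappa> leads to (\<open>us\<close>, \<open>bot_flux\<close>) and a contact from there to
        \<open>?v\<close>.\<close>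
      proof (cases "\<kappa> * (um - u0) < \<alpha> * u0")
        case two: True
        define s where "s = (bot_flux - \<alpha> * u0) / (us - u0)"
        have s: "\<xi> < s \<longleftrightarrow> \<xi> * (us - u0) < bot_flux - \<alpha> * u0" "s < \<xi> \<longleftrightarrow> bot_flux - \<alpha> * u0 < \<xi> * (us - u0)" for \<xi>
          using free by (simp_all add: s_def pos_less_divide_eq pos_divide_less_eq)
        have sk: "s < - \<kappa>" unfolding s using two by (simp add: algebra_simps)
        have right: "\<gamma> - \<alpha> * u0 < \<xi> * (?v - u0)" if "- \<kappa> < \<xi>" for \<xi>
        proof -
          have "(- \<kappa>) * (?v - u0) < \<xi> * (?v - u0)" using that ne by (intro mult_strict_right_mono) auto
          moreover have "\<gamma> - \<alpha> * u0 < - \<kappa> * (?v - u0)"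
            using two v(2) by (simp add: algebra_simps)
          ultimately show ?thesis by linarith
        qed
        have s_eq: "s * (us - u0) = bot_flux - \<alpha> * u0" using free by (simp add: s_def)
        have k_eq: "- \<kappa> * (?v - us) = \<gamma> - bot_flux"
          using v(2) by (simp add: algebra_simps)
        let ?U = "step u0 (us - u0) s (?v - us) (- \<kappa>)"
        let ?W = "step (\<alpha> * u0) (s * (us - u0)) s (- \<kappa> * (?v - us)) (- \<kappa>)"
        have UW: "?U \<xi> = (if \<xi> < s then u0 else if \<xi> < - \<kappa> then us else ?v)"
          "?W \<xi> = (if \<xi> < s then \<alpha> * u0 else if \<xi> < - \<kappa> then bot_flux else \<gamma>)" for \<xi>
          using sk unfolding s_eq k_eq by (auto simp: step_def)
        have "incoming_profile u0 \<gamma> ?U ?W"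
          unfolding incoming_profile_def
        proof (intro conjI)
          show "\<exists>c w d1 s1 d2 s2. ?U = step c d1 s1 d2 s2 \<and> ?W = step w (s1 * d1) s1 (s2 * d2) s2 \<and>
              s1 \<le> 0 \<and> s2 \<le> 0 \<and> w + s1 * d1 + s2 * d2 = \<gamma>"
          proof (intro exI conjI)
            show "s \<le> 0" "- \<kappa> \<le> 0" using sk \<kappa>_pos by linarith+
            show "\<alpha> * u0 + s * (us - u0) + - \<kappa> * (?v - us) = \<gamma>" using s_eq k_eq by linarith
          qed (rule refl)+
          show "\<forall>\<xi>. ?W \<xi> \<in> ftilde F (?U \<xi>)"
            unfolding UW using ftilde_congested[OF \<gamma>t] w0 jump by (auto simp: ftilde_crit)
          have "riemann_limit F (u0, w0) (?v, \<gamma>) \<xi> (?U \<xi>) (?W \<xi>)" if ne: "\<xi> \<noteq> s" "\<xi> \<noteq> - \<kappa>" for w0 \<xi>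
          proof -
            consider "\<xi> < s" | "s < \<xi>" "\<xi> < - \<kappa>" | "- \<kappa> < \<xi>" using ne by linarith
            then show ?thesis
            proof cases
              case 1
              with sk have "\<xi> < - \<kappa>" by linarith
              from rc(3)[OF this s(1)[THEN iffD1, OF 1]] show ?thesis unfolding UW using 1 by simp
            next
              case 2
              from rc(4)[OF 2(2) s(2)[THEN iffD1, OF 2(1)]] show ?thesis unfolding UW using 2 by simp
            next
              case 3
              from rc(2)[OF 3 right[OF 3]] show ?thesis unfolding UW using 3 sk by simp
            qed
          qed
          then show "\<exists>S. finite S \<and> (\<forall>w0\<in>ftilde F u0. \<forall>\<xi>. \<xi> \<notin> S \<longrightarrow>
              riemann_limit F (u0, w0) (?v, \<gamma>) \<xi> (?U \<xi>) (?W \<xi>))"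
            by (intro exI[of _ "{s, - \<kappa>}"]) simp
          show "\<forall>\<xi>>0. ?U \<xi> = ?v \<and> ?W \<xi> = \<gamma>" unfolding UW using sk \<kappa>_pos by auto
          \<comment> \<open>The datum flux exceeds \<open>bot_flux\<close> here, so the clause on
            the standing shock is vacuous.\<close>
          have "bot_flux < \<kappa> * (um - u0)" using free \<kappa>_pos by simp
          then have "\<gamma> \<noteq> \<alpha> * u0" using False two by linarith
          then show "u0 < us \<and> \<gamma> = \<alpha> * u0 \<longrightarrow> (\<forall>\<xi><0. ?U \<xi> = u0 \<and> ?W \<xi> = \<gamma>)" by simp
        qed
        then show ?thesis by blast
      next
        case one: False
        \<comment> \<open>Now the datum lies on or below the extended line, so the chord to
          \<open>?v\<close> stays on or below the congested branch: one shock, no slower than the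
          contact.\<close>
        have ks: "- \<kappa> \<le> ?s"
          unfolding pos_le_divide_eq[OF diff_gt_0_iff_gt[THEN iffD2, OF ne]]
          using one v(2) by (simp add: algebra_simps)
        have left: "\<xi> * (us - u0) < bot_flux - \<alpha> * u0" if "\<xi> < - \<kappa>" for \<xi>
        proof -
          have "\<xi> * (us - u0) < (- \<kappa>) * (us - u0)" using that free by (intro mult_strict_right_mono) auto
          then show ?thesis using one by (simp add: algebra_simps)
        qed
        have l: "riemann_limit F (u0, w) (?v, \<gamma>) \<xi> u0 (\<alpha> * u0)" if "\<xi> < ?s" "\<xi> \<noteq> - \<kappa>" for w \<xi>
          using that rc(1,3) left s_less by (cases "\<xi> < - \<kappa>") auto
        have r: "riemann_limit F (u0, w) (?v, \<gamma>) \<xi> ?v \<gamma>" if "?s < \<xi>" for w \<xi>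
        proof -
          have "- \<kappa> < \<xi>" using that ks by linarith
          from rc(2)[OF this s_less(2)[THEN iffD1, OF that]] show ?thesis .
        qed
        show ?thesis
          by (rule incoming_profile_single[where c = u0 and w = "\<alpha> * u0" and S = "{- \<kappa>}"])
            (use ne w0 \<gamma>t neg l r in auto)
      qed
    qed
  next
    case crit
    show ?thesis
    proof (cases "bot_flux \<le> \<gamma>")
      case True
      show ?thesis
        by (rule incoming_profile_const[where S = "{}"])
          (use \<gamma>t crit True v_crit[OF True] riemann_crit_crit in \<open>auto simp: ftilde_crit\<close>)
    next
      case False
      then have v: "us < ?v" "\<kappa> * (um - ?v) = \<gamma>" using v_cong by auto
      have s: "(\<gamma> - bot_flux) / (?v - us) = - \<kappa>"
      proof -
        have "\<gamma> - bot_flux = - \<kappa> * (?v - us)" using v(2) by (simp add: algebra_simps)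
        then show ?thesis using v(1) by simp
      qed
      show ?thesis
        by (rule incoming_profile_single[where c = us and w = bot_flux and S = "{}"], unfold s)
          (use \<gamma>t crit v \<kappa>_pos jump riemann_crit_cong[OF _ v(1)] in \<open>auto simp: ftilde_crit\<close>)
    qed
  next
    case cong
    then have w0: "ftilde F u0 = {\<kappa> * (um - u0)}" using u0 by (simp add: ftilde_cong)
    show ?thesis
    proof (cases "bot_flux \<le> \<gamma>")
      case True
      let ?s = "(\<gamma> - \<kappa> * (um - u0)) / (us - u0)"
      have e: "?s = (\<kappa> * (um - u0) - \<gamma>) / (u0 - us)" using cong by (simp add: field_simps)
      have s: "\<xi> < ?s \<longleftrightarrow> \<xi> * (u0 - us) < \<kappa> * (um - u0) - \<gamma>" "?s < \<xi> \<longleftrightarrow> \<kappa> * (um - u0) - \<gamma> < \<xi> * (u0 - us)" for \<xi>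
        unfolding e using cong by (simp_all add: pos_less_divide_eq pos_divide_less_eq)
      have "\<kappa> * (um - u0) < bot_flux" using cong \<kappa>_pos by simp
      then have neg: "?s \<le> 0" unfolding e using True cong by (intro divide_nonpos_pos) auto
      show ?thesis
        by (rule incoming_profile_single[where c = u0 and w = "\<kappa> * (um - u0)" and S = "{- \<kappa>}"])
          (use \<gamma>t cong w0 neg s True v_crit[OF True] riemann_cong_crit[OF cong, of \<gamma>] in auto)
    next
      case False
      then have v: "us < ?v" "\<kappa> * (um - ?v) = \<gamma>" using v_cong by auto
      note rc = riemann_cong_cong[OF cong v(1), unfolded v(2)]
      show ?thesis
      proof (cases "?v = u0")
        case True
        show ?thesis
          by (rule incoming_profile_const[where S = "{- \<kappa>}"])
            (use \<gamma>t cong rc v(2) True in \<open>auto simp: neq_iff\<close>)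
      next
        case ne: False
        have s: "(\<gamma> - \<kappa> * (um - u0)) / (?v - u0) = - \<kappa>"
        proof -
          have "\<gamma> - \<kappa> * (um - u0) = - \<kappa> * (?v - u0)" using v(2) by (simp add: algebra_simps)
          then show ?thesis using ne by simp
        qed
        show ?thesis
          by (rule incoming_profile_single[where c = u0 and w = "\<kappa> * (um - u0)" and S = "{}"], unfold s)
            (use \<gamma>t cong w0 ne v \<kappa>_pos rc in auto)
      qed
    qed
  qed
qed


lemma outgoing_profile_single:
  assumes c: "\<gamma> / \<alpha> \<noteq> u0" and w: "w0 \<in> ftilde F u0" and \<gamma>: "\<gamma> \<in> {0..top_flux}" and S: "finite S"
    and pos: "0 \<le> (w0 - \<gamma>) / (u0 - \<gamma> / \<alpha>)"
    and lim: "\<And>\<xi>. \<xi> \<notin> S \<Longrightarrow> \<xi> < (w0 - \<gamma>) / (u0 - \<gamma> / \<alpha>) \<Longrightarrow>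
        riemann_limit F (\<gamma> / \<alpha>, \<gamma>) (u0, w0) \<xi> (\<gamma> / \<alpha>) \<gamma>"
       "\<And>\<xi>. \<xi> \<notin> S \<Longrightarrow> (w0 - \<gamma>) / (u0 - \<gamma> / \<alpha>) < \<xi> \<Longrightarrow>
        riemann_limit F (\<gamma> / \<alpha>, \<gamma>) (u0, w0) \<xi> u0 w0"
  shows "\<exists>U W. outgoing_profile (u0, w0) \<gamma> U W"
proof -
  define c where "c = \<gamma> / \<alpha>"
  define s where "s = (w0 - \<gamma>) / (u0 - c)"
  have "c \<noteq> u0" using assms(1) by (simp add: c_def)
  note j = single_jump[OF this s_def]
  let ?U = "step c (u0 - c) s 0 0"
  let ?W = "step \<gamma> (s * (u0 - c)) s (0 * 0) 0"
  have "outgoing_profile (u0, w0) \<gamma> ?U ?W"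
    unfolding outgoing_profile_def
  proof (intro conjI)
    show "\<exists>c' d1 s1 d2 s2. ?U = step c' d1 s1 d2 s2 \<and>
        ?W = step \<gamma> (s1 * d1) s1 (s2 * d2) s2 \<and> 0 \<le> s1 \<and> 0 \<le> s2"
      using pos unfolding c_def[symmetric] s_def[symmetric]
      by (intro exI[of _ c] exI[of _ "u0 - c"] exI[of _ s] exI[of _ 0]) simp
    show "\<forall>\<xi>. ?W \<xi> \<in> ftilde F (?U \<xi>)"
      unfolding j using w ftilde_free_flux[OF \<gamma>] by (simp add: c_def)
    show "\<exists>S. finite S \<and> (\<forall>\<xi>. \<xi> \<notin> S \<longrightarrow>
        riemann_limit F (\<gamma> / \<alpha>, \<gamma>) (u0, w0) \<xi> (?U \<xi>) (?W \<xi>))"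
      unfolding j using S lim[folded c_def, folded s_def]
      by (intro exI[of _ "insert s S"]) (auto simp: c_def)
    show "\<forall>\<xi><0. ?U \<xi> = \<gamma> / \<alpha> \<and> ?W \<xi> = \<gamma>"
      unfolding j using pos by (auto simp: c_def s_def)
    show "us \<le> fst (u0, w0) \<and> \<gamma> = snd (u0, w0) \<longrightarrow>
        (\<forall>\<xi>>0. ?U \<xi> = fst (u0, w0) \<and> ?W \<xi> = \<gamma>)"
      unfolding j by (auto simp: s_def)
  qed
  then show ?thesis by blast
qed

lemma outgoing_profile_const:
  assumes \<gamma>: "\<gamma> \<in> {0..top_flux}" and S: "finite S"
    and lim: "\<And>\<xi>. \<xi> \<notin> S \<Longrightarrow> riemann_limit F (\<gamma> / \<alpha>, \<gamma>) (\<gamma> / \<alpha>, \<gamma>) \<xi> (\<gamma> / \<alpha>) \<gamma>"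
  shows "\<exists>U W. outgoing_profile (\<gamma> / \<alpha>, \<gamma>) \<gamma> U W"
proof -
  have "\<exists>c d1 s1 d2 s2. (\<lambda>_. \<gamma> / \<alpha>) = step c d1 s1 d2 s2 \<and>
        (\<lambda>_. \<gamma>) = step \<gamma> (s1 * d1) s1 (s2 * d2) s2 \<and> 0 \<le> s1 \<and> 0 \<le> s2"
    by (intro exI[of _ "\<gamma> / \<alpha>"] exI[of _ 0]) (auto simp: step_const)
  then have "outgoing_profile (\<gamma> / \<alpha>, \<gamma>) \<gamma> (\<lambda>_. \<gamma> / \<alpha>) (\<lambda>_. \<gamma>)"
    unfolding outgoing_profile_def using ftilde_free_flux[OF \<gamma>] S lim by auto
  then show ?thesis by blast
qed

lemma ftilde_range: "w \<in> ftilde F u \<Longrightarrow> w \<in> {0..top_flux}"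
proof -
  assume w: "w \<in> ftilde F u"
  consider "u < us" | "u = us" | "us < u" by linarith
  then show ?thesis
  proof cases
    case 1
    then have "0 \<le> u" "w = \<alpha> * u" using w by (auto simp: ftilde_free split: if_splits)
    then show ?thesis using 1 \<alpha>_pos by simp
  next
    case 2
    then show ?thesis using w bot_flux_pos by (auto simp: ftilde_crit)
  next
    case 3
    then have "u \<le> um" "w = \<kappa> * (um - u)" using w by (auto simp: ftilde_cong split: if_splits)
    moreover have "\<kappa> * (um - u) \<le> bot_flux" using 3 \<kappa>_pos by simp
    ultimately have "0 \<le> w" "w \<le> bot_flux" using \<kappa>_pos by simp_all
    then show ?thesis using jump by simp
  qed
qed

lemma capacity_out_le: "w0 \<in> ftilde F u0 \<Longrightarrow> capacity_out (u0, w0) \<in> {0..top_flux}"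
  using ftilde_range[of w0 u0] \<alpha>_pos ustar_pos by (simp add: capacity_out_def)

text \<open>From the junction state \<gamma> / \<alpha> a free datum is reached by a contact, a
  critical or congested one by a shock, whose speed is nonnegative as \<gamma> \<le>
  \<open>w0\<close>. Coinciding states give a constant profile.\<close>

lemma ex_outgoing_profile:
  assumes w0: "w0 \<in> ftilde F u0" and \<gamma>: "\<gamma> \<in> {0..capacity_out (u0, w0)}"
  shows "\<exists>U W. outgoing_profile (u0, w0) \<gamma> U W"
proof -
  have \<gamma>t: "\<gamma> \<in> {0..top_flux}" using \<gamma> capacity_out_le[OF w0] by auto
  obtain v where v_div: "\<gamma> / \<alpha> = v" and \<gamma>_eq: "\<gamma> = \<alpha> * v"
    using that[of "\<gamma> / \<alpha>"] \<alpha>_pos by simp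
  have v: "0 \<le> v" "v \<le> us" using ftilde_free_flux(2)[OF \<gamma>t] by (auto simp: v_div)
  consider (free) "u0 < us" | (crit) "u0 = us" | (cong) "us < u0" by linarith
  then show ?thesis
  proof cases
    case free
    then have w0u: "w0 = \<alpha> * u0" using w0 by (simp add: ftilde_free split: if_splits)
    have l: "riemann_limit F (v, \<gamma>) (u0, w0) \<xi> v \<gamma>" if "\<xi> < \<alpha>" for \<xi>
    proof (cases "v = us")
      case True
      then show ?thesis using riemann_crit_free(1)[OF _ free that, of \<gamma> w0] jump by (simp add: \<gamma>_eq)
    next
      case False
      then show ?thesis using riemann_free_free(1)[OF _ free that, of v \<gamma> w0] v(2) by (simp add: \<gamma>_eq)
    qed
    have r: "riemann_limit F (v, \<gamma>) (u0, w0) \<xi> u0 w0" if "\<alpha> < \<xi>" for \<xi>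
    proof (cases "v = us")
      case True
      then show ?thesis using riemann_crit_free(2)[OF _ free that, of \<gamma> w0] jump by (simp add: \<gamma>_eq w0u)
    next
      case False
      then show ?thesis using riemann_free_free(2)[OF _ free that, of v \<gamma> w0] v(2) by (simp add: w0u)
    qed
    show ?thesis
    proof (cases "v = u0")
      case True
      then have e: "u0 = v" "w0 = \<gamma>" using w0u \<gamma>_eq by simp_all
      have "riemann_limit F (v, \<gamma>) (v, \<gamma>) \<xi> v \<gamma>" if "\<xi> \<notin> {\<alpha>}" for \<xi>
        using l[of \<xi>] r[of \<xi>] that unfolding e by (cases "\<xi> < \<alpha>") auto
      then show ?thesis unfolding e by (intro outgoing_profile_const[OF \<gamma>t, of "{\<alpha>}", unfolded v_div]) auto
    next
      case False
      have s: "(w0 - \<gamma>) / (u0 - v) = \<alpha>"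
      proof -
        have "w0 - \<gamma> = \<alpha> * (u0 - v)" by (simp add: w0u \<gamma>_eq algebra_simps)
        then show ?thesis using False by simp
      qed
      show ?thesis
        by (rule outgoing_profile_single[where S = "{}"], unfold v_div s)
          (use False w0 \<gamma>t \<alpha>_pos l r in auto)
    qed
  next
    case crit
    then have w0c: "w0 \<in> {bot_flux..top_flux}" "\<gamma> \<le> w0" using w0 \<gamma> by (auto simp: ftilde_crit capacity_out_def)
    show ?thesis
    proof (cases "v = us")
      case True
      \<comment> \<open>Full flux against a critical datum: \<gamma> \<le> \<open>w0\<close> forces
        \<open>w0 = top_flux\<close>, so nothing moves.\<close>
      then have "\<gamma> = top_flux" using \<gamma>_eq by simp
      then have e: "u0 = v" "w0 = \<gamma>" using w0c crit True by auto
      have "riemann_limit F (v, \<gamma>) (v, \<gamma>) \<xi> v \<gamma>" for \<xi>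
        using riemann_crit_crit[of \<gamma> \<gamma> \<xi>] w0c True unfolding e by simp
      then show ?thesis unfolding e by (intro outgoing_profile_const[OF \<gamma>t, of "{}", unfolded v_div]) auto
    next
      case False
      then have vu: "v < us" using v by simp
      have s: "\<xi> < (w0 - \<gamma>) / (us - v) \<longleftrightarrow> \<xi> * (us - v) < w0 - \<alpha> * v"
        "(w0 - \<gamma>) / (us - v) < \<xi> \<longleftrightarrow> w0 - \<alpha> * v < \<xi> * (us - v)" for \<xi>
        using vu by (simp_all add: pos_less_divide_eq pos_divide_less_eq \<gamma>_eq)
      have pos: "0 \<le> (w0 - \<gamma>) / (us - v)" using vu w0c by simp
      show ?thesis
        by (rule outgoing_profile_single[where S = "{}"], unfold v_div crit)
          (use vu w0 crit \<gamma>t pos s riemann_free_crit[OF vu w0c(1), of _ \<gamma>] in \<open>auto simp: \<gamma>_eq[symmetric]\<close>)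
    qed
  next
    case cong
    then have w0u: "w0 = \<kappa> * (um - u0)" and \<gamma>w: "\<gamma> \<le> w0"
      using w0 \<gamma> by (auto simp: ftilde_cong capacity_out_def split: if_splits)
    have wb: "w0 < bot_flux" using cong \<kappa>_pos by (simp add: w0u)
    have vu: "v < us"
    proof -
      have "\<alpha> * v < \<alpha> * us" using wb \<gamma>w jump \<gamma>_eq by linarith
      then show ?thesis using \<alpha>_pos by simp
    qed
    have vu0: "v < u0" using vu cong by simp
    have s: "\<xi> < (w0 - \<gamma>) / (u0 - v) \<longleftrightarrow> \<xi> * (u0 - v) < w0 - \<alpha> * v"
      "(w0 - \<gamma>) / (u0 - v) < \<xi> \<longleftrightarrow> w0 - \<alpha> * v < \<xi> * (u0 - v)" for \<xi>
      using vu0 by (simp_all add: pos_less_divide_eq pos_divide_less_eq \<gamma>_eq)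
    have pos: "0 \<le> (w0 - \<gamma>) / (u0 - v)" using vu0 \<gamma>w by simp
    note rc = riemann_free_cong[OF vu cong, folded w0u \<gamma>_eq]
    have l: "riemann_limit F (v, \<gamma>) (u0, w0) \<xi> v \<gamma>" if x: "\<xi> < (w0 - \<gamma>) / (u0 - v)" "\<xi> \<noteq> - \<kappa>" for \<xi>
    proof (cases "\<xi> < - \<kappa>")
      case True
      \<comment> \<open>Left of -\<kappa> the competitor of \<open>v\<close> is the end of the ramp;
        it loses because \<xi> is negative and \<gamma> is below \<open>bot_flux\<close>.\<close>
      then have "\<xi> * (us - v) < 0" using vu \<kappa>_pos by (simp add: mult_neg_pos)
      then show ?thesis using rc(3)[OF True] wb \<gamma>w by simp
    next
      case False
      then show ?thesis using rc(1)[of \<xi>] s(1)[THEN iffD1, OF x(1)] x(2) by (simp add: \<gamma>_eq)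
    qed
    have r: "riemann_limit F (v, \<gamma>) (u0, w0) \<xi> u0 w0" if x: "(w0 - \<gamma>) / (u0 - v) < \<xi>" for \<xi>
      using rc(2)[of \<xi>] s(2)[THEN iffD1, OF x] x pos \<kappa>_pos by (simp add: \<gamma>_eq)
    show ?thesis
      by (rule outgoing_profile_single[where S = "{- \<kappa>}"], unfold v_div)
        (use vu0 w0 \<gamma>t pos l r in auto)
  qed
qed

section \<open>Junction states compatible with the sign of the speeds\<close>

lemma finite_avoid:
  fixes l r :: real
  assumes "finite S" "l < r"
  shows "\<exists>\<xi>. l < \<xi> \<and> \<xi> < r \<and> \<xi> \<notin> S"
proof -
  have "infinite {l<..<r}" using assms by (simp add: infinite_Ioo)
  then have "\<not> {l<..<r} \<subseteq> S" using assms finite_subset by blast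
  then show ?thesis by auto
qed

text \<open>The right state must be seen on positive rays off a finite set, so one suitable ray
  refutes an excluded pair. Between 0 and \<alpha> a free \<open>v\<close> is seen only if it equals
  \<open>u0\<close>; and if \<omega> exceeded the flux of a free datum, the shock would move right
  and \<open>u0\<close> would show on a small positive ray.\<close>

lemma incoming_wave_states:
  assumes u0: "u0 \<in> {0..um}" and w0: "w0 \<in> ftilde F u0" and \<omega>: "\<omega> \<in> ftilde F v" and S: "finite S"
    and lim: "\<And>\<xi> u w. 0 < \<xi> \<Longrightarrow> \<xi> \<notin> S \<Longrightarrow> riemann_limit F (u0, w0) (v, \<omega>) \<xi> u w \<Longrightarrow> u = v \<and> w = \<omega>"
  shows "v = congested \<omega> \<and> \<omega> \<le> capacity_in u0 \<or> v = u0 \<and> u0 < us \<and> \<omega> = \<alpha> * u0"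
proof -
  have \<omega>t: "\<omega> \<in> {0..top_flux}" by (rule ftilde_range[OF \<omega>])
  obtain \<xi> where \<xi>: "0 < \<xi>" "\<xi> < \<alpha>" "\<xi> \<notin> S" using finite_avoid[OF S \<alpha>_pos] by blast
  have k: "- \<kappa> < \<xi>" using \<xi> \<kappa>_pos by linarith
  consider "v < us" "u0 < us" | "v < us" "u0 = us" | "v < us" "us < u0" | "us \<le> v" "us \<le> u0" | "us \<le> v" "u0 < us"
    by linarith
  then show ?thesis
  proof cases
    case 1
    then show ?thesis using lim[OF \<xi>(1,3) riemann_free_free(1)[OF 1(2,1) \<xi>(2)]] \<omega>
      by (auto simp: ftilde_free split: if_splits)
  next
    case 2
    then show ?thesis using lim[OF \<xi>(1,3)] riemann_crit_free(1)[OF _ 2(1) \<xi>(2), of w0 \<omega>] w0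
      by (auto simp: ftilde_crit)
  next
    case 3
    then show ?thesis using lim[OF \<xi>(1,3) riemann_cong_free[OF 3(2,1) k \<xi>(2)]] by auto
  next
    case 4
    then show ?thesis using congested_eq[OF 4(1) \<omega>] \<omega>t by (simp add: capacity_in_def)
  next
    case 5
    have "\<omega> \<le> \<alpha> * u0"
    proof (rule ccontr)
      assume "\<not> \<omega> \<le> \<alpha> * u0"
      then have "0 < (\<omega> - \<alpha> * u0) / (v - u0)" using 5 by simp
      from finite_avoid[OF S this] obtain \<zeta> where \<zeta>: "0 < \<zeta>" "\<zeta> < (\<omega> - \<alpha> * u0) / (v - u0)" "\<zeta> \<notin> S"
        by blast
      have z: "\<zeta> * (v - u0) < \<omega> - \<alpha> * u0" using \<zeta>(2) 5 by (simp add: pos_less_divide_eq)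
      have "riemann_limit F (u0, w0) (v, \<omega>) \<zeta> u0 (\<alpha> * u0)"
      proof (cases "v = us")
        case True
        then show ?thesis using riemann_free_crit(1)[OF 5(2)] \<omega> z by (simp add: ftilde_crit)
      next
        case False
        then have "us < v" using 5 by simp
        then show ?thesis using riemann_free_cong(1)[OF 5(2), of v \<zeta>] \<omega> z \<zeta>(1) \<kappa>_pos
          by (simp add: ftilde_cong split: if_splits)
      qed
      from lim[OF \<zeta>(1,3) this] show False using 5 by simp
    qed
    then show ?thesis using congested_eq[OF 5(1) \<omega>] 5 by (simp add: capacity_in_def)
  qed
qed

text \<open>For a given flux the wave on x < b is unique off finitely many rays, although two
  junction states may carry that flux.\<close>

lemma incoming_wave_determined:
  assumes u0: "u0 \<in> {0..um}" and w0: "w0 \<in> ftilde F u0" and \<omega>: "\<omega> \<in> ftilde F v"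
    and wave: "incoming_wave F b (u0, w0) (v, \<omega>) u w"
  shows "\<omega> \<in> {0..capacity_in u0}"
    and "incoming_profile u0 \<omega> U W \<Longrightarrow> \<exists>S. finite S \<and> (\<forall>x<b. \<forall>t>0. (x - b) / t \<notin> S \<longrightarrow>
        u x t = U ((x - b) / t) \<and> w x t = W ((x - b) / t))"
proof -
  obtain U' W' where rs: "riemann_solution F (u0, w0) (v, \<omega>) U' W'"
    and pos: "\<forall>\<xi>>0. U' \<xi> = v \<and> W' \<xi> = \<omega>"
    and uw: "\<forall>x<b. \<forall>t>0. u x t = U' ((x - b) / t) \<and> w x t = W' ((x - b) / t)"
    using wave by (auto simp: incoming_wave_def)
  obtain S where S: "finite S" and det: "\<And>\<xi> u w. \<xi> \<notin> S \<Longrightarrow>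
      riemann_limit F (u0, w0) (v, \<omega>) \<xi> u w \<Longrightarrow> U' \<xi> = u \<and> W' \<xi> = w"
    using riemann_solution_determined[OF rs] by metis
  have st: "v = congested \<omega> \<and> \<omega> \<le> capacity_in u0 \<or> v = u0 \<and> u0 < us \<and> \<omega> = \<alpha> * u0"
    using det pos by (intro incoming_wave_states[OF u0 w0 \<omega> S]) metis
  then show "\<omega> \<in> {0..capacity_in u0}"
    using ftilde_range[OF \<omega>] by (auto simp: capacity_in_def)
  assume prof: "incoming_profile u0 \<omega> U W"
  have "\<exists>S'. finite S' \<and> (\<forall>\<xi><0. \<xi> \<notin> S' \<longrightarrow> U' \<xi> = U \<xi> \<and> W' \<xi> = W \<xi>)"
    using st
  proof
    assume v: "v = congested \<omega> \<and> \<omega> \<le> capacity_in u0"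
    obtain S' where "finite S'" "\<forall>w0\<in>ftilde F u0. \<forall>\<xi>. \<xi> \<notin> S' \<longrightarrow>
        riemann_limit F (u0, w0) (congested \<omega>, \<omega>) \<xi> (U \<xi>) (W \<xi>)"
      using prof by (auto simp: incoming_profile_def)
    moreover from this have "U' \<xi> = U \<xi> \<and> W' \<xi> = W \<xi>" if "\<xi> \<notin> S \<union> S'" for \<xi>
      using det[of \<xi> "U \<xi>" "W \<xi>"] w0 v that by simp
    ultimately show ?thesis using S by (intro exI[of _ "S \<union> S'"]) simp
  next
    \<comment> \<open>The free state \<open>u0\<close> persists at the junction; on the road this
      agrees with the standing-shock clause of the profile.\<close>
    assume v: "v = u0 \<and> u0 < us \<and> \<omega> = \<alpha> * u0"
    have "U' \<xi> = U \<xi> \<and> W' \<xi> = W \<xi>" if "\<xi> < 0" "\<xi> \<notin> S" for \<xi>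
      using det[OF that(2), of u0 "\<alpha> * u0"] riemann_free_free(1)[of u0 v \<xi> w0 \<omega>] that \<alpha>_pos v prof
      by (simp add: incoming_profile_def)
    then show ?thesis using S by blast
  qed
  then obtain S' where S': "finite S'" and eq: "\<And>\<xi>. \<xi> < 0 \<Longrightarrow> \<xi> \<notin> S' \<Longrightarrow> U' \<xi> = U \<xi> \<and> W' \<xi> = W \<xi>"
    by blast
  show "\<exists>S. finite S \<and> (\<forall>x<b. \<forall>t>0. (x - b) / t \<notin> S \<longrightarrow>
        u x t = U ((x - b) / t) \<and> w x t = W ((x - b) / t))"
    using S' eq uw by (intro exI[of _ S']) (simp add: divide_neg_pos)
qed

section \<open>Closed forms of \<open>finv_plus\<close> and \<open>eta\<close>, and the prescribed
  state sets\<close>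

lemma finv_plus_eq: "finv_plus F = bot_flux / \<alpha>"
  unfolding finv_plus_def branch2_eq
proof (rule the_equality)
  have "bot_flux / \<alpha> < us" using jump \<alpha>_pos by (simp add: field_simps)
  then show "bot_flux / \<alpha> \<in> {0..<us} \<and> flux F (bot_flux / \<alpha>) = bot_flux"
    using bot_flux_pos \<alpha>_pos by (simp add: flux_def branch1_eq)
qed (use \<alpha>_pos in \<open>auto simp: flux_def branch1_eq field_simps\<close>)

lemma eta_free:
  assumes "0 \<le> u" "u \<le> finv_plus F"
  shows "eta F u = um - \<alpha> * u / \<kappa>"
proof -
  have u: "\<alpha> * u \<le> bot_flux" using assms \<alpha>_pos by (simp add: finv_plus_eq pos_le_divide_eq mult.commute)
  then have us: "u < us" using jump \<alpha>_pos by (metis le_less_trans mult_less_cancel_left_pos)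
  have eq: "\<kappa> * (um - v) = \<alpha> * u \<longleftrightarrow> v = um - \<alpha> * u / \<kappa>" for v
    using \<kappa>_pos by (auto simp: field_simps)
  have "us \<le> um - \<alpha> * u / \<kappa>" using u \<kappa>_pos by (simp add: field_simps)
  moreover have "um - \<alpha> * u / \<kappa> \<le> um" using assms(1) \<alpha>_pos \<kappa>_pos by simp
  moreover have "(THE v. v \<in> {us..um} \<and> branch2 F v = flux F u) = um - \<alpha> * u / \<kappa>"
  proof (rule the_equality)
    show "um - \<alpha> * u / \<kappa> \<in> {us..um} \<and> branch2 F (um - \<alpha> * u / \<kappa>) = flux F u"
      using calculation us eq[of "um - \<alpha> * u / \<kappa>"] by (simp add: flux_def branch1_eq branch2_eq)
    show "v = um - \<alpha> * u / \<kappa>" if "v \<in> {us..um} \<and> branch2 F v = flux F u" for v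
      using that us eq[of v] by (simp add: flux_def branch1_eq branch2_eq)
  qed
  ultimately show ?thesis using assms(2) by (simp add: eta_def)
qed

lemma eta_cong:
  assumes "us < u" "u \<le> um"
  shows "eta F u = \<kappa> * (um - u) / \<alpha>"
proof -
  let ?v = "\<kappa> * (um - u) / \<alpha>"
  have lt: "\<kappa> * (um - u) < bot_flux" using assms \<kappa>_pos by simp
  then have v: "?v < finv_plus F" "0 \<le> ?v"
    using assms \<kappa>_pos \<alpha>_pos by (auto simp: finv_plus_eq divide_strict_right_mono)
  have f: "finv_plus F < us" using jump \<alpha>_pos by (simp add: finv_plus_eq field_simps)
  have "(THE v. v \<in> {0..<finv_plus F} \<and> flux F v = flux F u) = ?v"
  proof (rule the_equality)
    show "?v \<in> {0..<finv_plus F} \<and> flux F ?v = flux F u"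
      using v f assms \<alpha>_pos by (simp add: flux_def branch1_eq branch2_eq)
    fix x assume "x \<in> {0..<finv_plus F} \<and> flux F x = flux F u"
    then have "\<alpha> * x = \<kappa> * (um - u)"
      using f assms by (simp add: flux_def branch1_eq branch2_eq split: if_splits)
    then show "x = ?v" using \<alpha>_pos by (simp add: field_simps)
  qed
  then show ?thesis using f assms by (simp add: eta_def)
qed

text \<open>State and flux are chosen before \<open>w0\<close>, so one wave serves all flux values
  of the datum. At the full flux of a free datum the state must be \<open>u0\<close>:
  \<open>congested \<gamma>\<close> gives the same wave on x < b, but for
  \<open>u0 \<le> finv_plus F\<close> it equals \<open>eta F u0\<close>, which the prescribed set
  omits.\<close>

lemma incoming_wave_exists:
  assumes u0: "u0 \<in> {0..um}" and \<gamma>: "\<gamma> \<in> {0..capacity_in u0}" and prof: "incoming_profile u0 \<gamma> U W"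
    and uw: "\<And>x t. x < b \<Longrightarrow> 0 < t \<Longrightarrow> u x t = U ((x - b) / t) \<and> w x t = W ((x - b) / t)"
  shows "\<exists>v\<in>incoming_states F u0. \<exists>\<omega>\<in>ftilde F v. \<forall>w0\<in>ftilde F u0. incoming_wave F b (u0, w0) (v, \<omega>) u w"
proof (cases "u0 < us \<and> \<gamma> = \<alpha> * u0")
  case True
  then have prof0: "\<And>\<xi>. \<xi> < 0 \<Longrightarrow> U \<xi> = u0 \<and> W \<xi> = \<gamma>" using prof by (simp add: incoming_profile_def)
  show ?thesis
  proof (intro bexI ballI)
    show "u0 \<in> incoming_states F u0" using True by (simp add: incoming_states_def)
    show "\<gamma> \<in> ftilde F u0" using True u0 by (simp add: ftilde_free)
    fix w0 assume "w0 \<in> ftilde F u0"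
    have "riemann_solution F (u0, w0) (u0, \<gamma>) (\<lambda>_. u0) (\<lambda>_. \<gamma>)"
      by (rule riemann_solutionI[of "{\<alpha>}"]) (use True riemann_free_free[of u0 u0 _ w0 \<gamma>] in \<open>auto simp: neq_iff\<close>)
    then show "incoming_wave F b (u0, w0) (u0, \<gamma>) u w"
      unfolding incoming_wave_def fst_conv snd_conv
      by (intro exI[of _ "\<lambda>_. u0"] exI[of _ "\<lambda>_. \<gamma>"]) (simp add: uw prof0 divide_neg_pos)
  qed
next
  case False
  have \<gamma>t: "\<gamma> \<in> {0..top_flux}" using \<gamma> \<alpha>_pos by (auto simp: capacity_in_def split: if_splits intro: order_trans)
  note cs = ftilde_congested[OF \<gamma>t]
  show ?thesis
  proof (intro bexI ballI)
    show "congested \<gamma> \<in> incoming_states F u0"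
    proof (cases "u0 \<le> finv_plus F")
      case True
      then have "\<alpha> * u0 \<le> bot_flux" using \<alpha>_pos by (simp add: finv_plus_eq pos_le_divide_eq mult.commute)
      then have "u0 < us" using jump \<alpha>_pos by (metis le_less_trans mult_less_cancel_left_pos)
      \<comment> \<open>Strict since the standing shock is excluded in this branch; this puts
        \<open>congested \<gamma>\<close> strictly beyond \<open>eta F u0\<close>.\<close>
      then have "\<gamma> < \<alpha> * u0" using False \<gamma> by (simp add: capacity_in_def)
      moreover from this have "congested \<gamma> = um - \<gamma> / \<kappa>" using \<open>\<alpha> * u0 \<le> bot_flux\<close> by (simp add: congested_def)
      ultimately show ?thesis
        using True cs(2) u0 \<kappa>_pos by (simp add: incoming_states_def eta_free divide_strict_right_mono)
    next
      case False
      then show ?thesis using cs(2) by (simp add: incoming_states_def)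
    qed
    show "\<gamma> \<in> ftilde F (congested \<gamma>)" by (rule cs)
    fix w0 assume w0: "w0 \<in> ftilde F u0"
    obtain S where "finite S" "\<forall>w0\<in>ftilde F u0. \<forall>\<xi>. \<xi> \<notin> S \<longrightarrow>
        riemann_limit F (u0, w0) (congested \<gamma>, \<gamma>) \<xi> (U \<xi>) (W \<xi>)"
      using prof by (auto simp: incoming_profile_def)
    then have "riemann_solution F (u0, w0) (congested \<gamma>, \<gamma>) U W"
      using w0 by (intro riemann_solutionI[of S]) auto
    then show "incoming_wave F b (u0, w0) (congested \<gamma>, \<gamma>) u w"
      unfolding incoming_wave_def using prof uw by (auto simp: incoming_profile_def)
  qed
qed

text \<open>The test rays are negative and lie right of -\<kappa>. A critical \<open>v\<close>
  before a free datum shows \<open>top_flux\<close> there, so \<omega> must have this value; before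
  a critical datum the right flux shows, so \<omega> = \<open>w0\<close>. For a free
  \<open>v\<close> before critical or congested traffic, a flux above \<open>w0\<close> would make
  the shock move left.\<close>

lemma outgoing_wave_states:
  assumes w0: "w0 \<in> ftilde F u0" and \<omega>: "\<omega> \<in> ftilde F v" and S: "finite S"
    and lim: "\<And>\<xi> u w. \<xi> < 0 \<Longrightarrow> \<xi> \<notin> S \<Longrightarrow> riemann_limit F (v, \<omega>) (u0, w0) \<xi> u w \<Longrightarrow> u = v \<and> w = \<omega>"
  shows "v = \<omega> / \<alpha> \<and> \<omega> \<le> capacity_out (u0, w0) \<or> v = u0 \<and> us \<le> u0 \<and> \<omega> = w0"
proof -
  have \<omega>t: "\<omega> \<in> {0..top_flux}" by (rule ftilde_range[OF \<omega>])
  obtain \<xi> where \<xi>: "- \<kappa> < \<xi>" "\<xi> < 0" "\<xi> \<notin> S" using finite_avoid[OF S, of "- \<kappa>" 0] \<kappa>_pos by auto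
  have a: "\<xi> < \<alpha>" using \<xi> \<alpha>_pos by linarith
  consider "v < us" "u0 < us" | "v = us" "u0 < us" | "us < v" "u0 < us" | "v < us" "us \<le> u0"
    | "v = us" "u0 = us" | "us < v" "u0 = us" | "v = us" "us < u0" | "us < v" "us < u0" by linarith
  then show ?thesis
  proof cases
    case 1
    then have "\<omega> = \<alpha> * v" using \<omega> by (auto simp: ftilde_free split: if_splits)
    then show ?thesis using \<omega>t 1 \<alpha>_pos by (simp add: capacity_out_def)
  next
    case 2
    then have "\<omega> = top_flux"
      using lim[OF \<xi>(2,3)] riemann_crit_free(1)[OF _ 2(2) a, of \<omega> w0] \<omega> by (auto simp: ftilde_crit)
    then show ?thesis using 2 \<alpha>_pos by (simp add: capacity_out_def)
  next
    case 3
    then show ?thesis using lim[OF \<xi>(2,3) riemann_cong_free[OF 3 \<xi>(1) a]] by simp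
  next
    case 4
    then have wv: "\<omega> = \<alpha> * v" using \<omega> by (auto simp: ftilde_free split: if_splits)
    have "\<omega> \<le> w0"
    proof (rule ccontr)
      assume "\<not> \<omega> \<le> w0"
      \<comment> \<open>The ray has to lie right of the shock and also right of -\<kappa>, where
        \<open>riemann_free_cong\<close> compares \<open>v\<close> with \<open>u0\<close>
        itself.\<close>
      then have "max (- \<kappa>) ((w0 - \<omega>) / (u0 - v)) < 0" using 4 \<kappa>_pos by (simp add: divide_neg_pos)
      from finite_avoid[OF S this] obtain \<zeta> where \<zeta>: "\<zeta> < 0" "- \<kappa> < \<zeta>" "(w0 - \<omega>) / (u0 - v) < \<zeta>" "\<zeta> \<notin> S"
        by auto
      have z: "w0 - \<alpha> * v < \<zeta> * (u0 - v)" using \<zeta>(3) 4 wv by (simp add: pos_divide_less_eq)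
      have "riemann_limit F (v, \<omega>) (u0, w0) \<zeta> u0 w0"
      proof (cases "u0 = us")
        case True
        then show ?thesis using riemann_free_crit(2)[OF 4(1)] w0 z by (simp add: ftilde_crit)
      next
        case False
        then have "us < u0" using 4 by simp
        then show ?thesis using riemann_free_cong(2)[OF 4(1), of u0 \<zeta>] w0 z \<zeta>(2)
          by (simp add: ftilde_cong split: if_splits)
      qed
      from lim[OF \<zeta>(1,4) this] show False using 4 by simp
    qed
    then show ?thesis using 4 wv \<alpha>_pos by (simp add: capacity_out_def)
  next
    case 5
    then have "\<omega> = w0"
      using lim[OF \<xi>(2,3)] riemann_crit_crit[of \<omega> w0 \<xi>] \<omega> w0 by (auto simp: ftilde_crit)
    then show ?thesis using 5 by simp
  next
    case 6
    have v: "\<omega> = \<kappa> * (um - v)" using \<omega> 6 by (auto simp: ftilde_cong split: if_splits)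
    have "(- \<kappa>) * (v - us) < \<xi> * (v - us)" using \<xi> 6 by (intro mult_strict_right_mono) auto
    then have "\<kappa> * (um - v) - w0 < \<xi> * (v - us)" using w0 6 by (simp add: ftilde_crit algebra_simps)
    then have "riemann_limit F (v, \<omega>) (us, w0) \<xi> us w0"
      using riemann_cong_crit(1)[OF 6(1), of w0 \<xi>] w0 6 \<xi> by (simp add: ftilde_crit)
    then show ?thesis using lim[OF \<xi>(2,3)] 6 by auto
  next
    case 7
    then have "riemann_limit F (v, \<omega>) (u0, w0) \<xi> u0 w0"
      using riemann_crit_cong(2)[OF _ 7(2) \<xi>(1), of \<omega> w0] \<omega> w0 by (simp add: ftilde_crit ftilde_cong split: if_splits)
    then show ?thesis using lim[OF \<xi>(2,3)] 7 by auto
  next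
    case 8
    then have "riemann_limit F (v, \<omega>) (u0, w0) \<xi> u0 w0"
      using riemann_cong_cong(2)[OF 8 \<xi>(1), of \<omega> w0] w0 by (simp add: ftilde_cong split: if_splits)
    then show ?thesis using lim[OF \<xi>(2,3)] 8 by auto
  qed
qed

lemma outgoing_wave_determined:
  assumes w0: "w0 \<in> ftilde F u0" and \<omega>: "\<omega> \<in> ftilde F v"
    and wave: "outgoing_wave F a (u0, w0) (v, \<omega>) u w"
  shows "\<omega> \<in> {0..capacity_out (u0, w0)}"
    and "outgoing_profile (u0, w0) \<omega> U W \<Longrightarrow> \<exists>S. finite S \<and> (\<forall>x>a. \<forall>t>0. (x - a) / t \<notin> S \<longrightarrow>
        u x t = U ((x - a) / t) \<and> w x t = W ((x - a) / t))"
proof -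
  obtain U' W' where rs: "riemann_solution F (v, \<omega>) (u0, w0) U' W'"
    and neg: "\<forall>\<xi><0. U' \<xi> = v \<and> W' \<xi> = \<omega>"
    and uw: "\<forall>x>a. \<forall>t>0. u x t = U' ((x - a) / t) \<and> w x t = W' ((x - a) / t)"
    using wave by (auto simp: outgoing_wave_def)
  obtain S where S: "finite S" and det: "\<And>\<xi> u w. \<xi> \<notin> S \<Longrightarrow>
      riemann_limit F (v, \<omega>) (u0, w0) \<xi> u w \<Longrightarrow> U' \<xi> = u \<and> W' \<xi> = w"
    using riemann_solution_determined[OF rs] by metis
  have st: "v = \<omega> / \<alpha> \<and> \<omega> \<le> capacity_out (u0, w0) \<or> v = u0 \<and> us \<le> u0 \<and> \<omega> = w0"
    using det neg by (intro outgoing_wave_states[OF w0 \<omega> S]) metis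
  then show "\<omega> \<in> {0..capacity_out (u0, w0)}"
    using ftilde_range[OF \<omega>] by (auto simp: capacity_out_def)
  assume prof: "outgoing_profile (u0, w0) \<omega> U W"
  have "\<exists>S'. finite S' \<and> (\<forall>\<xi>>0. \<xi> \<notin> S' \<longrightarrow> U' \<xi> = U \<xi> \<and> W' \<xi> = W \<xi>)"
    using st
  proof
    assume v: "v = \<omega> / \<alpha> \<and> \<omega> \<le> capacity_out (u0, w0)"
    obtain S' where "finite S'" "\<forall>\<xi>. \<xi> \<notin> S' \<longrightarrow> riemann_limit F (\<omega> / \<alpha>, \<omega>) (u0, w0) \<xi> (U \<xi>) (W \<xi>)"
      using prof by (auto simp: outgoing_profile_def)
    moreover from this have "U' \<xi> = U \<xi> \<and> W' \<xi> = W \<xi>" if "\<xi> \<notin> S \<union> S'" for \<xi>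
      using det[of \<xi> "U \<xi>" "W \<xi>"] v that by simp
    ultimately show ?thesis using S by (intro exI[of _ "S \<union> S'"]) simp
  next
    assume v: "v = u0 \<and> us \<le> u0 \<and> \<omega> = w0"
    have "riemann_limit F (v, \<omega>) (u0, w0) \<xi> u0 w0" if "\<xi> > 0" for \<xi>
    proof (cases "u0 = us")
      case True
      then show ?thesis using riemann_crit_crit v w0 by (simp add: ftilde_crit)
    next
      case False
      then have "us < u0" using v by simp
      then show ?thesis using riemann_cong_cong(2)[of u0 u0 \<xi> w0 w0] v w0 that \<kappa>_pos
        by (simp add: ftilde_cong split: if_splits)
    qed
    then show ?thesis using det v prof S by (intro exI[of _ S]) (auto simp: outgoing_profile_def)
  qed
  then obtain S' where S': "finite S'" and eq: "\<And>\<xi>. \<xi> > 0 \<Longrightarrow> \<xi> \<notin> S' \<Longrightarrow> U' \<xi> = U \<xi> \<and> W' \<xi> = W \<xi>"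
    by blast
  show "\<exists>S. finite S \<and> (\<forall>x>a. \<forall>t>0. (x - a) / t \<notin> S \<longrightarrow>
        u x t = U ((x - a) / t) \<and> w x t = W ((x - a) / t))"
    using S' eq uw by (intro exI[of _ S']) simp
qed

lemma outgoing_datum:
  assumes "u0 \<in> {0..um}"
  shows "snd (outgoing_datum F u0 free) \<in> ftilde F u0" "fst (outgoing_datum F u0 free) = u0"
  using assms jump by (auto simp: outgoing_datum_def ftilde_def branch1_eq branch2_eq)

text \<open>For a critical or congested datum, either \<gamma> is the datum flux and
  \<open>u0\<close> persists, or \<gamma> < \<open>w0\<close>; dividing the latter by \<alpha>
  yields the strict bounds by \<open>finv_plus F\<close> and \<open>eta F u0\<close> in the
  prescribed sets.\<close>

lemma outgoing_wave_exists:
  assumes u0: "u0 \<in> {0..um}" and s0: "s0 = outgoing_datum F u0 free"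
    and \<gamma>: "\<gamma> \<in> {0..capacity_out s0}" and prof: "outgoing_profile s0 \<gamma> U W"
    and uw: "\<And>x t. a < x \<Longrightarrow> 0 < t \<Longrightarrow> u x t = U ((x - a) / t) \<and> w x t = W ((x - a) / t)"
  shows "\<exists>v\<in>outgoing_states F u0 free. \<exists>\<omega>\<in>ftilde F v. outgoing_wave F a s0 (v, \<omega>) u w"
proof -
  obtain w0 where s0w: "s0 = (u0, w0)" and w0: "w0 \<in> ftilde F u0"
    using outgoing_datum[OF u0, of free] s0 by (metis prod.collapse)
  have \<gamma>t: "\<gamma> \<in> {0..top_flux}" using \<gamma> capacity_out_le[OF w0] by (auto simp: s0w)
  note fs = ftilde_free_flux[OF \<gamma>t]
  show ?thesis
  proof (cases "us \<le> u0 \<and> \<gamma> = w0")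
    case True
    then have prof0: "\<And>\<xi>. 0 < \<xi> \<Longrightarrow> U \<xi> = u0 \<and> W \<xi> = \<gamma>" using prof by (simp add: outgoing_profile_def s0w)
    have "riemann_solution F (u0, w0) (u0, w0) (\<lambda>_. u0) (\<lambda>_. w0)"
    proof (cases "u0 = us")
      case True
      then show ?thesis using riemann_crit_crit w0 by (intro riemann_solutionI[of "{}"]) (auto simp: ftilde_crit)
    next
      case False
      then have "us < u0" using \<open>us \<le> u0 \<and> \<gamma> = w0\<close> by simp
      then show ?thesis using riemann_cong_cong[of u0 u0 _ w0 w0] w0
        by (intro riemann_solutionI[of "{- \<kappa>}"]) (auto simp: ftilde_cong neq_iff split: if_splits)
    qed
    then have "outgoing_wave F a s0 (u0, w0) u w"
      unfolding outgoing_wave_def s0w fst_conv snd_conv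
      by (intro exI[of _ "\<lambda>_. u0"] exI[of _ "\<lambda>_. w0"]) (use True in \<open>simp add: uw prof0\<close>)
    moreover have "u0 \<in> outgoing_states F u0 free" using True ustar_pos by (simp add: outgoing_states_def)
    ultimately show ?thesis using w0 by blast
  next
    case False
    obtain S where "finite S" "\<forall>\<xi>. \<xi> \<notin> S \<longrightarrow> riemann_limit F (\<gamma> / \<alpha>, \<gamma>) s0 \<xi> (U \<xi>) (W \<xi>)"
      using prof by (auto simp: outgoing_profile_def)
    then have "riemann_solution F (\<gamma> / \<alpha>, \<gamma>) s0 U W" by (intro riemann_solutionI[of S]) auto
    then have "outgoing_wave F a s0 (\<gamma> / \<alpha>, \<gamma>) u w"
      unfolding outgoing_wave_def using prof uw by (auto simp: outgoing_profile_def)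
    moreover have "\<gamma> / \<alpha> \<in> outgoing_states F u0 free"
    proof (cases "us \<le> u0")
      case True
      then have lt: "\<gamma> / \<alpha> < w0 / \<alpha>"
        using False \<gamma> \<alpha>_pos by (intro divide_strict_right_mono) (auto simp: s0w capacity_out_def)
      show ?thesis
      proof (cases "u0 = us")
        case True
        then show ?thesis using lt fs s0 s0w
          by (auto simp: outgoing_states_def outgoing_datum_def finv_plus_eq branch1_eq branch2_eq)
      next
        case False
        then have "us < u0" "u0 \<le> um" using True u0 by auto
        then show ?thesis using lt fs w0 by (simp add: outgoing_states_def eta_cong ftilde_cong)
      qed
    next
      case False
      then show ?thesis using fs by (simp add: outgoing_states_def)
    qed
    ultimately show ?thesis using fs by blast
  qed
qed

end

subsection \<open>The linear program at the junction\<close>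

definition feasible :: "real^'m^'n \<Rightarrow> ('n::finite \<Rightarrow> real) \<Rightarrow> ('m::finite \<Rightarrow> real) \<Rightarrow> (real^'n) set" where
  "feasible A \<Gamma> \<Delta> = {x. (\<forall>i. x $ i \<in> {0..\<Gamma> i}) \<and> (\<forall>j. (\<Sum>i\<in>UNIV. A $ i $ j * x $ i) \<le> \<Delta> j)}"

lemma feasible_maximum_exists:
  fixes A :: "real^'m^'n"
  assumes "\<And>i. 0 \<le> \<Gamma> i" "\<And>j. 0 \<le> \<Delta> j"
  shows "\<exists>x\<in>feasible A \<Gamma> \<Delta>. \<forall>y\<in>feasible A \<Gamma> \<Delta>. (\<Sum>i\<in>UNIV. y $ i) \<le> (\<Sum>i\<in>UNIV. x $ i)"
proof -
  have eq: "feasible A \<Gamma> \<Delta> = cbox 0 (\<chi> i. \<Gamma> i) \<inter> {x. \<forall>j. (\<Sum>i\<in>UNIV. A $ i $ j * x $ i) \<le> \<Delta> j}"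
    by (auto simp: feasible_def mem_box_cart)
  have "compact (feasible A \<Gamma> \<Delta>)"
    unfolding eq by (intro compact_Int_closed compact_cbox closed_Collect_all closed_Collect_le continuous_intros)
  moreover have "0 \<in> feasible A \<Gamma> \<Delta>" using assms by (simp add: feasible_def)
  ultimately show ?thesis
    by (intro continuous_attains_sup continuous_intros) auto
qed

lemma feasible_maximum_unique:
  fixes A :: "real^'m^'n"
  assumes A: "distribution_matrix A"
    and x: "x \<in> feasible A \<Gamma> \<Delta>" "\<And>z. z \<in> feasible A \<Gamma> \<Delta> \<Longrightarrow> (\<Sum>i\<in>UNIV. z $ i) \<le> (\<Sum>i\<in>UNIV. x $ i)"
    and y: "y \<in> feasible A \<Gamma> \<Delta>" "(\<Sum>i\<in>UNIV. x $ i) \<le> (\<Sum>i\<in>UNIV. y $ i)"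
  shows "x = y"
proof (rule ccontr)
  assume "x \<noteq> y"
  define d where "d = y - x"
  have d: "d \<noteq> 0" using \<open>x \<noteq> y\<close> by (simp add: d_def)
  define z where "z = (1/2) *\<^sub>R (x + y)"
  define one :: "real^'n" where "one = (\<chi> i. 1)"
  define nrm :: "'n + 'm \<Rightarrow> real^'n" where "nrm = (\<lambda>k. case k of Inl i \<Rightarrow> axis i 1 | Inr j \<Rightarrow> column j A)"
  have plane: "constraint_plane A k = {e. nrm k \<bullet> e = 0}" for k
    by (auto simp: constraint_plane_def nrm_def orthogonal_comp_def orthogonal_def split: sum.split)
  have nrmL: "nrm (Inl i) \<bullet> e = e $ i" for i e by (simp add: nrm_def inner_axis')
  have nrmR: "nrm (Inr j) \<bullet> e = (\<Sum>i\<in>UNIV. A $ i $ j * e $ i)" for j e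
    by (simp add: nrm_def column_def inner_vec_def)
  have one: "one \<bullet> e = (\<Sum>i\<in>UNIV. e $ i)" for e by (simp add: one_def inner_vec_def)
  have feas: "v \<in> feasible A \<Gamma> \<Delta> \<longleftrightarrow> (\<forall>i. 0 \<le> nrm (Inl i) \<bullet> v \<and> nrm (Inl i) \<bullet> v \<le> \<Gamma> i) \<and>
      (\<forall>j. nrm (Inr j) \<bullet> v \<le> \<Delta> j)" for v
    by (auto simp: feasible_def nrmL nrmR)
  have nz: "nrm k \<bullet> z = (nrm k \<bullet> x + nrm k \<bullet> y) / 2" and nd: "nrm k \<bullet> d = nrm k \<bullet> y - nrm k \<bullet> x" for k
    by (simp_all add: z_def d_def inner_add_right inner_diff_right)
  have one_z: "one \<bullet> z = one \<bullet> x"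
    using x(2)[OF y(1)] y(2) by (simp add: z_def inner_add_right one[symmetric])
  define K0 where "K0 = {k. nrm k \<bullet> d = 0}"
  \<comment> \<open>A constraint active at the midpoint is constant along the segment, so it belongs to \<open>K0\<close>.\<close>
  have le0: "one \<bullet> e \<le> 0" if e: "\<And>k. k \<in> K0 \<Longrightarrow> nrm k \<bullet> e = 0" for e
  proof -
    have ev: "\<forall>\<^sub>F \<tau> in at_right 0. nrm k \<bullet> (z + \<tau> *\<^sub>R e) \<le> c"
      if c: "nrm k \<bullet> x \<le> c" "nrm k \<bullet> y \<le> c" for k c
    proof (cases "k \<in> K0")
      case True
      then show ?thesis using c e[OF True] nd[of k] by (simp add: inner_add_right nz K0_def)
    next
      case False
      then have "nrm k \<bullet> z < c" using c nd[of k] unfolding nz K0_def by auto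
      moreover have "((\<lambda>\<tau>. nrm k \<bullet> (z + \<tau> *\<^sub>R e)) \<longlongrightarrow> nrm k \<bullet> (z + 0 *\<^sub>R e)) (at_right 0)"
        by (intro tendsto_intros)
      ultimately have "\<forall>\<^sub>F \<tau> in at_right 0. nrm k \<bullet> (z + \<tau> *\<^sub>R e) < c"
        by (intro order_tendstoD(2)) auto
      then show ?thesis by eventually_elim simp
    qed
    have ev': "\<forall>\<^sub>F \<tau> in at_right 0. 0 \<le> nrm k \<bullet> (z + \<tau> *\<^sub>R e)"
      if c: "0 \<le> nrm k \<bullet> x" "0 \<le> nrm k \<bullet> y" for k
    proof (cases "k \<in> K0")
      case True
      then show ?thesis using c e[OF True] nd[of k] by (simp add: inner_add_right nz K0_def)
    next
      case False
      then have "0 < nrm k \<bullet> z" using c nd[of k] unfolding nz K0_def by auto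
      moreover have "((\<lambda>\<tau>. nrm k \<bullet> (z + \<tau> *\<^sub>R e)) \<longlongrightarrow> nrm k \<bullet> (z + 0 *\<^sub>R e)) (at_right 0)"
        by (intro tendsto_intros)
      ultimately have "\<forall>\<^sub>F \<tau> in at_right 0. 0 < nrm k \<bullet> (z + \<tau> *\<^sub>R e)"
        by (intro order_tendstoD(1)) auto
      then show ?thesis by eventually_elim simp
    qed
    have "\<forall>\<^sub>F \<tau> in at_right 0. z + \<tau> *\<^sub>R e \<in> feasible A \<Gamma> \<Delta>"
      unfolding feas using x(1) y(1) ev ev' unfolding feas
      by (intro eventually_conj eventually_all_finite) auto
    then have "\<forall>\<^sub>F \<tau> in at_right 0. z + \<tau> *\<^sub>R e \<in> feasible A \<Gamma> \<Delta> \<and> 0 < (\<tau>::real)"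
      using eventually_at_right_less by (rule eventually_conj)
    then obtain \<tau> :: real where \<tau>: "z + \<tau> *\<^sub>R e \<in> feasible A \<Gamma> \<Delta>" "0 < \<tau>"
      using eventually_happens trivial_limit_at_right_real by blast
    have "one \<bullet> z + \<tau> * (one \<bullet> e) \<le> one \<bullet> x"
      using x(2)[OF \<tau>(1)] unfolding one[symmetric] by (simp add: inner_add_right)
    then show ?thesis using \<tau>(2) by (simp add: one_z mult_le_0_iff)
  qed
  \<comment> \<open>Both \<open>e\<close> and \<open>- e\<close> can be followed from the midpoint,
    so the total flux can increase along neither.\<close>
  have zero: "one \<bullet> e = 0" if e: "\<And>k. k \<in> K0 \<Longrightarrow> nrm k \<bullet> e = 0" for e
    using le0[OF e] le0[of "- e"] e by fastforce
  obtain B where B: "B \<subseteq> nrm ` K0" "independent B" "nrm ` K0 \<subseteq> span B" "card B = dim (nrm ` K0)"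
    using basis_exists by blast
  have finB: "finite B" using B(2) by (rule independent_imp_finite)
  have cardB: "card B \<le> CARD('n) - 1"
  proof -
    \<comment> \<open>All normals in \<open>K0\<close> are orthogonal to \<open>d\<close>, so
      independent ones number at most \<open>CARD('n) - 1\<close>, the largest size of an index set
      in the condition on the matrix.\<close>
    have "B \<subseteq> {v. d \<bullet> v = 0}" using B(1) by (auto simp: K0_def inner_commute)
    then have "card B \<le> dim {v. d \<bullet> v = 0}" by (rule independent_card_le_dim[OF _ B(2)])
    then show ?thesis using dim_hyperplane[OF d] by simp
  qed
  \<comment> \<open>One index for each basis vector: different indices may have equal normals, while
    the condition counts indices.\<close>
  define K where "K = inv_into K0 nrm ` B"
  have cardK: "card K = card B" unfolding K_def
    by (intro card_image inj_on_inv_into B)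
  have nrmK: "nrm ` K = B" unfolding K_def using B(1) by (rule image_inv_into_cancel[OF refl])
  have "one \<bullet> e = 0" if e: "e \<in> (\<Inter>k\<in>K. constraint_plane A k)" for e
  proof (rule zero)
    have "\<forall>v\<in>B. orthogonal e v"
      using e unfolding plane nrmK[symmetric] by (auto simp: orthogonal_def inner_commute)
    then have orth: "orthogonal e v" if "v \<in> span B" for v
      using orthogonal_to_span[OF that] by auto
    fix k assume "k \<in> K0"
    then have "nrm k \<in> span B" using B(3) by blast
    from orth[OF this] show "nrm k \<bullet> e = 0" by (simp add: orthogonal_def inner_commute)
  qed
  then have mem: "one \<in> orthogonal_comp (\<Inter>k\<in>K. constraint_plane A k)"
    by (auto simp: orthogonal_comp_def orthogonal_def inner_commute)
  show False
  proof (cases "card K = 0")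
    case True
    \<comment> \<open>The condition on the matrix starts at one index. For none, the intersection is
      the whole space and (1,...,1) would be orthogonal to itself.\<close>
    then have "K = {}" using finB by (simp add: K_def)
    then have "orthogonal one one" using mem by (simp add: orthogonal_comp_def)
    then show False by (simp add: orthogonal_def one) (simp add: one_def)
  next
    case False
    then show False using A mem cardB cardK unfolding distribution_matrix_def one_def[symmetric] by auto
  qed
qed

subsection \<open>Weak formulation\<close>

text \<open>\<open>D\<close> is a road including its end at the junction. \<open>D_limit\<close>
  makes one-sided derivatives in x unique, so \<phi>x is determined by \<phi> up to that
  end.\<close>

locale test_strip =
  fixes D :: "real set" and T :: real and \<phi> \<phi>x \<phi>t :: "real \<Rightarrow> real \<Rightarrow> real"
  assumes T_pos: "0 < T"
    and D_limit: "\<And>x. x \<in> D \<Longrightarrow> at x within D \<noteq> bot"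
    and test: "test_function (D \<times> {0<..<T}) \<phi> \<phi>x \<phi>t"
begin

lemma continuous_test:
  "continuous_on (D \<times> {0<..<T}) (\<lambda>(x, t). \<phi> x t)"
  "continuous_on (D \<times> {0<..<T}) (\<lambda>(x, t). \<phi>x x t)"
  "continuous_on (D \<times> {0<..<T}) (\<lambda>(x, t). \<phi>t x t)"
proof -
  have "\<And>z. z \<in> D \<times> {0<..<T} \<Longrightarrow> ((\<lambda>(x, t). \<phi> x t) has_derivative
      (\<lambda>(h, k). \<phi>x (fst z) (snd z) * h + \<phi>t (fst z) (snd z) * k)) (at z within D \<times> {0<..<T})"
    using test by (auto simp: test_function_def)
  then show "continuous_on (D \<times> {0<..<T}) (\<lambda>(x, t). \<phi> x t)"
    by (rule has_derivative_continuous_on)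
qed (use test in \<open>auto simp: test_function_def\<close>)

lemma derivative_along_curve:
  assumes r: "r \<in> R" and sub: "\<And>r. r \<in> R \<Longrightarrow> X r \<in> D \<and> Y r \<in> {0<..<T}"
    and X: "(X has_real_derivative X') (at r within R)"
    and Y: "(Y has_real_derivative Y') (at r within R)"
  shows "((\<lambda>r. \<phi> (X r) (Y r)) has_real_derivative \<phi>x (X r) (Y r) * X' + \<phi>t (X r) (Y r) * Y') (at r within R)"
proof -
  have pair: "((\<lambda>r. (X r, Y r)) has_derivative (\<lambda>h. (X' * h, Y' * h))) (at r within R)"
    using X Y by (intro has_derivative_Pair) (auto simp: has_field_derivative_def)
  have deriv: "\<And>z. z \<in> D \<times> {0<..<T} \<Longrightarrow> ((\<lambda>(x, t). \<phi> x t) has_derivative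
      (\<lambda>(h, k). \<phi>x (fst z) (snd z) * h + \<phi>t (fst z) (snd z) * k)) (at z within D \<times> {0<..<T})"
    using test by (auto simp: test_function_def)
  have "(\<lambda>r. (X r, Y r)) ` R \<subseteq> D \<times> {0<..<T}" using sub by blast
  from has_derivative_in_compose2[OF deriv this r pair]
  have "((\<lambda>r. \<phi> (X r) (Y r)) has_derivative
      (\<lambda>h. \<phi>x (X r) (Y r) * (X' * h) + \<phi>t (X r) (Y r) * (Y' * h))) (at r within R)" by simp
  moreover have "(\<lambda>h. \<phi>x (X r) (Y r) * (X' * h) + \<phi>t (X r) (Y r) * (Y' * h)) =
      (*) (\<phi>x (X r) (Y r) * X' + \<phi>t (X r) (Y r) * Y')"
    by (auto simp: fun_eq_iff distrib_right mult.assoc)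
  ultimately show ?thesis by (simp add: has_field_derivative_def)
qed

lemma continuous_compose:
  assumes f: "continuous_on (D \<times> {0<..<T}) (\<lambda>(x, t). f x t)"
    and X: "continuous_on V X" and Y: "continuous_on V Y"
    and sub: "\<And>v. v \<in> V \<Longrightarrow> X v \<in> D \<and> Y v \<in> {0<..<T}"
  shows "continuous_on V (\<lambda>v. f (X v) (Y v))"
proof -
  have "(\<lambda>v. (X v, Y v)) ` V \<subseteq> D \<times> {0<..<T}" using sub by blast
  from continuous_on_compose2[OF f continuous_on_Pair[OF X Y] this] show ?thesis by simp
qed

text \<open>The support condition speaks of \<phi> only; since the complement of the compact set is
  open, \<phi> vanishes locally there and so do its partial derivatives.\<close>

lemma vanishing:
  "\<exists>t\<^sub>0 t\<^sub>1 L. 0 < t\<^sub>0 \<and> t\<^sub>0 < t\<^sub>1 \<and> t\<^sub>1 < T \<and> 0 < L \<and> (\<forall>x\<in>D. \<forall>t\<in>{0<..<T}. t \<notin> {t\<^sub>0..t\<^sub>1} \<or> L \<le> \<bar>x\<bar> \<longrightarrow>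
      \<phi> x t = 0 \<and> \<phi>x x t = 0 \<and> \<phi>t x t = 0)"
proof -
  obtain K where K: "K \<subseteq> D \<times> {0<..<T}" "compact K" and off: "\<And>x t. (x, t) \<in> D \<times> {0<..<T} - K \<Longrightarrow> \<phi> x t = 0"
    using test unfolding test_function_def by blast
  have zero: "\<phi> x t = 0 \<and> \<phi>x x t = 0 \<and> \<phi>t x t = 0" if xt: "x \<in> D" "t \<in> {0<..<T}" "(x, t) \<notin> K" for x t
  proof -
    have "open (- K)" using K(2) by (simp add: compact_imp_closed open_Compl)
    then obtain e where e: "0 < e" "ball (x, t) e \<subseteq> - K"
      using xt(3) by (auto simp: open_contains_ball)
    have "((\<lambda>y. \<phi> y t) has_real_derivative \<phi>x x t * 1 + \<phi>t x t * 0) (at x within D)"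
      by (rule derivative_along_curve) (use xt in \<open>auto intro!: derivative_eq_intros\<close>)
    then have "((\<lambda>y. \<phi> y t) has_real_derivative \<phi>x x t) (at x within D)" by simp
    then have "((\<lambda>y. 0) has_real_derivative \<phi>x x t) (at x within D)"
    proof (rule has_field_derivative_transform_within[OF _ e(1) xt(1)])
      fix y assume y: "y \<in> D" "dist y x < e"
      then have "(y, t) \<in> ball (x, t) e" by (simp add: dist_Pair_Pair dist_commute)
      then show "\<phi> y t = 0" using e(2) y xt by (intro off) auto
    qed
    then have "\<phi>x x t = 0"
      using vector_derivative_unique_within[OF D_limit[OF xt(1)], of "\<lambda>y. 0" "\<phi>x x t" 0]
      by (simp add: has_real_derivative_iff_has_vector_derivative)
    moreover have "((\<lambda>s. \<phi> x s) has_real_derivative \<phi>x x t * 0 + \<phi>t x t * 1) (at t within {0<..<T})"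
      by (rule derivative_along_curve) (use xt in \<open>auto intro!: derivative_eq_intros\<close>)
    then have "((\<lambda>s. \<phi> x s) has_real_derivative \<phi>t x t) (at t within {0<..<T})" by simp
    then have "((\<lambda>s. 0) has_real_derivative \<phi>t x t) (at t within {0<..<T})"
    proof (rule has_field_derivative_transform_within[OF _ e(1) xt(2)])
      fix s assume s: "s \<in> {0<..<T}" "dist s t < e"
      then have "(x, s) \<in> ball (x, t) e" by (simp add: dist_Pair_Pair dist_commute)
      then show "\<phi> x s = 0" using e(2) s xt by (intro off) auto
    qed
    then have "\<phi>t x t = 0"
      using at_within_open[OF xt(2)] DERIV_unique[OF _ DERIV_const] by simp
    ultimately show ?thesis using off xt by auto
  qed
  have "\<exists>t\<^sub>0 t\<^sub>1. 0 < t\<^sub>0 \<and> t\<^sub>0 < t\<^sub>1 \<and> t\<^sub>1 < T \<and> snd ` K \<subseteq> {t\<^sub>0..t\<^sub>1}"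
  proof (cases "K = {}")
    case True
    then show ?thesis using T_pos by (intro exI[of _ "T / 3"] exI[of _ "T / 2"]) auto
  next
    case False
    have c: "compact (snd ` K)" using K(2) by (intro compact_continuous_image continuous_intros)
    obtain m M where m: "m \<in> snd ` K" "\<forall>t\<in>snd ` K. m \<le> t" and M: "M \<in> snd ` K" "\<forall>t\<in>snd ` K. t \<le> M"
      using compact_attains_inf[OF c] compact_attains_sup[OF c] False by auto
    have "0 < m" "m \<le> M" "M < T" using m M K(1) by auto
    \<comment> \<open>Taking \<open>(M + T) / 2\<close> and not \<open>M\<close> keeps the time
      interval nondegenerate when \<open>m = M\<close>.\<close>
    then show ?thesis using m M by (intro exI[of _ m] exI[of _ "(M + T) / 2"]) force
  qed
  then obtain t\<^sub>0 t\<^sub>1 where t: "0 < t\<^sub>0" "t\<^sub>0 < t\<^sub>1" "t\<^sub>1 < T" "snd ` K \<subseteq> {t\<^sub>0..t\<^sub>1}" by blast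
  have "bounded (fst ` K)" using K(2) by (intro compact_imp_bounded compact_continuous_image continuous_intros)
  then obtain L where L: "0 < L" "\<And>x. x \<in> fst ` K \<Longrightarrow> norm x < L" by (auto simp: bounded_pos_less)
  have "(x, t) \<notin> K" if "t \<notin> {t\<^sub>0..t\<^sub>1} \<or> L \<le> \<bar>x\<bar>" for x t
    using that t(4) L(2) by force
  then show ?thesis using zero t(1-3) L(1)
    by (intro exI[of _ t\<^sub>0] exI[of _ t\<^sub>1] exI[of _ L] conjI ballI impI) simp_all
qed

lemma integrable_in_time:
  assumes "continuous_on {0<..<T} E" "0 < t\<^sub>0" "t\<^sub>0 < t\<^sub>1" "t\<^sub>1 < T"
    and "\<And>t. t \<in> {0<..<T} \<Longrightarrow> t \<notin> {t\<^sub>0..t\<^sub>1} \<Longrightarrow> E t = (0::real)"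
  shows "set_integrable lebesgue {0<..<T} E" "(LINT t:{0<..<T}|lebesgue. E t) = integral {t\<^sub>0..t\<^sub>1} E"
proof -
  have eq: "(\<lambda>t. indicator {0<..<T} t *\<^sub>R E t) = (\<lambda>t. indicator {t\<^sub>0..t\<^sub>1} t *\<^sub>R E t)"
    using assms by (auto simp: indicator_def fun_eq_iff)
  have int: "set_integrable lebesgue {t\<^sub>0..t\<^sub>1} E"
    by (intro absolutely_integrable_continuous_real continuous_on_subset[OF assms(1)]) (use assms in auto)
  then show "set_integrable lebesgue {0<..<T} E" unfolding set_integrable_def eq .
  show "(LINT t:{0<..<T}|lebesgue. E t) = integral {t\<^sub>0..t\<^sub>1} E"
    using set_lebesgue_integral_eq_integral(2)[OF int] unfolding set_lebesgue_integral_def eq .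
qed

lemma integrable_boundary:
  assumes "b \<in> D"
  shows "set_integrable lebesgue {0<..<T} (\<phi> b)"
proof -
  obtain t\<^sub>0 t\<^sub>1 L where "0 < t\<^sub>0" "t\<^sub>0 < t\<^sub>1" "t\<^sub>1 < T" "\<forall>x\<in>D. \<forall>t\<in>{0<..<T}. t \<notin> {t\<^sub>0..t\<^sub>1} \<or> L \<le> \<bar>x\<bar> \<longrightarrow>
      \<phi> x t = 0 \<and> \<phi>x x t = 0 \<and> \<phi>t x t = 0"
    using vanishing by blast
  moreover have "continuous_on {0<..<T} (\<lambda>t. \<phi> b t)"
    by (rule continuous_compose[OF continuous_test(1)]) (use assms in \<open>auto intro: continuous_intros\<close>)
  ultimately show ?thesis using assms by (intro integrable_in_time(1)[of "\<phi> b" t\<^sub>0 t\<^sub>1]) auto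
qed

text \<open>Divergence theorem on the region between the lines \<open>x = p\<^sub>0 + p\<^sub>1 t\<close> and \<open>x = q\<^sub>0 + q\<^sub>1 t\<close>.
  \<open>E\<close> is the time derivative of the mass of \<open>\<phi>\<close> between the lines, hence has mean zero.\<close>

lemma moving_strip:
  assumes pq: "\<And>t. t \<in> {0<..<T} \<Longrightarrow> p\<^sub>0 + p\<^sub>1 * t \<le> q\<^sub>0 + q\<^sub>1 * t \<and> {p\<^sub>0 + p\<^sub>1 * t..q\<^sub>0 + q\<^sub>1 * t} \<subseteq> D"
  shows "\<exists>E. set_integrable lebesgue {0<..<T} E \<and> (LINT t:{0<..<T}|lebesgue. E t) = 0 \<and>
      (\<forall>t\<in>{0<..<T}. \<forall>\<alpha> \<beta>.
        set_integrable lebesgue {p\<^sub>0 + p\<^sub>1 * t..q\<^sub>0 + q\<^sub>1 * t} (\<lambda>x. \<alpha> * \<phi>t x t + \<beta> * \<phi>x x t) \<and>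
        (LINT x:{p\<^sub>0 + p\<^sub>1 * t..q\<^sub>0 + q\<^sub>1 * t}|lebesgue. \<alpha> * \<phi>t x t + \<beta> * \<phi>x x t) =
          \<alpha> * E t + (\<beta> - \<alpha> * q\<^sub>1) * \<phi> (q\<^sub>0 + q\<^sub>1 * t) t - (\<beta> - \<alpha> * p\<^sub>1) * \<phi> (p\<^sub>0 + p\<^sub>1 * t) t)"
proof -
  define p where "p = (\<lambda>t. p\<^sub>0 + p\<^sub>1 * t)"
  define q where "q = (\<lambda>t. q\<^sub>0 + q\<^sub>1 * t)"
  \<comment> \<open>Rescaling the moving interval to [0, 1] gives integrals over a fixed domain, to
    which the Leibniz rule applies.\<close>
  define X where "X = (\<lambda>t r. p t + (q t - p t) * r)"
  have pq': "p t \<le> q t" "{p t..q t} \<subseteq> D" if "t \<in> {0<..<T}" for t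
    using pq[OF that] by (auto simp: p_def q_def)
  have X: "X t r \<in> D" "X t r \<in> {p t..q t}" if "t \<in> {0<..<T}" "r \<in> {0..1}" for t r
  proof -
    have "0 \<le> (q t - p t) * r" using pq'[OF that(1)] that(2) by simp
    moreover have "(q t - p t) * r \<le> (q t - p t) * 1"
      using pq'[OF that(1)] that(2) by (intro mult_left_mono) auto
    ultimately show "X t r \<in> {p t..q t}" by (simp add: X_def)
    with pq'[OF that(1)] show "X t r \<in> D" by blast
  qed
  \<comment> \<open>\<open>G\<close> below is the mass of \<phi> between the lines after rescaling;
    \<open>H\<close> is the time derivative of its integrand.\<close>
  define H where "H = (\<lambda>t r. (q\<^sub>1 - p\<^sub>1) * \<phi> (X t r) t +
      (q t - p t) * (\<phi>x (X t r) t * (p\<^sub>1 + (q\<^sub>1 - p\<^sub>1) * r) + \<phi>t (X t r) t))"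
  define E where "E = (\<lambda>t. integral {0..1} (H t))"
  define G where "G = (\<lambda>t. integral {0..1} (\<lambda>r. (q t - p t) * \<phi> (X t r) t))"
  have X_cont: "continuous_on V (\<lambda>v. X (fst v) (snd v))" for V
    unfolding X_def p_def q_def by (intro continuous_intros)
  have cont_H: "continuous_on ({0<..<T} \<times> cbox 0 1) (\<lambda>(t, r). H t r)"
    unfolding H_def case_prod_beta p_def q_def
    by (intro continuous_intros continuous_compose[OF continuous_test(1)] continuous_compose[OF continuous_test(2)]
        continuous_compose[OF continuous_test(3)] X_cont) (use X in \<open>auto simp: \<close>)
  have X_cont_r: "continuous_on V (\<lambda>r. X t r)" for V t
    unfolding X_def p_def q_def by (intro continuous_intros)
  have X_deriv_t: "((\<lambda>t. X t r) has_real_derivative p\<^sub>1 + (q\<^sub>1 - p\<^sub>1) * r) (at t within V)" for t r V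
    unfolding X_def p_def q_def by (auto intro!: derivative_eq_intros simp: algebra_simps)
  have X_deriv_r: "((\<lambda>r. X t r) has_real_derivative q t - p t) (at r within V)" for t r V
    unfolding X_def by (auto intro!: derivative_eq_intros)
  have cont_r: "continuous_on {0..1} (\<lambda>r. \<phi> (X t r) t)" "continuous_on {0..1} (\<lambda>r. \<phi>x (X t r) t)"
      "continuous_on {0..1} (\<lambda>r. \<phi>t (X t r) t)" if t: "t \<in> {0<..<T}" for t
    by (intro continuous_compose[OF continuous_test(1)] continuous_compose[OF continuous_test(2)]
        continuous_compose[OF continuous_test(3)] X_cont_r continuous_on_const; use X t in auto)+
  have G_deriv: "(G has_real_derivative E t) (at t)" if t: "t \<in> {0<..<T}" for t
  proof -
    have "((\<lambda>t. integral (cbox 0 1) (\<lambda>r. (q t - p t) * \<phi> (X t r) t)) has_field_derivative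
        integral (cbox 0 1) (H t)) (at t within {0<..<T})"
    proof (rule leibniz_rule_field_derivative[OF _ _ cont_H t])
      fix t r :: real assume tr: "t \<in> {0<..<T}" "r \<in> cbox 0 1"
      have d: "((\<lambda>t. \<phi> (X t r) t) has_real_derivative \<phi>x (X t r) t * (p\<^sub>1 + (q\<^sub>1 - p\<^sub>1) * r) + \<phi>t (X t r) t * 1)
          (at t within {0<..<T})"
        by (rule derivative_along_curve) (use X tr X_deriv_t in auto)
      have "((\<lambda>t. q t - p t) has_real_derivative q\<^sub>1 - p\<^sub>1) (at t within {0<..<T})"
        unfolding p_def q_def by (auto intro!: derivative_eq_intros)
      from DERIV_mult'[OF this d]
      show "((\<lambda>t. (q t - p t) * \<phi> (X t r) t) has_field_derivative H t r) (at t within {0<..<T})"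
        by (rule DERIV_cong) (simp add: H_def)
    next
      fix t :: real assume t: "t \<in> {0<..<T}"
      show "(\<lambda>r. (q t - p t) * \<phi> (X t r) t) integrable_on cbox 0 1"
        using cont_r[OF t] by (intro integrable_continuous) (auto intro!: continuous_intros)
    qed simp
    then show ?thesis using at_within_open[OF t] unfolding G_def E_def by simp
  qed
  obtain t\<^sub>0 t\<^sub>1 L where t01: "0 < t\<^sub>0" "t\<^sub>0 < t\<^sub>1" "t\<^sub>1 < T" and "0 < L"
    and van: "\<And>x t. x \<in> D \<Longrightarrow> t \<in> {0<..<T} \<Longrightarrow> t \<notin> {t\<^sub>0..t\<^sub>1} \<or> L \<le> \<bar>x\<bar> \<Longrightarrow>
      \<phi> x t = 0 \<and> \<phi>x x t = 0 \<and> \<phi>t x t = 0"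
    using vanishing by blast
  \<comment> \<open>Times strictly outside the support in time: \<open>G\<close> vanishes at both,
    so its derivative \<open>E\<close> integrates to zero.\<close>
  define s\<^sub>0 where "s\<^sub>0 = t\<^sub>0 / 2"
  define s1 where "s1 = (t\<^sub>1 + T) / 2"
  have s: "0 < s\<^sub>0" "s\<^sub>0 < t\<^sub>0" "t\<^sub>1 < s1" "s1 < T" "s\<^sub>0 < s1" using t01 by (auto simp: s\<^sub>0_def s1_def)
  have H_0: "H t r = 0" if "t \<in> {0<..<T}" "t \<notin> {t\<^sub>0..t\<^sub>1}" "r \<in> {0..1}" for t r
    using van[OF X(1)[OF that(1,3)] that(1)] that(2) by (simp add: H_def)
  have E_0: "E t = 0" if t: "t \<in> {0<..<T}" "t \<notin> {t\<^sub>0..t\<^sub>1}" for t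
  proof -
    have "E t = integral {0..1} (\<lambda>r :: real. 0 :: real)" unfolding E_def
      by (rule Henstock_Kurzweil_Integration.integral_cong) (rule H_0[OF t])
    then show ?thesis by simp
  qed
  have G_0: "G t = 0" if t: "t \<in> {0<..<T}" "t \<notin> {t\<^sub>0..t\<^sub>1}" for t
  proof -
    have "G t = integral {0..1} (\<lambda>r :: real. 0 :: real)" unfolding G_def
      by (rule Henstock_Kurzweil_Integration.integral_cong) (use van[OF X(1)[OF t(1)] t(1)] t(2) in auto)
    then show ?thesis by simp
  qed
  have E_cont: "continuous_on {0<..<T} E"
    using integral_continuous_on_param[OF cont_H] by (simp add: E_def)
  have "E t = 0" if "t \<in> {0<..<T}" "t \<notin> {s\<^sub>0..s1}" for t
    using E_0[OF that(1)] that s by auto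
  note int = integrable_in_time[OF E_cont s(1,5,4) this]
  have "(E has_integral G s1 - G s\<^sub>0) {s\<^sub>0..s1}"
    using s G_deriv by (intro fundamental_theorem_of_calculus)
      (auto simp: has_real_derivative_iff_has_vector_derivative[symmetric] intro: has_field_derivative_at_within)
  then have E_int: "(LINT t:{0<..<T}|lebesgue. E t) = 0"
    using int(2) G_0[of s\<^sub>0] G_0[of s1] s by (simp add: integral_unique)
  have "set_integrable lebesgue {p t..q t} (\<lambda>x. \<alpha> * \<phi>t x t + \<beta> * \<phi>x x t) \<and>
        (LINT x:{p t..q t}|lebesgue. \<alpha> * \<phi>t x t + \<beta> * \<phi>x x t) =
          \<alpha> * E t + (\<beta> - \<alpha> * q\<^sub>1) * \<phi> (q t) t - (\<beta> - \<alpha> * p\<^sub>1) * \<phi> (p t) t"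
    if t: "t \<in> {0<..<T}" for t \<alpha> \<beta>
  proof
    have cx: "continuous_on {p t..q t} (\<lambda>x. \<phi>x x t)" "continuous_on {p t..q t} (\<lambda>x. \<phi>t x t)"
      by (intro continuous_compose[OF continuous_test(2)] continuous_compose[OF continuous_test(3)]
          continuous_on_const continuous_on_id; use pq'[OF t] t in auto)+
    then show int: "set_integrable lebesgue {p t..q t} (\<lambda>x. \<alpha> * \<phi>t x t + \<beta> * \<phi>x x t)"
      by (intro absolutely_integrable_continuous_real continuous_intros)
    have ix: "(\<lambda>x. \<phi>x x t) integrable_on {p t..q t}" "(\<lambda>x. \<phi>t x t) integrable_on {p t..q t}"
      using cx by (auto intro: integrable_continuous_real)
    have 1: "((\<lambda>x. \<phi>x x t) has_integral \<phi> (q t) t - \<phi> (p t) t) {p t..q t}"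
    proof (rule fundamental_theorem_of_calculus)
      fix x assume x: "x \<in> {p t..q t}"
      have "((\<lambda>x. \<phi> x t) has_real_derivative \<phi>x x t * 1 + \<phi>t x t * 0) (at x within {p t..q t})"
        by (rule derivative_along_curve) (use x pq'[OF t] t in \<open>auto intro!: derivative_eq_intros\<close>)
      then show "((\<lambda>x. \<phi> x t) has_vector_derivative \<phi>x x t) (at x within {p t..q t})"
        by (simp add: has_real_derivative_iff_has_vector_derivative)
    qed (rule pq'[OF t])
    \<comment> \<open>The derivative in \<open>r\<close> of \<phi> times the velocity of the point
      with parameter \<open>r\<close>. \<open>H t\<close> is \<open>?B\<close> plus the rescaled
      \<phi>t, which separates the motion of the two ends from the integral of \<phi>t.\<close>
    let ?B = "\<lambda>r. (q\<^sub>1 - p\<^sub>1) * \<phi> (X t r) t + (p\<^sub>1 + (q\<^sub>1 - p\<^sub>1) * r) * (\<phi>x (X t r) t * (q t - p t))"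
    have "(?B has_integral (p\<^sub>1 + (q\<^sub>1 - p\<^sub>1) * 1) * \<phi> (X t 1) t - (p\<^sub>1 + (q\<^sub>1 - p\<^sub>1) * 0) * \<phi> (X t 0) t) {0..1}"
    proof (rule fundamental_theorem_of_calculus)
      fix r :: real assume r: "r \<in> {0..1}"
      have "((\<lambda>r. \<phi> (X t r) t) has_real_derivative \<phi>x (X t r) t * (q t - p t) + \<phi>t (X t r) t * 0) (at r within {0..1})"
        by (rule derivative_along_curve) (use r X t X_deriv_r in auto)
      then have "((\<lambda>r. (p\<^sub>1 + (q\<^sub>1 - p\<^sub>1) * r) * \<phi> (X t r) t) has_real_derivative ?B r) (at r within {0..1})"
        by (auto intro!: derivative_eq_intros)
      then show "((\<lambda>r. (p\<^sub>1 + (q\<^sub>1 - p\<^sub>1) * r) * \<phi> (X t r) t) has_vector_derivative ?B r) (at r within {0..1})"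
        by (simp add: has_real_derivative_iff_has_vector_derivative)
    qed simp
    then have 2: "(?B has_integral q\<^sub>1 * \<phi> (q t) t - p\<^sub>1 * \<phi> (p t) t) {0..1}"
      by (simp add: X_def)
    have "((\<lambda>r. (q t - p t) *\<^sub>R \<phi>t (X t r) t) has_integral integral {X t 0..X t 1} (\<lambda>x. \<phi>t x t)) {0..1}"
    proof (rule has_integral_substitution[where c = "p t" and d = "q t"])
      show "X t ` {0..1} \<subseteq> {p t..q t}" using X t by blast
      show "X t 0 \<le> X t 1" using pq'[OF t] by (simp add: X_def)
    qed (use cx X_deriv_r in auto)
    then have 3: "((\<lambda>r. (q t - p t) * \<phi>t (X t r) t) has_integral integral {p t..q t} (\<lambda>x. \<phi>t x t)) {0..1}"
      by (simp add: X_def)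
    have "((\<lambda>r. ?B r + (q t - p t) * \<phi>t (X t r) t) has_integral
        q\<^sub>1 * \<phi> (q t) t - p\<^sub>1 * \<phi> (p t) t + integral {p t..q t} (\<lambda>x. \<phi>t x t)) {0..1}"
      by (rule has_integral_add[OF 2 3])
    moreover have "(\<lambda>r. ?B r + (q t - p t) * \<phi>t (X t r) t) = H t"
      by (auto simp: H_def fun_eq_iff algebra_simps)
    ultimately have E: "E t = q\<^sub>1 * \<phi> (q t) t - p\<^sub>1 * \<phi> (p t) t + integral {p t..q t} (\<lambda>x. \<phi>t x t)"
      by (simp add: E_def integral_unique)
    have "(LINT x:{p t..q t}|lebesgue. \<alpha> * \<phi>t x t + \<beta> * \<phi>x x t) =
        integral {p t..q t} (\<lambda>x. \<alpha> * \<phi>t x t + \<beta> * \<phi>x x t)"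
      by (rule set_lebesgue_integral_eq_integral(2)[OF int])
    also have "\<dots> = \<alpha> * integral {p t..q t} (\<lambda>x. \<phi>t x t) + \<beta> * integral {p t..q t} (\<lambda>x. \<phi>x x t)"
      using ix by (subst integral_add) (auto intro: integrable_on_mult_right)
    also have "\<dots> = \<alpha> * E t + (\<beta> - \<alpha> * q\<^sub>1) * \<phi> (q t) t - (\<beta> - \<alpha> * p\<^sub>1) * \<phi> (p t) t"
      unfolding E integral_unique[OF 1] by (simp add: algebra_simps)
    finally show "(LINT x:{p t..q t}|lebesgue. \<alpha> * \<phi>t x t + \<beta> * \<phi>x x t) =
          \<alpha> * E t + (\<beta> - \<alpha> * q\<^sub>1) * \<phi> (q t) t - (\<beta> - \<alpha> * p\<^sub>1) * \<phi> (p t) t" .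
  qed
  then show ?thesis using int(1) E_int unfolding p_def q_def by blast
qed

text \<open>Density and flux are sums of constants on overlapping moving strips. The
  \<open>E\<close> terms have mean zero, so only edge terms remain; \<open>bd\<close> asks them to
  collapse to the junction, and Rankine-Hugoniot along the jump lines will provide this.\<close>

lemma weak_form_strips:
  fixes p\<^sub>0 p\<^sub>1 q\<^sub>0 q\<^sub>1 \<alpha> \<beta> :: "nat \<Rightarrow> real"
  assumes A: "finite A" and b: "b \<in> D"
    and pq: "\<And>k t. k \<in> A \<Longrightarrow> t \<in> {0<..<T} \<Longrightarrow>
        p\<^sub>0 k + p\<^sub>1 k * t \<le> q\<^sub>0 k + q\<^sub>1 k * t \<and> {p\<^sub>0 k + p\<^sub>1 k * t..q\<^sub>0 k + q\<^sub>1 k * t} \<subseteq> D"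
    and uw: "\<And>t x. t \<in> {0<..<T} \<Longrightarrow> x \<noteq> b \<Longrightarrow>
        indicator I x * (u x t * \<phi>t x t + w x t * \<phi>x x t) =
        (\<Sum>k\<in>A. indicator {p\<^sub>0 k + p\<^sub>1 k * t..q\<^sub>0 k + q\<^sub>1 k * t} x * (\<alpha> k * \<phi>t x t + \<beta> k * \<phi>x x t))"
    and bd: "\<And>t. t \<in> {0<..<T} \<Longrightarrow> (\<Sum>k\<in>A. (\<beta> k - \<alpha> k * q\<^sub>1 k) * \<phi> (q\<^sub>0 k + q\<^sub>1 k * t) t -
        (\<beta> k - \<alpha> k * p\<^sub>1 k) * \<phi> (p\<^sub>0 k + p\<^sub>1 k * t) t) = C * \<phi> b t"
  shows "weak_form I T u w \<phi>x \<phi>t = C * (LINT t:{0<..<T}|lebesgue. \<phi> b t)"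
proof -
  let ?J = "\<lambda>k t. {p\<^sub>0 k + p\<^sub>1 k * t..q\<^sub>0 k + q\<^sub>1 k * t}"
  let ?f = "\<lambda>k t x. \<alpha> k * \<phi>t x t + \<beta> k * \<phi>x x t"
  have "\<forall>k\<in>A. \<exists>E. set_integrable lebesgue {0<..<T} E \<and> (LINT t:{0<..<T}|lebesgue. E t) = 0 \<and>
      (\<forall>t\<in>{0<..<T}. set_integrable lebesgue (?J k t) (?f k t) \<and>
        (LINT x:?J k t|lebesgue. ?f k t x) =
          \<alpha> k * E t + (\<beta> k - \<alpha> k * q\<^sub>1 k) * \<phi> (q\<^sub>0 k + q\<^sub>1 k * t) t - (\<beta> k - \<alpha> k * p\<^sub>1 k) * \<phi> (p\<^sub>0 k + p\<^sub>1 k * t) t)"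
    using moving_strip[OF pq] by (intro ballI) meson
  from bchoice[OF this] obtain E where E_all: "\<forall>k\<in>A. set_integrable lebesgue {0<..<T} (E k) \<and>
      (LINT t:{0<..<T}|lebesgue. E k t) = 0 \<and>
      (\<forall>t\<in>{0<..<T}. set_integrable lebesgue (?J k t) (?f k t) \<and>
        (LINT x:?J k t|lebesgue. ?f k t x) =
          \<alpha> k * E k t + (\<beta> k - \<alpha> k * q\<^sub>1 k) * \<phi> (q\<^sub>0 k + q\<^sub>1 k * t) t - (\<beta> k - \<alpha> k * p\<^sub>1 k) * \<phi> (p\<^sub>0 k + p\<^sub>1 k * t) t)"
    by blast
  have E: "\<And>k. k \<in> A \<Longrightarrow> set_integrable lebesgue {0<..<T} (E k)"
      "\<And>k. k \<in> A \<Longrightarrow> (LINT t:{0<..<T}|lebesgue. E k t) = 0"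
      "\<And>k t. k \<in> A \<Longrightarrow> t \<in> {0<..<T} \<Longrightarrow> set_integrable lebesgue (?J k t) (?f k t)"
      "\<And>k t. k \<in> A \<Longrightarrow> t \<in> {0<..<T} \<Longrightarrow> (LINT x:?J k t|lebesgue. ?f k t x) =
          \<alpha> k * E k t + (\<beta> k - \<alpha> k * q\<^sub>1 k) * \<phi> (q\<^sub>0 k + q\<^sub>1 k * t) t - (\<beta> k - \<alpha> k * p\<^sub>1 k) * \<phi> (p\<^sub>0 k + p\<^sub>1 k * t) t"
    using E_all by blast+
  have inner: "(LINT x:I|lebesgue. u x t * \<phi>t x t + w x t * \<phi>x x t) = (\<Sum>k\<in>A. \<alpha> k * E k t) + C * \<phi> b t"
    if t: "t \<in> {0<..<T}" for t
  proof -
    \<comment> \<open>The road is open and the strips are closed at the junction, so the integrands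
      agree only off \<open>b\<close>.\<close>
    have "(LINT x:I|lebesgue. u x t * \<phi>t x t + w x t * \<phi>x x t) =
        (LINT x|lebesgue. (\<Sum>k\<in>A. indicator (?J k t) x *\<^sub>R ?f k t x))"
      unfolding set_lebesgue_integral_def
      by (rule integral_discrete_difference[of "{b}"]) (use uw[OF t] in auto)
    also have "\<dots> = (\<Sum>k\<in>A. (LINT x:?J k t|lebesgue. ?f k t x))"
      unfolding set_lebesgue_integral_def
      by (rule Bochner_Integration.integral_sum) (use E(3) t in \<open>auto simp: set_integrable_def\<close>)
    also have "\<dots> = (\<Sum>k\<in>A. \<alpha> k * E k t) + C * \<phi> b t"
      unfolding bd[OF t, symmetric] sum.distrib[symmetric] using E(4) t by (intro sum.cong) auto
    finally show ?thesis .
  qed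
  have "weak_form I T u w \<phi>x \<phi>t = (LINT t:{0<..<T}|lebesgue. (\<Sum>k\<in>A. \<alpha> k * E k t) + C * \<phi> b t)"
    unfolding weak_form_def by (rule set_lebesgue_integral_cong) (use inner in auto)
  also have "\<dots> = (LINT t:{0<..<T}|lebesgue. (\<Sum>k\<in>A. \<alpha> k * E k t)) + (LINT t:{0<..<T}|lebesgue. C * \<phi> b t)"
    using E(1) integrable_boundary[OF b]
    by (intro set_integral_add(2)) (auto simp: set_integrable_def sum_distrib_left mult.left_commute)
  also have "(LINT t:{0<..<T}|lebesgue. (\<Sum>k\<in>A. \<alpha> k * E k t)) = (\<Sum>k\<in>A. (LINT t:{0<..<T}|lebesgue. \<alpha> k * E k t))"
    unfolding set_lebesgue_integral_def scaleR_sum_right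
    by (rule Bochner_Integration.integral_sum) (use E(1) in \<open>auto simp: set_integrable_def mult.left_commute\<close>)
  also have "\<dots> = 0" using E(2) by simp
  finally show ?thesis by simp
qed

end

section \<open>Variation, measurability and null sets for step profiles\<close>

lemma bounded_variation_const: "bounded_variation_on I (\<lambda>x. c)"
  by (auto simp: bounded_variation_on_def)

lemma bounded_variation_add:
  assumes "bounded_variation_on I f" "bounded_variation_on I g"
  shows "bounded_variation_on I (\<lambda>x. f x + g x)"
proof -
  obtain C D where C: "\<And>xs. sorted xs \<Longrightarrow> set xs \<subseteq> I \<Longrightarrow> (\<Sum>k<length xs - 1. \<bar>f (xs ! Suc k) - f (xs ! k)\<bar>) \<le> C"
    and D: "\<And>xs. sorted xs \<Longrightarrow> set xs \<subseteq> I \<Longrightarrow> (\<Sum>k<length xs - 1. \<bar>g (xs ! Suc k) - g (xs ! k)\<bar>) \<le> D"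
    using assms unfolding bounded_variation_on_def by blast
  have "(\<Sum>k<length xs - 1. \<bar>f (xs ! Suc k) + g (xs ! Suc k) - (f (xs ! k) + g (xs ! k))\<bar>) \<le> C + D"
    if xs: "sorted xs" "set xs \<subseteq> I" for xs
  proof -
    have "(\<Sum>k<length xs - 1. \<bar>f (xs ! Suc k) + g (xs ! Suc k) - (f (xs ! k) + g (xs ! k))\<bar>) \<le>
        (\<Sum>k<length xs - 1. \<bar>f (xs ! Suc k) - f (xs ! k)\<bar> + \<bar>g (xs ! Suc k) - g (xs ! k)\<bar>)"
      by (rule sum_mono) linarith
    also have "\<dots> \<le> C + D" unfolding sum.distrib by (rule add_mono[OF C[OF xs] D[OF xs]])
    finally show ?thesis .
  qed
  then show ?thesis unfolding bounded_variation_on_def by blast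
qed

text \<open>The indicator of [p, \<infinity>) is monotone, so absolute increments along a sorted
  list telescope.\<close>

lemma bounded_variation_jump:
  "bounded_variation_on I (\<lambda>x. if p \<le> x then d else (0::real))"
proof -
  have "(\<Sum>k<length xs - 1. \<bar>(if p \<le> xs ! Suc k then d else 0) - (if p \<le> xs ! k then d else 0)\<bar>) \<le> \<bar>d\<bar>"
    if xs: "sorted xs" for xs :: "real list"
  proof -
    define h :: "nat \<Rightarrow> real" where "h = (\<lambda>k. if p \<le> xs ! k then 1 else 0)"
    have "(\<Sum>k<length xs - 1. \<bar>(if p \<le> xs ! Suc k then d else 0) - (if p \<le> xs ! k then d else 0)\<bar>) =
        (\<Sum>k<length xs - 1. (h (Suc k) - h k) * \<bar>d\<bar>)"
    proof (rule sum.cong[OF refl])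
      fix k assume "k \<in> {..<length xs - 1}"
      then have "xs ! k \<le> xs ! Suc k" using xs by (intro sorted_nth_mono) auto
      then show "\<bar>(if p \<le> xs ! Suc k then d else 0) - (if p \<le> xs ! k then d else 0)\<bar> = (h (Suc k) - h k) * \<bar>d\<bar>"
        by (auto simp: h_def)
    qed
    also have "\<dots> = (h (length xs - 1) - h 0) * \<bar>d\<bar>"
      by (simp add: sum_distrib_right[symmetric] sum_lessThan_telescope)
    also have "\<dots> \<le> 1 * \<bar>d\<bar>" by (intro mult_right_mono) (auto simp: h_def)
    finally show ?thesis by simp
  qed
  then show ?thesis unfolding bounded_variation_on_def by (intro exI[of _ "\<bar>d\<bar>"]) blast
qed

lemma step_scaled:
  assumes "0 < t"
  shows "step c d1 s1 d2 s2 ((x - b) / t) =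
    c + (if b + s1 * t \<le> x then d1 else 0) + (if b + s2 * t \<le> x then d2 else 0)"
  using assms by (simp add: step_def pos_le_divide_eq le_diff_eq add.commute)

lemma bounded_variation_step:
  "0 < t \<Longrightarrow> bounded_variation_on I (\<lambda>x. step c d1 s1 d2 s2 ((x - b) / t))"
  unfolding step_scaled by (intro bounded_variation_add bounded_variation_const bounded_variation_jump)

lemma set_borel_measurable_step:
  fixes u0 :: real
  assumes I: "I = {..<b} \<or> I = {b<..}"
  shows "set_borel_measurable lebesgue (I \<times> {0..})
    (\<lambda>(x, t). if 0 < t then step c d1 s1 d2 s2 ((x - b) / t) else u0)"
proof -
  have [measurable]: "fst \<in> borel_measurable (borel :: (real \<times> real) measure)"
      "snd \<in> borel_measurable (borel :: (real \<times> real) measure)"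
    by (intro borel_measurable_continuous_onI continuous_intros)+
  have I_set: "I \<times> {0..} \<in> sets (borel :: (real \<times> real) measure)"
    using I by (auto intro!: borel_Times)
  have "(\<lambda>z. indicator (I \<times> {0..}) z *\<^sub>R (if 0 < snd z then step c d1 s1 d2 s2 ((fst z - b) / snd z) else u0))
      \<in> borel_measurable (borel :: (real \<times> real) measure)"
    using I_set unfolding step_def by measurable
  then have "(\<lambda>z. indicator (I \<times> {0..}) z *\<^sub>R (if 0 < snd z then step c d1 s1 d2 s2 ((fst z - b) / snd z) else u0))
      \<in> borel_measurable (lebesgue :: (real \<times> real) measure)"
    by (intro measurable_completion) simp
  then show ?thesis by (simp add: set_borel_measurable_def case_prod_beta)
qed

text \<open>Each excluded ray lies on a line x - \<sigma> * t = b, and t = 0 is one more line;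
  finitely many lines are negligible.\<close>

lemma AE_off_rays:
  assumes S: "finite S" and P: "\<And>x t. 0 < t \<Longrightarrow> (x - b) / t \<notin> S \<Longrightarrow> P x t"
  shows "AE (x, t) in (lebesgue :: (real \<times> real) measure). (0::real) \<le> t \<longrightarrow> P x t"
proof (rule AE_I')
  let ?N = "(\<Union>\<sigma>\<in>S. {z :: real \<times> real. (1, - \<sigma>) \<bullet> z = b}) \<union> {z. (0, 1) \<bullet> z = 0}"
  have "negligible ?N"
    using S by (intro negligible_Un negligible_Union)
      (auto intro!: negligible_hyperplane simp: zero_prod_def)
  then show "?N \<in> null_sets lebesgue" by (simp add: negligible_iff_null_sets)
  have N: "(x, t) \<in> ?N" if "0 \<le> t" "\<not> P x t" for x t
  proof (cases "t = 0")
    case False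
    then have "(x - b) / t \<in> S" using P[of t x] that by auto
    moreover have "(1, - ((x - b) / t)) \<bullet> (x, t) = b" using False by simp
    ultimately show ?thesis by blast
  qed simp
  show "{z \<in> space lebesgue. \<not> (case z of (x, t) \<Rightarrow> 0 \<le> t \<longrightarrow> P x t)} \<subseteq> ?N"
  proof
    fix z assume z: "z \<in> {z \<in> space lebesgue. \<not> (case z of (x, t) \<Rightarrow> 0 \<le> t \<longrightarrow> P x t)}"
    have "(fst z, snd z) \<in> ?N" by (rule N) (use z in \<open>auto simp: case_prod_beta\<close>)
    then show "z \<in> ?N" unfolding prod.collapse .
  qed
qed

section \<open>Weak form of a step profile on a half-line\<close>

lemma at_within_half_line:
  fixes x b :: real
  shows "x \<in> {..b} \<Longrightarrow> at x within {..b} \<noteq> bot" "x \<in> {b..} \<Longrightarrow> at x within {b..} \<noteq> bot"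
proof -
  assume "x \<in> {..b}"
  moreover have "x islimpt {x - 1<..<x}" by (rule islimpt_greaterThanLessThan2) simp
  ultimately have "x islimpt {..b}" by (elim islimpt_subset) auto
  then show "at x within {..b} \<noteq> bot" by (simp add: trivial_limit_within)
next
  assume "x \<in> {b..}"
  moreover have "x islimpt {x<..<x + 1}" by (rule islimpt_greaterThanLessThan1) simp
  ultimately have "x islimpt {b..}" by (elim islimpt_subset) auto
  then show "at x within {b..} \<noteq> bot" by (simp add: trivial_limit_within)
qed

lemma sum_three: "(\<Sum>k\<in>{0, 1, 2::nat}. f k) = f 0 + f 1 + (f 2 :: real)"
  by simp

text \<open>The additive form of \<open>step\<close> becomes three overlapping strips ending at x =
  b: a base and one strip for each jump. Along a jump line
  \<open>\<beta> k = \<alpha> k * p\<^sub>1 k\<close> cancels the edge term, and the base starts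
  outside the support; what survives is the total flux at x = b.\<close>

lemma weak_form_incoming:
  assumes T: "0 < T" and test: "test_function ({..b} \<times> {0<..<T}) \<phi> \<phi>x \<phi>t"
    and s: "s1 \<le> 0" "s2 \<le> 0"
    and u: "\<And>x t. 0 < t \<Longrightarrow> u x t = step c d1 s1 d2 s2 ((x - b) / t)"
    and w: "\<And>x t. 0 < t \<Longrightarrow> w x t = step c' (s1 * d1) s1 (s2 * d2) s2 ((x - b) / t)"
  shows "weak_form {..<b} T u w \<phi>x \<phi>t = (c' + s1 * d1 + s2 * d2) * (LINT t:{0<..<T}|lebesgue. \<phi> b t)"
proof -
  interpret test_strip "{..b}" T \<phi> \<phi>x \<phi>t
    by unfold_locales (use T test at_within_half_line in auto)
  obtain t\<^sub>0 t\<^sub>1 L where L: "0 < L" and van: "\<And>x t. x \<in> {..b} \<Longrightarrow> t \<in> {0<..<T} \<Longrightarrow> L \<le> \<bar>x\<bar> \<Longrightarrow>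
      \<phi> x t = 0 \<and> \<phi>x x t = 0 \<and> \<phi>t x t = 0"
    using vanishing by blast
  \<comment> \<open>This makes \<open>l\<close> at most \<open>b\<close> and at most
    \<open>- L\<close>, so \<phi> vanishes from \<open>l\<close> leftwards.\<close>
  define l where "l = b - \<bar>b\<bar> - L"
  have l: "l \<le> b" using L by (simp add: l_def)
  have l_van: "\<phi> x t = 0 \<and> \<phi>x x t = 0 \<and> \<phi>t x t = 0" if "x \<le> l" "t \<in> {0<..<T}" for x t
    using that l L by (intro van) (auto simp: l_def)
  define p\<^sub>0 p\<^sub>1 \<alpha> \<beta> :: "nat \<Rightarrow> real"
    where "p\<^sub>0 = (\<lambda>k. if k = 0 then l else b)" and "p\<^sub>1 = (\<lambda>k. if k = 0 then 0 else if k = 1 then s1 else s2)"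
      and "\<alpha> = (\<lambda>k. if k = 0 then c else if k = 1 then d1 else d2)"
      and "\<beta> = (\<lambda>k. if k = 0 then c' else if k = 1 then s1 * d1 else s2 * d2)"
  note defs = p\<^sub>0_def p\<^sub>1_def \<alpha>_def \<beta>_def
  have st: "s1 * t \<le> 0" "s2 * t \<le> 0" if "0 < t" for t
    using s that by (simp_all add: mult_nonpos_nonneg)
  show ?thesis
  proof (rule weak_form_strips[where A = "{0, 1, 2}" and p\<^sub>0 = p\<^sub>0 and p\<^sub>1 = p\<^sub>1 and q\<^sub>0 = "\<lambda>_. b" and q\<^sub>1 = "\<lambda>_. 0"
        and \<alpha> = \<alpha> and \<beta> = \<beta>])
    show "p\<^sub>0 k + p\<^sub>1 k * t \<le> b + 0 * t \<and> {p\<^sub>0 k + p\<^sub>1 k * t..b + 0 * t} \<subseteq> {..b}"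
      if "k \<in> {0, 1, 2}" "t \<in> {0<..<T}" for k t
      using that l st[of t] by (auto simp: defs)
    show "(\<Sum>k\<in>{0, 1, 2}. (\<beta> k - \<alpha> k * 0) * \<phi> (b + 0 * t) t - (\<beta> k - \<alpha> k * p\<^sub>1 k) * \<phi> (p\<^sub>0 k + p\<^sub>1 k * t) t) =
        (c' + s1 * d1 + s2 * d2) * \<phi> b t" if "t \<in> {0<..<T}" for t
      unfolding sum_three using l_van[of l t] that by (simp add: defs algebra_simps)
    show "indicator {..<b} x * (u x t * \<phi>t x t + w x t * \<phi>x x t) =
        (\<Sum>k\<in>{0, 1, 2}. indicator {p\<^sub>0 k + p\<^sub>1 k * t..b + 0 * t} x * (\<alpha> k * \<phi>t x t + \<beta> k * \<phi>x x t))"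
      if t: "t \<in> {0<..<T}" and x: "x \<noteq> b" for t x
    proof -
      consider "b < x" | "x < b" "x < l" | "x < b" "l \<le> x" using x by linarith
      then show ?thesis
      proof cases
        case 1
        then show ?thesis unfolding sum_three by simp
      next
        case 2
        then show ?thesis unfolding sum_three using l_van[of x t] t by simp
      next
        case 3
        have uw: "u x t = c + (if b + s1 * t \<le> x then d1 else 0) + (if b + s2 * t \<le> x then d2 else 0)"
          "w x t = c' + (if b + s1 * t \<le> x then s1 * d1 else 0) + (if b + s2 * t \<le> x then s2 * d2 else 0)"
          using t by (simp_all add: u w step_scaled)
        show ?thesis unfolding sum_three uw using 3
          by (simp add: defs indicator_def distrib_right)
      qed
    qed
  qed simp_all
qed

text \<open>The strips share a right end outside the support and the jump lines cancel as before;
  only the base flux \<open>c'\<close> at x = a is left, with the sign of a left end.\<close>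

lemma weak_form_outgoing:
  assumes T: "0 < T" and test: "test_function ({a..} \<times> {0<..<T}) \<phi> \<phi>x \<phi>t"
    and s: "0 \<le> s1" "0 \<le> s2"
    and u: "\<And>x t. 0 < t \<Longrightarrow> u x t = step c d1 s1 d2 s2 ((x - a) / t)"
    and w: "\<And>x t. 0 < t \<Longrightarrow> w x t = step c' (s1 * d1) s1 (s2 * d2) s2 ((x - a) / t)"
  shows "weak_form {a<..} T u w \<phi>x \<phi>t = - c' * (LINT t:{0<..<T}|lebesgue. \<phi> a t)"
proof -
  interpret test_strip "{a..}" T \<phi> \<phi>x \<phi>t
    by unfold_locales (use T test at_within_half_line in auto)
  obtain t\<^sub>0 t\<^sub>1 L where L: "0 < L" and van: "\<And>x t. x \<in> {a..} \<Longrightarrow> t \<in> {0<..<T} \<Longrightarrow> L \<le> \<bar>x\<bar> \<Longrightarrow>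
      \<phi> x t = 0 \<and> \<phi>x x t = 0 \<and> \<phi>t x t = 0"
    using vanishing by blast
  \<comment> \<open>Beyond the support and, for all times up to \<open>T\<close>, beyond both jump
    lines, so that no strip is reversed.\<close>
  define r where "r = a + \<bar>a\<bar> + L + s1 * T + s2 * T"
  have sT: "0 \<le> s1 * T" "0 \<le> s2 * T" using s T by simp_all
  have r: "a \<le> r" "a + s1 * t \<le> r" "a + s2 * t \<le> r" "0 \<le> s1 * t" "0 \<le> s2 * t" if "t \<in> {0<..<T}" for t
  proof -
    have "s1 * t \<le> s1 * T" "s2 * t \<le> s2 * T" using s that by (auto intro: mult_left_mono)
    then show "a \<le> r" "a + s1 * t \<le> r" "a + s2 * t \<le> r"
      unfolding r_def using sT L abs_ge_zero[of a] by linarith+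
    show "0 \<le> s1 * t" "0 \<le> s2 * t" using s that by simp_all
  qed
  have r_van: "\<phi> x t = 0 \<and> \<phi>x x t = 0 \<and> \<phi>t x t = 0" if "r \<le> x" "t \<in> {0<..<T}" for x t
    using that r(1)[OF that(2)] L sT by (intro van) (auto simp: r_def)
  define p\<^sub>1 \<alpha> \<beta> :: "nat \<Rightarrow> real"
    where "p\<^sub>1 = (\<lambda>k. if k = 0 then 0 else if k = 1 then s1 else s2)"
      and "\<alpha> = (\<lambda>k. if k = 0 then c else if k = 1 then d1 else d2)"
      and "\<beta> = (\<lambda>k. if k = 0 then c' else if k = 1 then s1 * d1 else s2 * d2)"
  note defs = p\<^sub>1_def \<alpha>_def \<beta>_def
  show ?thesis
  proof (rule weak_form_strips[where A = "{0, 1, 2}" and p\<^sub>0 = "\<lambda>_. a" and p\<^sub>1 = p\<^sub>1 and q\<^sub>0 = "\<lambda>_. r" and q\<^sub>1 = "\<lambda>_. 0"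
        and \<alpha> = \<alpha> and \<beta> = \<beta>])
    show "a + p\<^sub>1 k * t \<le> r + 0 * t \<and> {a + p\<^sub>1 k * t..r + 0 * t} \<subseteq> {a..}"
      if "k \<in> {0, 1, 2}" "t \<in> {0<..<T}" for k t
      using that r[of t] by (auto simp: defs)
    show "(\<Sum>k\<in>{0, 1, 2}. (\<beta> k - \<alpha> k * 0) * \<phi> (r + 0 * t) t - (\<beta> k - \<alpha> k * p\<^sub>1 k) * \<phi> (a + p\<^sub>1 k * t) t) =
        - c' * \<phi> a t" if "t \<in> {0<..<T}" for t
      unfolding sum_three using r_van[of r t] that by (simp add: defs algebra_simps)
    show "indicator {a<..} x * (u x t * \<phi>t x t + w x t * \<phi>x x t) =
        (\<Sum>k\<in>{0, 1, 2}. indicator {a + p\<^sub>1 k * t..r + 0 * t} x * (\<alpha> k * \<phi>t x t + \<beta> k * \<phi>x x t))"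
      if t: "t \<in> {0<..<T}" and x: "x \<noteq> a" for t x
    proof -
      consider "x < a" | "a < x" "r < x" | "a < x" "x \<le> r" using x by linarith
      then show ?thesis
      proof cases
        case 1
        then show ?thesis unfolding sum_three using r[OF t] by (simp add: defs indicator_def)
      next
        case 2
        then show ?thesis unfolding sum_three using r_van[of x t] t by simp
      next
        case 3
        have uw: "u x t = c + (if a + s1 * t \<le> x then d1 else 0) + (if a + s2 * t \<le> x then d2 else 0)"
          "w x t = c' + (if a + s1 * t \<le> x then s1 * d1 else 0) + (if a + s2 * t \<le> x then s2 * d2 else 0)"
          using t by (simp_all add: u w step_scaled)
        show ?thesis unfolding sum_three uw using 3
          by (simp add: defs indicator_def distrib_right)
      qed
    qed
  qed simp_all
qed

section \<open>Traces of the flux at the junction\<close>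

lemma speed_tendsto:
  assumes "0 < (t::real)"
  shows "((\<lambda>x. (x - b) / t) \<longlongrightarrow> 0) (at b within V)"
proof -
  have "((\<lambda>x. (x - b) / t) \<longlongrightarrow> (b - b) / t) (at b within V)" using assms by (intro tendsto_intros) auto
  then show ?thesis by simp
qed

text \<open>Near the junction (x - b) / t tends to 0 without attaining it, so it avoids every finite
  set.\<close>

lemma eventually_avoid:
  assumes t: "0 < (t::real)" and S: "finite S"
  shows "\<forall>\<^sub>F x in at b within V. x \<in> V \<and> (x - b) / t \<notin> S"
proof -
  have V: "\<forall>\<^sub>F x in at b within V. x \<in> V \<and> x \<noteq> b" by (simp add: eventually_at_filter)
  have "\<forall>\<^sub>F x in at b within V. (x - b) / t \<noteq> \<sigma>" for \<sigma>
  proof (cases "\<sigma> = 0")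
    case True
    show ?thesis using V by eventually_elim (use True t in simp)
  next
    case False
    then show ?thesis by (intro tendsto_imp_eventually_ne[OF speed_tendsto[OF t]]) simp
  qed
  then have "\<forall>\<^sub>F x in at b within V. \<forall>\<sigma>\<in>S. (x - b) / t \<noteq> \<sigma>" using S by (intro eventually_ball_finite) auto
  with V show ?thesis by eventually_elim auto
qed

context pl_road begin

text \<open>At time \<open>t\<close> a jump of negative speed has left a neighbourhood of the
  junction, and a jump of speed zero has flux height \<open>s * d = 0\<close>; neither affects the
  trace.\<close>

lemma incoming_trace:
  assumes prof: "incoming_profile u0 \<gamma> U W" and t: "0 < t" and S: "finite S"
    and w: "\<And>x. x < b \<Longrightarrow> (x - b) / t \<notin> S \<Longrightarrow> w x = W ((x - b) / t)"
  shows "(w \<longlongrightarrow> \<gamma>) (at_left b)"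
proof -
  obtain c d1 s1 d2 s2 where W: "W = step c (s1 * d1) s1 (s2 * d2) s2" and s: "s1 \<le> 0" "s2 \<le> 0"
    and \<gamma>: "c + s1 * d1 + s2 * d2 = \<gamma>"
    using prof unfolding incoming_profile_def by blast
  have jump: "\<forall>\<^sub>F x in at_left b. (if s \<le> (x - b) / t then s * d else 0) = s * d" if "s \<le> 0" for s d
  proof (cases "s < 0")
    case True
    show ?thesis using order_tendstoD(1)[OF speed_tendsto[OF t] True] by eventually_elim auto
  next
    case False
    with that have "s = 0" by simp
    then show ?thesis by simp
  qed
  have "\<forall>\<^sub>F x in at_left b. w x = \<gamma>"
    using jump[OF s(1), of d1] jump[OF s(2), of d2] eventually_avoid[OF t S]
  proof eventually_elim
    case (elim x)
    then have "w x = W ((x - b) / t)" by (intro w) auto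
    also have "\<dots> = c + s1 * d1 + s2 * d2" unfolding W step_def elim(1,2) ..
    finally show ?case using \<gamma> by simp
  qed
  then show ?thesis by (rule tendsto_eventually)
qed

lemma outgoing_trace:
  assumes prof: "outgoing_profile s0 \<gamma> U W" and t: "0 < t" and S: "finite S"
    and w: "\<And>x. a < x \<Longrightarrow> (x - a) / t \<notin> S \<Longrightarrow> w x = W ((x - a) / t)"
  shows "(w \<longlongrightarrow> \<gamma>) (at_right a)"
proof -
  obtain d1 s1 d2 s2 where W: "W = step \<gamma> (s1 * d1) s1 (s2 * d2) s2" and s: "0 \<le> s1" "0 \<le> s2"
    using prof unfolding outgoing_profile_def by blast
  have jump: "\<forall>\<^sub>F x in at_right a. (if s \<le> (x - a) / t then s * d else 0) = 0" if "0 \<le> s" for s d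
  proof (cases "0 < s")
    case True
    show ?thesis using order_tendstoD(2)[OF speed_tendsto[OF t] True] by eventually_elim auto
  next
    case False
    with that have "s = 0" by simp
    then show ?thesis by simp
  qed
  have "\<forall>\<^sub>F x in at_right a. w x = \<gamma>"
    using jump[OF s(1), of d1] jump[OF s(2), of d2] eventually_avoid[OF t S]
  proof eventually_elim
    case (elim x)
    then have "w x = W ((x - a) / t)" by (intro w) auto
    also have "\<dots> = \<gamma>" unfolding W step_def elim(1,2) by simp
    finally show ?case .
  qed
  then show ?thesis by (rule tendsto_eventually)
qed

end

text \<open>Affinity and the zeros at 0 and \<open>umax F\<close> leave only two parameters, the
  slopes \<alpha> and -\<kappa> of the branches.\<close>

lemma valid_flux_pl_road:
  assumes "valid_flux F"
  shows "\<exists>\<alpha> \<kappa>. pl_road F \<alpha> \<kappa>"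
proof -
  note v = assms[unfolded valid_flux_def]
  obtain p q where b1: "\<And>x. branch1 F x = p * x + q" using v by (auto simp: affine_fun_def)
  obtain p' q' where b2: "\<And>x. branch2 F x = p' * x + q'" using v by (auto simp: affine_fun_def)
  have us: "0 < ustar F" "ustar F < umax F" using v by auto
  have q: "q = 0" using v us b1[of 0] by (simp add: flux_def)
  have q': "q' = - p' * umax F" using v us b2[of "umax F"] by (simp add: flux_def)
  have "branch1 F 0 < branch1 F 1" using v by (auto simp: strict_mono_def)
  then have p: "0 < p" by (simp add: b1)
  have "branch2 F 1 < branch2 F 0"
    using v monotone_onD[of UNIV "(<)" "(>)" "branch2 F" 0 1] by simp
  then have p': "0 < - p'" by (simp add: b2)
  have "pl_road F p (- p')"
  proof
    show "branch1 F = (\<lambda>x. p * x)" by (simp add: fun_eq_iff b1 q)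
    show "branch2 F = (\<lambda>x. - p' * (umax F - x))" by (simp add: fun_eq_iff b2 q' algebra_simps)
    show "- p' * (umax F - ustar F) < p * ustar F" using v by (simp add: b1 b2 q q' algebra_simps)
  qed (use v p p' in auto)
  then show ?thesis by blast
qed

subsection \<open>Solutions at the junction\<close>

text \<open>The form in which waves are determined; the profile serves as a common reference for two
  solutions.\<close>

definition agrees_on ::
  "real set \<Rightarrow> real \<Rightarrow> (real \<Rightarrow> real \<Rightarrow> real) \<Rightarrow> (real \<Rightarrow> real \<Rightarrow> real) \<Rightarrow> (real \<Rightarrow> real) \<Rightarrow> (real \<Rightarrow> real) \<Rightarrow> bool" where
  "agrees_on I b u w U W \<longleftrightarrow> (\<exists>S. finite S \<and> (\<forall>x\<in>I. \<forall>t>0. (x - b) / t \<notin> S \<longrightarrow>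
     u x t = U ((x - b) / t) \<and> w x t = W ((x - b) / t)))"

lemma agrees_on_AE:
  assumes 1: "agrees_on I b u w U W" and 2: "agrees_on I b u' w' U W"
  shows "AE (x, t) in lebesgue. x \<in> I \<and> 0 \<le> t \<longrightarrow> u x t = u' x t \<and> w x t = w' x t"
proof -
  from 1 obtain S where S: "finite S" and e: "\<forall>x\<in>I. \<forall>t>0. (x - b) / t \<notin> S \<longrightarrow>
      u x t = U ((x - b) / t) \<and> w x t = W ((x - b) / t)"
    unfolding agrees_on_def by (elim exE conjE) (rule that)
  from 2 obtain S' where S': "finite S'" and e': "\<forall>x\<in>I. \<forall>t>0. (x - b) / t \<notin> S' \<longrightarrow>
      u' x t = U ((x - b) / t) \<and> w' x t = W ((x - b) / t)"
    unfolding agrees_on_def by (elim exE conjE) (rule that)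
  have "AE (x, t) in lebesgue. 0 \<le> t \<longrightarrow> (x \<in> I \<and> 0 \<le> t \<longrightarrow> u x t = u' x t \<and> w x t = w' x t)"
  proof (rule AE_off_rays[of "S \<union> S'" b])
    fix x t :: real assume "0 < t" "(x - b) / t \<notin> S \<union> S'"
    then show "x \<in> I \<and> 0 \<le> t \<longrightarrow> u x t = u' x t \<and> w x t = w' x t"
      using e[rule_format, of x t] e'[rule_format, of x t] by simp
  qed (use S S' in simp)
  then show ?thesis by (rule eventually_mono) auto
qed

context pl_road begin

lemma flux_in_ftilde: "u \<in> {0..um} \<Longrightarrow> flux F u \<in> ftilde F u"
  using jump by (auto simp: ftilde_def flux_def branch1_eq branch2_eq)

text \<open>Reduces an arbitrary competitor to a point of the linear program: its traces are
  constant in time and obey the capacities, and together they fix the competitor on the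
  roads.\<close>

lemma junction_fluxes:
  fixes b :: "'n::finite \<Rightarrow> real" and a :: "'m::finite \<Rightarrow> real" and A :: "real^'m^'n"
  assumes uin0: "\<And>i. uin0 i \<in> {0..um}" and uout0: "\<And>j. uout0 j \<in> {0..um}"
    and win0: "\<And>i. win0 i \<in> ftilde F (uin0 i)"
    and wave: "wave_form F b a uin0 win0 uout0 free s" and dist: "distribution_condition b a A s"
  shows "\<exists>\<gamma> \<delta>. (\<forall>i. \<gamma> i \<in> {0..capacity_in (uin0 i)}) \<and>
    (\<forall>j. \<delta> j \<in> {0..capacity_out (outgoing_datum F (uout0 j) (free j))}) \<and>
    (\<forall>j. \<delta> j = (\<Sum>i\<in>UNIV. A $ i $ j * \<gamma> i)) \<and>
    (\<forall>t>0. throughput b s t = (\<Sum>i\<in>UNIV. \<gamma> i)) \<and>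
    (\<forall>i U W. incoming_profile (uin0 i) (\<gamma> i) U W \<longrightarrow> agrees_on {..<b i} (b i) (uin s i) (win s i) U W) \<and>
    (\<forall>j U W. outgoing_profile (outgoing_datum F (uout0 j) (free j)) (\<delta> j) U W \<longrightarrow>
      agrees_on {a j<..} (a j) (uout s j) (wout s j) U W)"
proof -
  let ?s0 = "\<lambda>j. outgoing_datum F (uout0 j) (free j)"
  define w0 where "w0 = (\<lambda>j. snd (?s0 j))"
  have s0: "?s0 j = (uout0 j, w0 j)" and w0: "w0 j \<in> ftilde F (uout0 j)" for j
    using outgoing_datum[OF uout0, of j "free j"] by (simp_all add: w0_def prod_eq_iff)
  have "\<forall>i. \<exists>\<omega>. \<omega> \<in> {0..capacity_in (uin0 i)} \<and>
      (\<forall>U W. incoming_profile (uin0 i) \<omega> U W \<longrightarrow> agrees_on {..<b i} (b i) (uin s i) (win s i) U W)"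
  proof
    fix i
    obtain v \<omega> where "\<omega> \<in> ftilde F v" "incoming_wave F (b i) (uin0 i, win0 i) (v, \<omega>) (uin s i) (win s i)"
      using wave unfolding wave_form_def by blast
    from incoming_wave_determined[OF uin0 win0 this]
    show "\<exists>\<omega>. \<omega> \<in> {0..capacity_in (uin0 i)} \<and>
      (\<forall>U W. incoming_profile (uin0 i) \<omega> U W \<longrightarrow> agrees_on {..<b i} (b i) (uin s i) (win s i) U W)"
      unfolding agrees_on_def Ball_def lessThan_iff by blast
  qed
  from choice[OF this] obtain \<gamma> where \<gamma>: "\<And>i. \<gamma> i \<in> {0..capacity_in (uin0 i)}"
    "\<And>i U W. incoming_profile (uin0 i) (\<gamma> i) U W \<Longrightarrow> agrees_on {..<b i} (b i) (uin s i) (win s i) U W" by blast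
  have "\<forall>j. \<exists>\<omega>. \<omega> \<in> {0..capacity_out (?s0 j)} \<and>
      (\<forall>U W. outgoing_profile (?s0 j) \<omega> U W \<longrightarrow> agrees_on {a j<..} (a j) (uout s j) (wout s j) U W)"
  proof
    fix j
    obtain v \<omega> where "\<omega> \<in> ftilde F v" "outgoing_wave F (a j) (uout0 j, w0 j) (v, \<omega>) (uout s j) (wout s j)"
      using wave unfolding wave_form_def s0 by blast
    from outgoing_wave_determined[OF w0 this]
    show "\<exists>\<omega>. \<omega> \<in> {0..capacity_out (?s0 j)} \<and>
      (\<forall>U W. outgoing_profile (?s0 j) \<omega> U W \<longrightarrow> agrees_on {a j<..} (a j) (uout s j) (wout s j) U W)"
      unfolding agrees_on_def Ball_def greaterThan_iff s0 by blast
  qed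
  from choice[OF this] obtain \<delta> where \<delta>: "\<And>j. \<delta> j \<in> {0..capacity_out (?s0 j)}"
    "\<And>j U W. outgoing_profile (?s0 j) (\<delta> j) U W \<Longrightarrow> agrees_on {a j<..} (a j) (uout s j) (wout s j) U W" by blast
  have tr_in: "((\<lambda>x. win s i x t) \<longlongrightarrow> \<gamma> i) (at_left (b i))" if t: "0 < t" for i t
  proof -
    \<comment> \<open>The competitor is given by no explicit profile, so its trace is read off the
      canonical profile with the same flux.\<close>
    obtain U W where prof: "incoming_profile (uin0 i) (\<gamma> i) U W"
      using ex_incoming_profile[OF uin0 \<gamma>(1)] by blast
    from \<gamma>(2)[OF prof] obtain S where "finite S" "\<And>x. x < b i \<Longrightarrow> (x - b i) / t \<notin> S \<Longrightarrow>
        win s i x t = W ((x - b i) / t)"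
      using t unfolding agrees_on_def Ball_def lessThan_iff by blast
    then show ?thesis by (rule incoming_trace[OF prof t])
  qed
  have tr_out: "((\<lambda>x. wout s j x t) \<longlongrightarrow> \<delta> j) (at_right (a j))" if t: "0 < t" for j t
  proof -
    obtain U W where prof: "outgoing_profile (?s0 j) (\<delta> j) U W"
      using ex_outgoing_profile[OF w0] \<delta>(1)[of j] unfolding s0 by blast
    from \<delta>(2)[OF prof] obtain S where "finite S" "\<And>x. a j < x \<Longrightarrow> (x - a j) / t \<notin> S \<Longrightarrow>
        wout s j x t = W ((x - a j) / t)"
      using t unfolding agrees_on_def Ball_def greaterThan_iff by blast
    then show ?thesis by (rule outgoing_trace[OF prof t])
  qed
  have "\<delta> j = (\<Sum>i\<in>UNIV. A $ i $ j * \<gamma> i)" for j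
  proof -
    \<comment> \<open>One positive time suffices, since the traces found above do not depend on
      time.\<close>
    obtain \<gamma>' \<delta>' where g: "\<And>i. ((\<lambda>x. win s i x 1) \<longlongrightarrow> \<gamma>' i) (at_left (b i))"
      and d: "\<And>j. ((\<lambda>x. wout s j x 1) \<longlongrightarrow> \<delta>' j) (at_right (a j))"
      and eq: "\<And>j. \<delta>' j = (\<Sum>i\<in>UNIV. A $ i $ j * \<gamma>' i)"
      using dist zero_less_one unfolding distribution_condition_def by blast
    have "\<gamma>' i = \<gamma> i" for i
      using tendsto_unique[OF _ g tr_in[OF zero_less_one]] by simp
    moreover have "\<delta>' j = \<delta> j"
      using tendsto_unique[OF _ d tr_out[OF zero_less_one]] by simp
    ultimately show ?thesis using eq[of j] by simp
  qed
  moreover have "throughput b s t = (\<Sum>i\<in>UNIV. \<gamma> i)" if "0 < t" for t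
    unfolding throughput_def by (intro sum.cong refl tendsto_Lim tr_in that) simp
  ultimately show ?thesis using \<gamma> \<delta> by blast
qed

end

section \<open>Construction of the solution and comparison with competitors\<close>

theorem theorem3p7:
  fixes F :: pl_flux
    and b :: "'n::finite \<Rightarrow> real" and a :: "'m::finite \<Rightarrow> real"
    and A :: "real^'m^'n"
    and uin0 :: "'n \<Rightarrow> real" and uout0 :: "'m \<Rightarrow> real" and free :: "'m \<Rightarrow> bool"
  assumes "valid_flux F"
    and "CARD('n) \<le> CARD('m)"
    and "distribution_matrix A"
    and "\<forall>i. uin0 i \<in> {0..umax F}"
    and "\<forall>j. uout0 j \<in> {0..umax F}"
  shows "\<exists>s. \<forall>win0. (\<forall>i. win0 i \<in> ftilde F (uin0 i)) \<longrightarrow>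
      wave_form F b a uin0 win0 uout0 free s \<and>
      admissible F b a A uin0 win0 uout0 free s \<and>
      (\<forall>s'. wave_form F b a uin0 win0 uout0 free s' \<and>
            admissible F b a A uin0 win0 uout0 free s' \<longrightarrow> same_solution b a s' s) \<and>
      (\<forall>i. \<exists>v\<in>incoming_states F (uin0 i). \<exists>\<omega>\<in>ftilde F v.
         incoming_wave F (b i) (uin0 i, win0 i) (v, \<omega>) (uin s i) (win s i)) \<and>
      (\<forall>j. \<exists>v\<in>outgoing_states F (uout0 j) (free j). \<exists>\<omega>\<in>ftilde F v.
         outgoing_wave F (a j) (outgoing_datum F (uout0 j) (free j)) (v, \<omega>) (uout s j) (wout s j))"
proof -
  obtain \<alpha> \<kappa> where "pl_road F \<alpha> \<kappa>" using valid_flux_pl_road[OF assms(1)] by blast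
  then interpret pl_road F \<alpha> \<kappa> .
  note A = assms(3)
  have uin0: "uin0 i \<in> {0..umax F}" and uout0: "uout0 j \<in> {0..umax F}" for i j
    using assms(4,5) by auto
  let ?s0 = "\<lambda>j. outgoing_datum F (uout0 j) (free j)"
  define \<Gamma> where "\<Gamma> = (\<lambda>i. capacity_in (uin0 i))"
  define \<Delta> where "\<Delta> = (\<lambda>j. capacity_out (?s0 j))"
  define w0 where "w0 = (\<lambda>j. snd (?s0 j))"
  have s0: "?s0 j = (uout0 j, w0 j)" and w0: "w0 j \<in> ftilde F (uout0 j)" for j
    using outgoing_datum[OF uout0, of j "free j"] by (simp_all add: w0_def prod_eq_iff)
  have row: "(\<Sum>j\<in>UNIV. A $ i $ j) = 1" and A_nonneg: "0 \<le> A $ i $ j" for i j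
    using A by (auto simp: distribution_matrix_def)
  have \<Gamma>_nonneg: "0 \<le> \<Gamma> i" for i using uin0[of i] \<alpha>_pos ustar_pos by (simp add: \<Gamma>_def capacity_in_def)
  have \<Delta>_nonneg: "0 \<le> \<Delta> j" for j using capacity_out_le[OF w0, of j] by (simp add: \<Delta>_def s0)
  obtain g where g: "g \<in> feasible A \<Gamma> \<Delta>"
    and g_max: "\<And>y. y \<in> feasible A \<Gamma> \<Delta> \<Longrightarrow> (\<Sum>i\<in>UNIV. y $ i) \<le> (\<Sum>i\<in>UNIV. g $ i)"
    using feasible_maximum_exists[of \<Gamma> \<Delta> A, OF \<Gamma>_nonneg \<Delta>_nonneg] by blast
  define \<gamma> where "\<gamma> = (\<lambda>i. g $ i)"
  define \<delta> where "\<delta> = (\<lambda>j. \<Sum>i\<in>UNIV. A $ i $ j * \<gamma> i)"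
  have \<gamma>: "\<gamma> i \<in> {0..capacity_in (uin0 i)}" for i using g by (simp add: feasible_def \<Gamma>_def \<gamma>_def)
  have \<delta>: "\<delta> j \<in> {0..capacity_out (?s0 j)}" for j
    using g \<gamma> A_nonneg by (auto simp: feasible_def \<Delta>_def \<delta>_def \<gamma>_def intro!: sum_nonneg)
  \<comment> \<open>The row sums turn the distribution rule into conservation at the junction,
    needed for the weak form.\<close>
  have sum_\<delta>: "(\<Sum>j\<in>UNIV. \<delta> j) = (\<Sum>i\<in>UNIV. \<gamma> i)"
  proof -
    have "(\<Sum>j\<in>UNIV. \<delta> j) = (\<Sum>i\<in>UNIV. (\<Sum>j\<in>UNIV. A $ i $ j) * \<gamma> i)"
      unfolding \<delta>_def sum_distrib_right by (rule sum.swap)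
    then show ?thesis by (simp add: row)
  qed
  have "\<forall>i. \<exists>UW. incoming_profile (uin0 i) (\<gamma> i) (fst UW) (snd UW)"
    using ex_incoming_profile[OF uin0 \<gamma>] by simp
  from choice[OF this] obtain P where P: "\<And>i. incoming_profile (uin0 i) (\<gamma> i) (fst (P i)) (snd (P i))" by blast
  have "\<forall>j. \<exists>UW. outgoing_profile (?s0 j) (\<delta> j) (fst UW) (snd UW)"
    using ex_outgoing_profile[OF w0, folded s0, OF \<delta>] by simp
  from choice[OF this] obtain Q where Q: "\<And>j. outgoing_profile (?s0 j) (\<delta> j) (fst (Q j)) (snd (Q j))" by blast
  \<comment> \<open>The definition does not mention \<open>win0\<close>, as the order of quantifiers
    requires. At t = 0 the density is the datum and the flux one fixed selection from
    \<open>ftilde\<close>.\<close>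
  define s :: "('n, 'm) junction_sol" where "s = \<lparr>
    uin = (\<lambda>i x t. if 0 < t then fst (P i) ((x - b i) / t) else uin0 i),
    win = (\<lambda>i x t. if 0 < t then snd (P i) ((x - b i) / t) else flux F (uin0 i)),
    uout = (\<lambda>j x t. if 0 < t then fst (Q j) ((x - a j) / t) else uout0 j),
    wout = (\<lambda>j x t. if 0 < t then snd (Q j) ((x - a j) / t) else flux F (uout0 j))\<rparr>"
  have s_in: "uin s i x t = (if 0 < t then fst (P i) ((x - b i) / t) else uin0 i)"
      "win s i x t = (if 0 < t then snd (P i) ((x - b i) / t) else flux F (uin0 i))"
    and s_out: "uout s j x t = (if 0 < t then fst (Q j) ((x - a j) / t) else uout0 j)"
      "wout s j x t = (if 0 < t then snd (Q j) ((x - a j) / t) else flux F (uout0 j))" for i j x t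
    by (simp_all add: s_def)
  have agree_in: "agrees_on {..<b i} (b i) (uin s i) (win s i) (fst (P i)) (snd (P i))" for i
    unfolding agrees_on_def by (intro exI[of _ "{}"]) (simp add: s_in)
  have agree_out: "agrees_on {a j<..} (a j) (uout s j) (wout s j) (fst (Q j)) (snd (Q j))" for j
    unfolding agrees_on_def by (intro exI[of _ "{}"]) (simp add: s_out)
  have in_wave: "\<exists>v\<in>incoming_states F (uin0 i). \<exists>\<omega>\<in>ftilde F v. \<forall>w0\<in>ftilde F (uin0 i).
      incoming_wave F (b i) (uin0 i, w0) (v, \<omega>) (uin s i) (win s i)" for i
    by (rule incoming_wave_exists[OF uin0 \<gamma> P]) (simp add: s_in)
  have out_wave: "\<exists>v\<in>outgoing_states F (uout0 j) (free j). \<exists>\<omega>\<in>ftilde F v.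
      outgoing_wave F (a j) (?s0 j) (v, \<omega>) (uout s j) (wout s j)" for j
    by (rule outgoing_wave_exists[OF uout0 refl \<delta> Q]) (simp add: s_out)
  have wave: "wave_form F b a uin0 win0 uout0 free s" if "\<And>i. win0 i \<in> ftilde F (uin0 i)" for win0
    unfolding wave_form_def using in_wave out_wave that by meson
  have steps_in: "\<exists>c w d1 s1 d2 s2. fst (P i) = step c d1 s1 d2 s2 \<and>
      snd (P i) = step w (s1 * d1) s1 (s2 * d2) s2 \<and> s1 \<le> 0 \<and> s2 \<le> 0 \<and> w + s1 * d1 + s2 * d2 = \<gamma> i" for i
    using P[of i] unfolding incoming_profile_def by blast
  have steps_out: "\<exists>c d1 s1 d2 s2. fst (Q j) = step c d1 s1 d2 s2 \<and>
      snd (Q j) = step (\<delta> j) (s1 * d1) s1 (s2 * d2) s2 \<and> 0 \<le> s1 \<and> 0 \<le> s2" for j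
    using Q[of j] unfolding outgoing_profile_def by blast
  have bv_in: "bounded_variation_on I (\<lambda>x. uin s i x t)" for i t I
  proof (cases "0 < t")
    case True
    then show ?thesis using steps_in[of i] by (auto simp: s_in intro: bounded_variation_step)
  qed (simp add: s_in bounded_variation_const)
  have bv_out: "bounded_variation_on I (\<lambda>x. uout s j x t)" for j t I
  proof (cases "0 < t")
    case True
    then show ?thesis using steps_out[of j] by (auto simp: s_out intro: bounded_variation_step)
  qed (simp add: s_out bounded_variation_const)
  have road_in: "road_pair F {..<b i} (uin s i) (win s i)" for i
  proof -
    have "(if 0 < t then snd (P i) ((x - b i) / t) else flux F (uin0 i)) \<in>
        ftilde F (if 0 < t then fst (P i) ((x - b i) / t) else uin0 i)" for x t
      using P[of i] flux_in_ftilde[OF uin0] by (simp add: incoming_profile_def)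
    moreover obtain c w d1 s1 d2 s2 where "fst (P i) = step c d1 s1 d2 s2"
      "snd (P i) = step w (s1 * d1) s1 (s2 * d2) s2" using steps_in[of i] by blast
    ultimately show ?thesis unfolding road_pair_def s_in
      by (intro conjI) (simp_all only: set_borel_measurable_step simp_thms, auto intro!: AE_I2)
  qed
  have road_out: "road_pair F {a j<..} (uout s j) (wout s j)" for j
  proof -
    have "(if 0 < t then snd (Q j) ((x - a j) / t) else flux F (uout0 j)) \<in>
        ftilde F (if 0 < t then fst (Q j) ((x - a j) / t) else uout0 j)" for x t
      using Q[of j] flux_in_ftilde[OF uout0] by (simp add: outgoing_profile_def)
    moreover obtain c d1 s1 d2 s2 where "fst (Q j) = step c d1 s1 d2 s2"
      "snd (Q j) = step (\<delta> j) (s1 * d1) s1 (s2 * d2) s2" using steps_out[of j] by blast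
    ultimately show ?thesis unfolding road_pair_def s_out
      by (intro conjI) (simp_all only: set_borel_measurable_step simp_thms, auto intro!: AE_I2)
  qed
  have weak: "weak_solution F b a uin0 uout0 s"
    unfolding weak_solution_def
  proof (intro conjI allI impI road_in road_out)
    fix T :: real and \<phi> \<phi>x \<phi>t \<psi> \<psi>x \<psi>t
    assume T: "0 < T" and test: "(\<forall>i. test_function ({..b i} \<times> {0<..<T}) (\<phi> i) (\<phi>x i) (\<phi>t i)) \<and>
      (\<forall>j. test_function ({a j..} \<times> {0<..<T}) (\<psi> j) (\<psi>x j) (\<psi>t j)) \<and>
      (\<forall>i j. \<forall>t\<in>{0<..<T}. \<phi> i (b i) t = \<psi> j (a j) t \<and> \<phi>x i (b i) t = \<psi>x j (a j) t)"
    \<comment> \<open>Any outgoing road will do: by the matching condition the boundary values of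
      all test functions have the same time integral \<open>J\<close>.\<close>
    obtain j\<^sub>0 :: 'm where True by blast
    define J where "J = (LINT t:{0<..<T}|lebesgue. \<psi> j\<^sub>0 (a j\<^sub>0) t)"
    have J_in: "(LINT t:{0<..<T}|lebesgue. \<phi> i (b i) t) = J" for i
      unfolding J_def by (rule set_lebesgue_integral_cong) (use test in auto)
    have J_out: "(LINT t:{0<..<T}|lebesgue. \<psi> j (a j) t) = J" for j
    proof -
      have "(LINT t:{0<..<T}|lebesgue. \<phi> i (b i) t) = (LINT t:{0<..<T}|lebesgue. \<psi> j (a j) t)" for i
        by (rule set_lebesgue_integral_cong) (use test in auto)
      then show ?thesis using J_in by simp
    qed
    have "weak_form {..<b i} T (uin s i) (win s i) (\<phi>x i) (\<phi>t i) = \<gamma> i * J" for i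
    proof -
      obtain c w d1 s1 d2 s2 where st: "fst (P i) = step c d1 s1 d2 s2"
        "snd (P i) = step w (s1 * d1) s1 (s2 * d2) s2" "s1 \<le> 0" "s2 \<le> 0" "w + s1 * d1 + s2 * d2 = \<gamma> i"
        using steps_in by blast
      have "weak_form {..<b i} T (uin s i) (win s i) (\<phi>x i) (\<phi>t i) =
          (w + s1 * d1 + s2 * d2) * (LINT t:{0<..<T}|lebesgue. \<phi> i (b i) t)"
        by (rule weak_form_incoming[OF T _ st(3,4)]) (use test st in \<open>auto simp: s_in\<close>)
      then show ?thesis unfolding J_in st(5) .
    qed
    moreover have "weak_form {a j<..} T (uout s j) (wout s j) (\<psi>x j) (\<psi>t j) = - \<delta> j * J" for j
    proof -
      obtain c d1 s1 d2 s2 where st: "fst (Q j) = step c d1 s1 d2 s2"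
        "snd (Q j) = step (\<delta> j) (s1 * d1) s1 (s2 * d2) s2" "0 \<le> s1" "0 \<le> s2"
        using steps_out by blast
      have "weak_form {a j<..} T (uout s j) (wout s j) (\<psi>x j) (\<psi>t j) =
          - \<delta> j * (LINT t:{0<..<T}|lebesgue. \<psi> j (a j) t)"
        by (rule weak_form_outgoing[OF T _ st(3,4)]) (use test st in \<open>auto simp: s_out\<close>)
      then show ?thesis unfolding J_out .
    qed
    ultimately have "(\<Sum>i\<in>UNIV. weak_form {..<b i} T (uin s i) (win s i) (\<phi>x i) (\<phi>t i)) +
        (\<Sum>j\<in>UNIV. weak_form {a j<..} T (uout s j) (wout s j) (\<psi>x j) (\<psi>t j)) =
        (\<Sum>i\<in>UNIV. \<gamma> i) * J - (\<Sum>j\<in>UNIV. \<delta> j) * J"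
      by (simp add: sum_distrib_right sum_negf)
    then show "(\<Sum>i\<in>UNIV. weak_form {..<b i} T (uin s i) (win s i) (\<phi>x i) (\<phi>t i)) +
        (\<Sum>j\<in>UNIV. weak_form {a j<..} T (uout s j) (wout s j) (\<psi>x j) (\<psi>t j)) = 0"
      by (simp add: sum_\<delta>)
  qed (simp_all add: s_in s_out)
  have trace: "((\<lambda>x. win s i x t) \<longlongrightarrow> \<gamma> i) (at_left (b i))"
      "((\<lambda>x. wout s j x t) \<longlongrightarrow> \<delta> j) (at_right (a j))" if t: "0 < t" for i j t
    by (rule incoming_trace[OF P t, of "{}"] outgoing_trace[OF Q t, of "{}"]; use t in \<open>simp add: s_in s_out\<close>)+
  have dist: "distribution_condition b a A s"
    unfolding distribution_condition_def
    by (intro allI impI exI[of _ \<gamma>] exI[of _ \<delta>] conjI trace) (simp_all add: \<delta>_def)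
  have through: "throughput b s t = (\<Sum>i\<in>UNIV. \<gamma> i)" if t: "0 < t" for t
    unfolding throughput_def by (intro sum.cong refl tendsto_Lim trace t) simp
  \<comment> \<open>Serves twice: the throughput of a competitor is that of a feasible point, which
    gives maximality, and the case \<open>y = g\<close> gives uniqueness.\<close>
  have competitor: "\<exists>y\<in>feasible A \<Gamma> \<Delta>. (\<forall>t>0. throughput b s' t = (\<Sum>i\<in>UNIV. y $ i)) \<and>
      (y = g \<longrightarrow> same_solution b a s' s)"
    if win0: "\<And>i. win0 i \<in> ftilde F (uin0 i)" and s': "wave_form F b a uin0 win0 uout0 free s'"
      "distribution_condition b a A s'" for win0 and s' :: "('n, 'm) junction_sol"
  proof -
    obtain \<gamma>' \<delta>' where *: "\<And>i. \<gamma>' i \<in> {0..capacity_in (uin0 i)}" "\<And>j. \<delta>' j \<in> {0..capacity_out (?s0 j)}"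
      "\<And>j. \<delta>' j = (\<Sum>i\<in>UNIV. A $ i $ j * \<gamma>' i)" "\<And>t. 0 < t \<Longrightarrow> throughput b s' t = (\<Sum>i\<in>UNIV. \<gamma>' i)"
      "\<And>i U W. incoming_profile (uin0 i) (\<gamma>' i) U W \<Longrightarrow> agrees_on {..<b i} (b i) (uin s' i) (win s' i) U W"
      "\<And>j U W. outgoing_profile (?s0 j) (\<delta>' j) U W \<Longrightarrow> agrees_on {a j<..} (a j) (uout s' j) (wout s' j) U W"
      using junction_fluxes[OF uin0 uout0 win0 s'] by blast
    define y :: "real^'n" where "y = (\<chi> i. \<gamma>' i)"
    have "y \<in> feasible A \<Gamma> \<Delta>"
      using *(1) *(2) by (auto simp: feasible_def \<Gamma>_def \<Delta>_def y_def *(3)[symmetric])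
    moreover have "same_solution b a s' s" if "y = g"
    proof -
      have e: "\<gamma>' = \<gamma>" using that by (auto simp: y_def \<gamma>_def fun_eq_iff)
      then have e': "\<delta>' = \<delta>" by (simp add: fun_eq_iff *(3) \<delta>_def)
      show ?thesis unfolding same_solution_def
        using agrees_on_AE[OF *(5)[unfolded e, OF P] agree_in]
          agrees_on_AE[OF *(6)[unfolded e', OF Q] agree_out]
        unfolding lessThan_iff greaterThan_iff by blast
    qed
    ultimately show ?thesis using *(4) by (intro bexI[of _ y]) (auto simp: y_def)
  qed
  show ?thesis
  proof (rule exI[of _ s], intro allI impI conjI)
    fix win0 assume "\<forall>i. win0 i \<in> ftilde F (uin0 i)"
    then have win0: "\<And>i. win0 i \<in> ftilde F (uin0 i)" by blast
    show "wave_form F b a uin0 win0 uout0 free s" by (rule wave[OF win0])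
    show "admissible F b a A uin0 win0 uout0 free s"
      unfolding admissible_def
    proof (intro conjI allI impI bv_in bv_out weak dist)
      fix s' :: "('n, 'm) junction_sol" and t :: real
      assume s': "wave_form F b a uin0 win0 uout0 free s' \<and> weak_solution F b a uin0 uout0 s' \<and>
        distribution_condition b a A s'" and t: "0 < t"
      obtain y where "y \<in> feasible A \<Gamma> \<Delta>" "throughput b s' t = (\<Sum>i\<in>UNIV. y $ i)"
        using competitor[of win0 s'] win0 s' t by blast
      then show "throughput b s' t \<le> throughput b s t"
        using g_max[of y] by (simp add: through[OF t] \<gamma>_def)
    qed
    show "same_solution b a s' s"
      if "wave_form F b a uin0 win0 uout0 free s' \<and> admissible F b a A uin0 win0 uout0 free s'" for s'
    proof -
      \<comment> \<open>\<open>s\<close> competes in the maximality condition of \<open>s'\<close>,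
        so the feasible point belonging to \<open>s'\<close> is a maximizer too.\<close>
      have s': "wave_form F b a uin0 win0 uout0 free s'" "distribution_condition b a A s'"
        and le: "throughput b s 1 \<le> throughput b s' 1"
        using that wave[OF win0] weak dist by (auto simp: admissible_def)
      obtain y where y: "y \<in> feasible A \<Gamma> \<Delta>" "throughput b s' 1 = (\<Sum>i\<in>UNIV. y $ i)"
        "y = g \<longrightarrow> same_solution b a s' s"
        using competitor[OF win0 s'] zero_less_one by blast
      have "g = y"
        by (rule feasible_maximum_unique[OF A g g_max y(1)]) (use le y(2) through[of 1] in \<open>simp_all add: \<gamma>_def\<close>)
      then show ?thesis using y(3) by simp
    qed
    show "\<exists>v\<in>incoming_states F (uin0 i). \<exists>\<omega>\<in>ftilde F v.
         incoming_wave F (b i) (uin0 i, win0 i) (v, \<omega>) (uin s i) (win s i)" for i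
      using in_wave[of i] win0[of i] by blast
    show "\<exists>v\<in>outgoing_states F (uout0 j) (free j). \<exists>\<omega>\<in>ftilde F v.
         outgoing_wave F (a j) (?s0 j) (v, \<omega>) (uout s j) (wout s j)" for j
      by (rule out_wave)
  qed
qed

end
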